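(* Let $m$ be a nonnegative integer and let $\pi$ be a partition with conjugate partition $\pi'$. Then $\dim F^{(n)}_{\pi}=\dim F^{(n+m)}_{\pi'}$ for every nonnegative integer $n$ if and only if $\pi$ has the form $(\alpha+m\mid\alpha)$ in Frobenius notation (for some strictly decreasing sequence $\alpha$ of nonnegative integers, possibly empty).
   Context: Frobenius notation: let $r$ be the length of the main diagonal of the Young diagram of a partition $\pi$. Write $\pi=(\alpha\mid\beta)=(\alpha_1,\dots,\alpha_r\mid\beta_1,\dots,\beta_r)$, where $\alpha_i$ is the number of boxes in row $i$ strictly to the right of the main diagonal, and $\beta_i$ is the number of boxes in column $i$ strictly below the main diagonal; so $\alpha_1>\cdots>\alpha_r\ge 0$ and $\beta_1>\cdots>\beta_r\ge0$. The zero partition corresponds to $r=0$. For a nonnegative integer $m$, $\alpha+m:=(\alpha_1+m,\dots,\alpha_r+m)$. The conjugate partition is obtained by transposing the Young diagram. $F^{(n)}_{\mu}$ denotes the finite-dimensional simple $\mathfrak{gl}_n(\mathbb C)$-module with highest weight $\mu$, where a partition with at most $n$ parts is regarded as a weakly decreasing $n$-tuple by appending zeros. If a partition $\mu$ has more than $n$ parts, then $F^{(n)}_\mu$ is taken to be $0$ (and $\dim F^{(n)}_{0}=1$ for the zero partition $0$, all $n\geq 0$); equivalently, $\dim F^{(n)}_\mu$ is given for all $n\ge0$ by the hook--content formula. *)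

theory Defs
  imports "Jordan_Normal_Form.VS_Connect"
begin

text \<open>A partition is the list of its nonzero parts, so its number of parts is the length of the
  list. Rows and columns of Young diagrams are numbered from 0.\<close>

definition is_partition :: "nat list \<Rightarrow> bool" where
  "is_partition p \<longleftrightarrow> sorted_wrt (\<ge>) p \<and> 0 \<notin> set p"

definition young_diagram :: "nat list \<Rightarrow> (nat \<times> nat) set" where
  "young_diagram p = {(i, j). i < length p \<and> j < p ! i}"

definition conjugate_partition :: "nat list \<Rightarrow> nat list" where
  "conjugate_partition p =
     map (\<lambda>j. card {i. (i, j) \<in> young_diagram p}) [0..<(if p = [] then 0 else hd p)]"

definition diagonal_length :: "nat list \<Rightarrow> nat" where
  "diagonal_length p = card {i. (i, i) \<in> young_diagram p}"

definition frobenius :: "nat list \<Rightarrow> nat list \<times> nat list" where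
  "frobenius p =
     (map (\<lambda>i. card {j. i < j \<and> (i, j) \<in> young_diagram p}) [0..<diagonal_length p],
      map (\<lambda>j. card {i. j < i \<and> (i, j) \<in> young_diagram p}) [0..<diagonal_length p])"

lemma partition_nth_mono:
  assumes "is_partition p" "i \<le> k" "k < length p"
  shows "p ! k \<le> p ! i"
  using assms by (cases "i = k") (auto simp: is_partition_def sorted_wrt_iff_nth_less)

lemma card_column:
  assumes "is_partition p"
  shows "i < card {i. (i, j) \<in> young_diagram p} \<longleftrightarrow> (i, j) \<in> young_diagram p"
proof -
  let ?C = "{i. (i, j) \<in> young_diagram p}"
  have fin: "finite ?C"
    by (rule finite_subset[of _ "{..<length p}"]) (auto simp: young_diagram_def)
  have down: "i \<in> ?C" if "k \<in> ?C" "i \<le> k" for i k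
    using that partition_nth_mono[OF assms that(2)] by (auto simp: young_diagram_def)
  show ?thesis
  proof
    assume "i < card ?C"
    show "(i, j) \<in> young_diagram p"
    proof (rule ccontr)
      assume "(i, j) \<notin> young_diagram p"
      then have "?C \<subseteq> {..<i}"
        using down by (metis (mono_tags) lessThan_iff linorder_not_less mem_Collect_eq subsetI)
      then have "card ?C \<le> i"
        using card_mono[of "{..<i}" ?C] by simp
      with \<open>i < card ?C\<close> show False by simp
    qed
  next
    assume "(i, j) \<in> young_diagram p"
    then have "{..i} \<subseteq> ?C" using down[of i] by auto
    then show "i < card ?C" using card_mono[OF fin, of "{..i}"] by simp
  qed
qed

lemma column_bound:
  assumes "is_partition p" "(i, j) \<in> young_diagram p"
  shows "j < (if p = [] then 0 else hd p)"
  using assms partition_nth_mono[OF assms(1), of 0 i]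
  by (cases p) (auto simp: young_diagram_def)

lemma young_diagram_conjugate_partition:
  assumes "is_partition p"
  shows "young_diagram (conjugate_partition p) = (young_diagram p)\<inverse>"
proof -
  have "(i, j) \<in> young_diagram (conjugate_partition p) \<longleftrightarrow> (j, i) \<in> young_diagram p" for i j
  proof -
    have "(i, j) \<in> young_diagram (conjugate_partition p) \<longleftrightarrow>
        i < (if p = [] then 0 else hd p) \<and> j < card {k. (k, i) \<in> young_diagram p}"
      unfolding young_diagram_def[of "conjugate_partition p"]
      by (simp add: conjugate_partition_def cong: conj_cong)
    then show ?thesis using card_column[OF assms, of j i] column_bound[OF assms, of j i] by blast
  qed
  then show ?thesis by auto
qed

lemma is_partition_conjugate_partition:
  assumes "is_partition p"
  shows "is_partition (conjugate_partition p)"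
proof -
  let ?c = "\<lambda>j. card {i. (i, j) \<in> young_diagram p}"
  have "?c k \<le> ?c j" if "j \<le> k" for j k
    using that by (intro card_mono finite_subset[of "{i. (i, j) \<in> young_diagram p}" "{..<length p}"])
      (auto simp: young_diagram_def)
  moreover have "0 < ?c j" if "j < (if p = [] then 0 else hd p)" for j
    using that card_column[OF assms, of 0 j]
    by (cases p) (auto simp: young_diagram_def)
  ultimately show ?thesis
    by (force simp: is_partition_def conjugate_partition_def sorted_wrt_iff_nth_less)
qed

text \<open>The Lie algebra of \<open>n \<times> n\<close> complex matrices is \<open>carrier_mat n n\<close> with the commutator
  bracket. A module of dimension \<open>d\<close> is given, up to the choice of a basis, by a Lie algebra
  homomorphism \<open>\<rho>\<close> from \<open>n \<times> n\<close> to \<open>d \<times> d\<close> matrices acting on \<open>carrier_vec d\<close>; the values of \<open>\<rho>\<close>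
  outside \<open>carrier_mat n n\<close> are irrelevant.\<close>

definition gl_module :: "nat \<Rightarrow> nat \<Rightarrow> (complex mat \<Rightarrow> complex mat) \<Rightarrow> bool" where
  "gl_module n d \<rho> \<longleftrightarrow>
     (\<forall>A \<in> carrier_mat n n. \<rho> A \<in> carrier_mat d d) \<and>
     (\<forall>A \<in> carrier_mat n n. \<forall>B \<in> carrier_mat n n. \<rho> (A + B) = \<rho> A + \<rho> B) \<and>
     (\<forall>c. \<forall>A \<in> carrier_mat n n. \<rho> (c \<cdot>\<^sub>m A) = c \<cdot>\<^sub>m \<rho> A) \<and>
     (\<forall>A \<in> carrier_mat n n. \<forall>B \<in> carrier_mat n n.
        \<rho> (A * B - B * A) = \<rho> A * \<rho> B - \<rho> B * \<rho> A)"

definition simple_gl_module :: "nat \<Rightarrow> nat \<Rightarrow> (complex mat \<Rightarrow> complex mat) \<Rightarrow> bool" where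
  "simple_gl_module n d \<rho> \<longleftrightarrow>
     gl_module n d \<rho> \<and> d \<noteq> 0 \<and>
     (\<forall>W. VectorSpace.subspace class_ring W (module_vec TYPE(complex) d) \<and>
          (\<forall>A \<in> carrier_mat n n. \<forall>w \<in> W. \<rho> A *\<^sub>v w \<in> W)
        \<longrightarrow> W = {0\<^sub>v d} \<or> W = carrier_vec d)"

definition matrix_unit :: "nat \<Rightarrow> nat \<Rightarrow> nat \<Rightarrow> complex mat" where
  "matrix_unit n i j = mat n n (\<lambda>(k, l). if k = i \<and> l = j then 1 else 0)"

text \<open>The \<open>i\<close>-th part, counted from 0, of the partition with zeros appended.\<close>

definition part :: "nat list \<Rightarrow> nat \<Rightarrow> nat" where
  "part p i = (if i < length p then p ! i else 0)"

definition has_highest_weight ::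
    "nat \<Rightarrow> nat \<Rightarrow> (complex mat \<Rightarrow> complex mat) \<Rightarrow> nat list \<Rightarrow> bool" where
  "has_highest_weight n d \<rho> p \<longleftrightarrow>
     (\<exists>v \<in> carrier_vec d. v \<noteq> 0\<^sub>v d \<and>
        (\<forall>i j. i < j \<and> j < n \<longrightarrow> \<rho> (matrix_unit n i j) *\<^sub>v v = 0\<^sub>v d) \<and>
        (\<forall>i < n. \<rho> (matrix_unit n i i) *\<^sub>v v = of_nat (part p i) \<cdot>\<^sub>v v))"

text \<open>For \<open>length p \<le> n\<close> the simple module of highest weight \<open>p\<close> exists and is unique up to
  isomorphism, so \<open>THE\<close> picks its dimension. For \<open>n = 0\<close> it is the one-dimensional space.\<close>

definition dim_F :: "nat \<Rightarrow> nat list \<Rightarrow> nat" where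
  "dim_F n p =
     (if n < length p then 0
      else (THE d. \<exists>\<rho>. simple_gl_module n d \<rho> \<and> has_highest_weight n d \<rho> p))"

end

theory Submission
  imports Defs "HOL-Library.Poly_Mapping" "HOL-Library.Function_Algebras" "HOL-Library.Nat_Bijection"
begin

text \<open>
  For a box in row \<open>i\<close> and column \<open>j\<close> let its content be \<open>j - i\<close>. The hook-content formula says that
  \<open>dim F\<^sub>p\<close> for \<open>gl\<^sub>n\<close>, times the product of the hook lengths of \<open>p\<close>, is the product of
  \<open>n + c\<close> over the contents \<open>c\<close> of the boxes of \<open>p\<close>. Conjugation preserves the hook lengths and
  negates the contents. So the two dimensions agree for all \<open>n\<close> if and only if the monic
  polynomials with the linear factors \<open>n + c\<close> and \<open>n + (m - c)\<close> agree, that is, if and only if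
  the contents, with multiplicities, are symmetric under \<open>c \<mapsto> m - c\<close>. A content \<open>c \<ge> 0\<close> occurs as
  often as there are \<open>i\<close> with \<open>\<alpha>\<^sub>i \<ge> c\<close>, and a content \<open>- c \<le> 0\<close> as often as there are \<open>i\<close> with
  \<open>\<beta>\<^sub>i \<ge> c\<close>; as the Frobenius coordinates are strictly decreasing, the symmetry says exactly that
  \<open>\<alpha>\<^sub>i = \<beta>\<^sub>i + m\<close> for all \<open>i\<close> (lemmas \<open>prods_eq_iff\<close>, \<open>content_symmetric_iff\<close>,
  \<open>frobenius_iff\<close>).

  The main work is the dimension of the simple modules, which are given abstractly. A simple module
  with a given highest weight exists: a basis vector of a fermionic Fock space has this weight, and
  a module of least dimension with a vector of highest weight \<open>p\<close> is simple, since otherwise the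
  vector would survive in a smaller submodule or quotient. That every such module has the dimension
  predicted by Weyl also yields uniqueness of the dimension.

  For the Weyl character formula, the lowered vectors \<open>E\<^sub>j\<^sub>i \<dots> E\<^sub>l\<^sub>k v\<close> of a highest weight vector
  \<open>v\<close> span a simple module, so it has a basis of weight vectors on which the Casimir operator is a
  scalar. Let \<open>\<chi>\<close> be the character, an element of the group algebra of the weight lattice with the
  derivations \<open>D\<^sub>i\<close>, and let \<open>T\<^sub>i\<^sub>j\<close> collect the traces of \<open>E\<^sub>j\<^sub>i E\<^sub>i\<^sub>j\<close> on the weight spaces.
  Cyclicity of the trace gives \<open>(x\<^sub>i - x\<^sub>j) T\<^sub>i\<^sub>j = x\<^sub>j (D\<^sub>i - D\<^sub>j) \<chi>\<close>. Together with the Casimir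
  equation it follows that the product \<open>Q \<chi>\<close> with the Vandermonde product \<open>Q\<close> is an eigenvector of
  the Laplacian \<open>\<Sum> D\<^sub>i\<^sup>2\<close>. Multiplicities of weights are invariant under permutations, because
  \<open>exp E\<^sub>i\<^sub>j exp (- E\<^sub>j\<^sub>i) exp E\<^sub>i\<^sub>j\<close> interchanges the weight spaces, so \<open>Q \<chi>\<close> is alternating. The
  weights of \<open>Q \<chi>\<close> lie on a sphere and below \<open>\<lambda> + \<rho>\<close>, which leaves only the orbit of \<open>\<lambda> + \<rho>\<close>.
  Specialising \<open>x\<^sub>i\<close> to \<open>q\<close> to the power \<open>\<rho>\<^sub>i\<close> and letting \<open>q\<close> tend to 1 gives the dimension.
\<close>

interpretation fs: vector_space "\<lambda>(c::complex) (f::'x\<Rightarrow>complex) x. c * f x"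
  by unfold_locales (auto simp: fun_eq_iff algebra_simps)

section \<open>The Vandermonde determinant\<close>

lemma coeff_prod_linear_factors:
  fixes x :: "nat \<Rightarrow> 'a::comm_ring_1"
  assumes "finite A"
  shows "coeff (\<Prod>k\<in>A. [:- x k, 1:]) (card A) = 1 \<and>
    (\<forall>m > card A. coeff (\<Prod>k\<in>A. [:- x k, 1:]) m = 0)"
  using assms
proof (induction A rule: finite_induct)
  case empty
  then show ?case by (auto simp: coeff_eq_0)
next
  case (insert a A)
  then show ?case
    by (auto simp: coeff_pCons split: nat.split)
qed

lemma det_vandermonde:
  fixes x :: "nat \<Rightarrow> 'a::comm_ring_1"
  shows "det (mat n n (\<lambda>(i, j). x i ^ (n - 1 - j))) = (\<Prod>j<n. \<Prod>k\<in>{j<..<n}. x j - x k)"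
proof -
  \<comment> \<open>Multiplying \<open>V\<close> by the coefficients of the monic polynomials \<open>P j\<close> makes it triangular, as
    \<open>P j\<close> vanishes at \<open>x i\<close> for \<open>i > j\<close>.\<close>
  define P where "P j = (\<Prod>k\<in>{j<..<n}. [:- x k, 1:])" for j
  define V where "V = mat n n (\<lambda>(i, j). x i ^ (n - 1 - j))"
  define U where "U = mat n n (\<lambda>(k, j). coeff (P j) (n - 1 - k))"
  have V: "V \<in> carrier_mat n n" and U: "U \<in> carrier_mat n n"
    by (auto simp: V_def U_def)
  have coeff_top: "coeff (P j) (n - 1 - j) = 1"
    and coeff_high: "m > n - 1 - j \<Longrightarrow> coeff (P j) m = 0" for j m
    using coeff_prod_linear_factors[of "{j<..<n}" x] by (auto simp: P_def)
  have "det U = prod_list (diag_mat U)"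
    by (rule det_lower_triangular[OF _ U]) (auto simp: U_def intro!: coeff_high)
  also have "\<dots> = 1"
    using coeff_top by (auto simp: prod_list_diag_prod U_def intro!: prod.neutral)
  finally have detU: "det U = 1" .
  have VU: "(V * U) $$ (i, j) = poly (P j) (x i)" if "i < n" "j < n" for i j
  proof -
    have "(V * U) $$ (i, j) = (\<Sum>k<n. x i ^ (n - 1 - k) * coeff (P j) (n - 1 - k))"
      using that by (auto simp: V_def U_def scalar_prod_def atLeast0LessThan)
    also have "\<dots> = (\<Sum>m<n. x i ^ m * coeff (P j) m)"
      by (rule sum.reindex_bij_witness[of _ "\<lambda>m. n - 1 - m" "\<lambda>m. n - 1 - m"]) auto
    also have "\<dots> = (\<Sum>m\<le>degree (P j). coeff (P j) m * x i ^ m)"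
    proof (rule sum.mono_neutral_cong)
      have "coeff (P j) m = 0" if "m \<ge> n" for m
        using coeff_high[of j m] that \<open>j < n\<close> by auto
      then show "x i ^ m * coeff (P j) m = 0" if "m \<in> {..<n} - {..degree (P j)}" for m
        using that by (simp add: coeff_eq_0)
      show "coeff (P j) m * x i ^ m = 0" if "m \<in> {..degree (P j)} - {..<n}" for m
        using that \<open>\<And>m. m \<ge> n \<Longrightarrow> coeff (P j) m = 0\<close> by simp
    qed (auto simp: mult.commute)
    finally show ?thesis by (simp add: poly_altdef)
  qed
  have poly_P: "poly (P j) y = (\<Prod>k\<in>{j<..<n}. y - x k)" for j y
    by (simp add: P_def poly_prod)
  have "det V = det (V * U)"
    using det_mult[OF V U] detU by simp
  also have "\<dots> = prod_list (diag_mat (V * U))"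
  proof (rule det_upper_triangular)
    show "upper_triangular (V * U)"
      unfolding upper_triangular_def
    proof (intro allI impI)
      fix i j assume "i < dim_row (V * U)" "j < i"
      then have ij: "i < n" "j < n" "i \<in> {j<..<n}" using V by auto
      have "(\<Prod>k\<in>{j<..<n}. x i - x k) = 0" by (rule prod_zero[OF _ bexI[OF _ ij(3)]]) auto
      then show "(V * U) $$ (i, j) = 0" using VU[OF ij(1,2)] poly_P by simp
    qed
    show "V * U \<in> carrier_mat n n" using V U by simp
  qed
  also have "\<dots> = (\<Prod>j<n. \<Prod>k\<in>{j<..<n}. x j - x k)"
    using V U by (simp add: prod_list_diag_prod VU poly_P atLeast0LessThan del: index_mult_mat(1))
  finally show ?thesis by (simp add: V_def)
qed

section \<open>Actions of the matrix units and their subquotients\<close>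

text \<open>Operators \<open>E i j\<close>, for \<open>i, j < n\<close>, on the complex-valued functions on a set. They are linear and
satisfy the commutation relations of the matrix units of \<open>gl\<^sub>n\<close>.\<close>

definition gl_action :: "nat \<Rightarrow> (nat \<Rightarrow> nat \<Rightarrow> ('x \<Rightarrow> complex) \<Rightarrow> 'x \<Rightarrow> complex) \<Rightarrow> bool" where
  "gl_action n E \<longleftrightarrow>
     (\<forall>i<n. \<forall>j<n. (\<forall>f g. E i j (f + g) = E i j f + E i j g) \<and>
        (\<forall>c f. E i j (\<lambda>x. c * f x) = (\<lambda>x. c * E i j f x))) \<and>
     (\<forall>i<n. \<forall>j<n. \<forall>k<n. \<forall>l<n. \<forall>f. E i j (E k l f) =
        E k l (E i j f) + (if j = k then E i l f else 0) - (if l = i then E k j f else 0))"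

text \<open>The same relations for \<open>d \<times> d\<close> matrices; \<open>R i j b c\<close> is the entry in row \<open>b\<close> and column \<open>c\<close> of
the matrix of the \<open>(i, j)\<close>-th matrix unit. Entries with indices \<open>\<ge> d\<close> are irrelevant.\<close>

definition gl_entries :: "nat \<Rightarrow> nat \<Rightarrow> (nat \<Rightarrow> nat \<Rightarrow> nat \<Rightarrow> nat \<Rightarrow> complex) \<Rightarrow> bool" where
  "gl_entries n d R \<longleftrightarrow>
     (\<forall>i<n. \<forall>j<n. \<forall>k<n. \<forall>l<n. \<forall>b<d. \<forall>e<d.
        (\<Sum>c<d. R i j b c * R k l c e) - (\<Sum>c<d. R k l b c * R i j c e) =
        (if j = k then R i l b e else 0) - (if l = i then R k j b e else 0))"

text \<open>The operator of a \<open>d \<times> d\<close> matrix on functions on the natural numbers. Its values vanish outside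
\<open>{..<d}\<close>, and it kills functions that vanish on \<open>{..<d}\<close>.\<close>

definition mat_op :: "nat \<Rightarrow> (nat \<Rightarrow> nat \<Rightarrow> complex) \<Rightarrow> (nat \<Rightarrow> complex) \<Rightarrow> nat \<Rightarrow> complex" where
  "mat_op d M f = (\<lambda>b. if b < d then \<Sum>c<d. M b c * f c else 0)"

text \<open>The functions supported on \<open>{..<d}\<close>, which play the role of \<open>\<complex>\<^sup>d\<close>.\<close>

definition supp_space :: "nat \<Rightarrow> (nat \<Rightarrow> complex) set" where
  "supp_space d = {f. \<forall>b\<ge>d. f b = 0}"

text \<open>A nonzero vector of weight \<open>lam\<close> that is killed by the raising operators.\<close>

definition hw_vec :: "nat \<Rightarrow> (nat \<Rightarrow> nat \<Rightarrow> ('x \<Rightarrow> complex) \<Rightarrow> 'x \<Rightarrow> complex) \<Rightarrow>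
    (nat \<Rightarrow> complex) \<Rightarrow> ('x \<Rightarrow> complex) \<Rightarrow> bool" where
  "hw_vec n E lam f \<longleftrightarrow> f \<noteq> 0 \<and> (\<forall>i j. i < j \<and> j < n \<longrightarrow> E i j f = 0) \<and>
     (\<forall>i<n. E i i f = (\<lambda>x. lam i * f x))"

lemma gl_action_add: "gl_action n E \<Longrightarrow> i < n \<Longrightarrow> j < n \<Longrightarrow> E i j (f + g) = E i j f + E i j g"
  and gl_action_scale: "gl_action n E \<Longrightarrow> i < n \<Longrightarrow> j < n \<Longrightarrow> E i j (\<lambda>x. c * f x) = (\<lambda>x. c * E i j f x)"
  unfolding gl_action_def by simp_all

lemma gl_action_comm:
  assumes "gl_action n E" "i < n" "j < n" "k < n" "l < n"
  shows "E i j (E k l f) =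
    E k l (E i j f) + (if j = k then E i l f else 0) - (if l = i then E k j f else 0)"
  using conjunct2[OF assms(1)[unfolded gl_action_def], rule_format, OF assms(2-5)] .

lemma gl_action_zero: "gl_action n E \<Longrightarrow> i < n \<Longrightarrow> j < n \<Longrightarrow> E i j 0 = 0"
  using gl_action_add[of n E i j 0 0] by simp

lemma gl_action_sum:
  "gl_action n E \<Longrightarrow> i < n \<Longrightarrow> j < n \<Longrightarrow> E i j (\<Sum>a\<in>A. f a) = (\<Sum>a\<in>A. E i j (f a))"
  by (induction A rule: infinite_finite_induct) (auto simp: gl_action_zero gl_action_add)

lemma sum_fun_apply: "(\<Sum>a\<in>A. f a) x = (\<Sum>a\<in>A. f a x :: 'b::comm_monoid_add)"
  by (induction A rule: infinite_finite_induct) auto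

lemma mat_op_add: "mat_op d M (f + g) = mat_op d M f + mat_op d M g"
  by (auto simp: mat_op_def fun_eq_iff algebra_simps sum.distrib)

lemma mat_op_scale: "mat_op d M (\<lambda>x. c * f x) = (\<lambda>x. c * mat_op d M f x)"
  by (auto simp: mat_op_def fun_eq_iff algebra_simps sum_distrib_left)

lemma mat_op_in_supp_space: "mat_op d M f \<in> supp_space d"
  by (auto simp: mat_op_def supp_space_def)

lemma mat_op_mat_op: "mat_op d M (mat_op d N f) = mat_op d (\<lambda>b e. \<Sum>c<d. M b c * N c e) f"
proof (rule ext)
  fix b
  have "(\<Sum>c<d. M b c * (\<Sum>e<d. N c e * f e)) = (\<Sum>e<d. (\<Sum>c<d. M b c * N c e) * f e)"
    unfolding sum_distrib_left sum_distrib_right by (subst sum.swap) (simp add: mult.assoc)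
  then show "mat_op d M (mat_op d N f) b = mat_op d (\<lambda>b e. \<Sum>c<d. M b c * N c e) f b"
    by (simp add: mat_op_def)
qed

lemma gl_action_mat_op:
  assumes "gl_entries n d R"
  shows "gl_action n (\<lambda>i j. mat_op d (R i j))"
proof -
  have "mat_op d (R i j) (mat_op d (R k l) f) = mat_op d (R k l) (mat_op d (R i j) f) +
      (if j = k then mat_op d (R i l) f else 0) - (if l = i then mat_op d (R k j) f else 0)"
    if "i < n" "j < n" "k < n" "l < n" for i j k l f
  proof (rule ext)
    fix b
    have *: "(\<Sum>c<d. R i j b c * R k l c e) = (\<Sum>c<d. R k l b c * R i j c e) +
        (if j = k then R i l b e else 0) - (if l = i then R k j b e else 0)" if "b < d" "e < d" for e
    proof -
      have "(\<Sum>c<d. R i j b c * R k l c e) - (\<Sum>c<d. R k l b c * R i j c e) =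
        (if j = k then R i l b e else 0) - (if l = i then R k j b e else 0)"
        using assms \<open>i < n\<close> \<open>j < n\<close> \<open>k < n\<close> \<open>l < n\<close> that unfolding gl_entries_def by blast
      then show ?thesis by (simp add: diff_eq_eq)
    qed
    have "(\<Sum>e<d. (\<Sum>c<d. R i j b c * R k l c e) * f e) = (\<Sum>e<d. (\<Sum>c<d. R k l b c * R i j c e) * f e)
        + (if j = k then \<Sum>e<d. R i l b e * f e else 0) - (if l = i then \<Sum>e<d. R k j b e * f e else 0)"
      if "b < d"
    proof -
      have "(\<Sum>e<d. (\<Sum>c<d. R i j b c * R k l c e) * f e) =
          (\<Sum>e<d. (\<Sum>c<d. R k l b c * R i j c e) * f e + (if j = k then R i l b e * f e else 0)
            - (if l = i then R k j b e * f e else 0))"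
        by (intro sum.cong refl) (simp add: *[OF that] distrib_right left_diff_distrib)
      then show ?thesis by (simp add: sum.distrib sum_subtractf)
    qed
    then show "mat_op d (R i j) (mat_op d (R k l) f) b = (mat_op d (R k l) (mat_op d (R i j) f) +
      (if j = k then mat_op d (R i l) f else 0) - (if l = i then mat_op d (R k j) f else 0)) b"
      unfolding mat_op_mat_op by (simp add: mat_op_def)
  qed
  then show ?thesis
    unfolding gl_action_def using mat_op_add mat_op_scale by blast
qed

lemma subspace_supp_space: "fs.subspace (supp_space d)"
  by (auto simp: fs.subspace_def supp_space_def)

lemma subspace_sum_scale:
  assumes "fs.subspace W" "\<And>c. c \<in> A \<Longrightarrow> u c \<in> W"
  shows "(\<Sum>c\<in>A. (\<lambda>x. a c * u c x)) \<in> W"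
  using assms fs.subspace_sum[of W A "\<lambda>c x. a c * u c x"] fs.subspace_scale by blast

text \<open>An action on a subquotient in coordinates: \<open>W\<close> is an invariant subspace, the common kernel in \<open>W\<close>
of the functionals \<open>\<phi> b\<close> is invariant too, and the \<open>u c\<close> are a dual family of vectors. The
quotient of \<open>W\<close> by the kernel then is a representation with the entries \<open>\<phi> b (E i j (u c))\<close>.
This covers changes of basis, submodules and quotients.\<close>

lemma subquotient:
  assumes gl: "gl_action n E" and W: "fs.subspace W"
    and inv: "\<And>i j f. i < n \<Longrightarrow> j < n \<Longrightarrow> f \<in> W \<Longrightarrow> E i j f \<in> W"
    and u: "\<And>c. c < k \<Longrightarrow> u c \<in> W"
    and phi_add: "\<And>b f g. b < k \<Longrightarrow> f \<in> W \<Longrightarrow> g \<in> W \<Longrightarrow> \<phi> b (f + g) = \<phi> b f + \<phi> b g"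
    and phi_scale: "\<And>b f a. b < k \<Longrightarrow> f \<in> W \<Longrightarrow> \<phi> b (\<lambda>x. a * f x) = a * \<phi> b f"
    and dual: "\<And>b c. b < k \<Longrightarrow> c < k \<Longrightarrow> \<phi> b (u c) = (if b = c then 1 else 0 :: complex)"
    and ker: "\<And>i j f b. i < n \<Longrightarrow> j < n \<Longrightarrow> f \<in> W \<Longrightarrow> (\<And>c. c < k \<Longrightarrow> \<phi> c f = 0) \<Longrightarrow> b < k \<Longrightarrow>
       \<phi> b (E i j f) = 0"
  shows subquotient_apply: "\<And>i j f b. i < n \<Longrightarrow> j < n \<Longrightarrow> f \<in> W \<Longrightarrow> b < k \<Longrightarrow>
      \<phi> b (E i j f) = (\<Sum>c<k. \<phi> b (E i j (u c)) * \<phi> c f)"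
    and subquotient_gl_entries: "gl_entries n k (\<lambda>i j b c. \<phi> b (E i j (u c)))"
proof -
  have phi_zero: "\<phi> b 0 = 0" if "b < k" for b
    using phi_add[OF that, of 0 0] fs.subspace_0[OF W] by simp
  have phi_sum: "\<phi> b (\<Sum>c\<in>A. (\<lambda>x. a c * w c x)) = (\<Sum>c\<in>A. a c * \<phi> b (w c))"
    if "b < k" "\<And>c. c \<in> A \<Longrightarrow> w c \<in> W" "finite A" for b a w and A :: "nat set"
    using that(3,2)
  proof (induction A rule: finite_induct)
    case empty
    then show ?case using phi_zero[OF \<open>b < k\<close>] by (simp add: zero_fun_def)
  next
    case (insert c A)
    have "\<phi> b (\<Sum>c\<in>insert c A. (\<lambda>x. a c * w c x)) =
        \<phi> b ((\<lambda>x. a c * w c x) + (\<Sum>c\<in>A. (\<lambda>x. a c * w c x)))"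
      by (subst sum.insert[OF insert.hyps]) (rule refl)
    also have "\<dots> = \<phi> b (\<lambda>x. a c * w c x) + \<phi> b (\<Sum>c\<in>A. (\<lambda>x. a c * w c x))"
      using insert.prems by (intro phi_add[OF \<open>b < k\<close> fs.subspace_scale[OF W] subspace_sum_scale[OF W]]) auto
    also have "\<phi> b (\<lambda>x. a c * w c x) = a c * \<phi> b (w c)"
      using insert.prems by (intro phi_scale[OF \<open>b < k\<close>]) auto
    also have "\<phi> b (\<Sum>c\<in>A. (\<lambda>x. a c * w c x)) = (\<Sum>c\<in>A. a c * \<phi> b (w c))"
      using insert by blast
    finally show ?case by (simp add: insert.hyps)
  qed
  have phi_diff: "\<phi> b (f - g) = \<phi> b f - \<phi> b g" if "b < k" "f \<in> W" "g \<in> W" for b f g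
    using phi_add[of b "f - g" g] that fs.subspace_diff[OF W] by (simp add: eq_diff_eq)
  show app: "\<phi> b (E i j f) = (\<Sum>c<k. \<phi> b (E i j (u c)) * \<phi> c f)"
    if "i < n" "j < n" "f \<in> W" "b < k" for i j f b
  proof -
    \<comment> \<open>The difference of \<open>f\<close> and its combination \<open>h\<close> of the \<open>u c\<close> lies in the kernel.\<close>
    define h where "h = (\<Sum>c<k. (\<lambda>x. \<phi> c f * u c x))"
    have h: "h \<in> W" unfolding h_def using u by (intro subspace_sum_scale[OF W]) auto
    have "\<phi> c (f - h) = 0" if "c < k" for c
    proof -
      have "\<phi> c h = (\<Sum>e<k. \<phi> e f * \<phi> c (u e))"
        unfolding h_def using phi_sum[OF \<open>c < k\<close>, of "{..<k}" u] u by auto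
      also have "\<dots> = (\<Sum>e<k. if e = c then \<phi> c f else 0)"
        using dual[OF \<open>c < k\<close>] by (intro sum.cong) auto
      finally show ?thesis using phi_diff[OF \<open>c < k\<close> \<open>f \<in> W\<close> h] \<open>c < k\<close> by simp
    qed
    then have "\<phi> b (E i j (f - h)) = 0"
      using ker[of i j "f - h" b] that fs.subspace_diff[OF W \<open>f \<in> W\<close> h] by blast
    moreover have "E i j f = E i j (f - h) + E i j h"
      using gl_action_add[OF gl \<open>i < n\<close> \<open>j < n\<close>, of "f - h" h] by simp
    moreover have "E i j h = (\<Sum>c<k. (\<lambda>x. \<phi> c f * E i j (u c) x))"
      unfolding h_def gl_action_sum[OF gl \<open>i < n\<close> \<open>j < n\<close>] gl_action_scale[OF gl \<open>i < n\<close> \<open>j < n\<close>] ..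
    moreover have "\<phi> b (E i j h) = (\<Sum>c<k. \<phi> c f * \<phi> b (E i j (u c)))"
      unfolding calculation(3) using u inv[OF \<open>i < n\<close> \<open>j < n\<close>]
      by (intro phi_sum[OF \<open>b < k\<close>]) auto
    ultimately show ?thesis
      using phi_add[OF \<open>b < k\<close> inv[OF \<open>i < n\<close> \<open>j < n\<close> fs.subspace_diff[OF W \<open>f \<in> W\<close> h]]
          inv[OF \<open>i < n\<close> \<open>j < n\<close> h]]
      by (simp add: mult.commute)
  qed
  show "gl_entries n k (\<lambda>i j b c. \<phi> b (E i j (u c)))"
    unfolding gl_entries_def
  proof (intro allI impI)
    fix i j p l b e assume *: "i < n" "j < n" "p < n" "l < n" "b < k" "e < k"
    have [simp]: "u e \<in> W" using u * by simp
    have "(\<Sum>c<k. \<phi> b (E i j (u c)) * \<phi> c (E p l (u e))) = \<phi> b (E i j (E p l (u e)))"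
      using app[of i j "E p l (u e)" b] inv * by simp
    moreover have "(\<Sum>c<k. \<phi> b (E p l (u c)) * \<phi> c (E i j (u e))) = \<phi> b (E p l (E i j (u e)))"
      using app[of p l "E i j (u e)" b] inv * by simp
    moreover have "E i j (E p l (u e)) = E p l (E i j (u e)) +
        ((if j = p then E i l (u e) else 0) - (if l = i then E p j (u e) else 0))"
      using gl_action_comm[OF gl, of i j p l "u e"] * by (simp add: add_diff_eq)
    moreover have "\<phi> b (E p l (E i j (u e)) +
        ((if j = p then E i l (u e) else 0) - (if l = i then E p j (u e) else 0)))
      = \<phi> b (E p l (E i j (u e))) +
        ((if j = p then \<phi> b (E i l (u e)) else 0) - (if l = i then \<phi> b (E p j (u e)) else 0))"
      using * inv phi_zero[OF \<open>b < k\<close>] fs.subspace_0[OF W] fs.subspace_diff[OF W]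
      by (subst phi_add) (auto simp: phi_diff)
    ultimately show "(\<Sum>c<k. \<phi> b (E i j (u c)) * \<phi> c (E p l (u e))) -
        (\<Sum>c<k. \<phi> b (E p l (u c)) * \<phi> c (E i j (u e))) =
        (if j = p then \<phi> b (E i l (u e)) else 0) - (if l = i then \<phi> b (E p j (u e)) else 0)"
      by simp
  qed
qed

text \<open>The coordinates with respect to a part \<open>C\<close> of a basis \<open>B\<close> are functionals as needed in
\<open>subquotient\<close>; their common kernel is spanned by the rest of the basis.\<close>

lemma representation_functionals:
  fixes B :: "('x \<Rightarrow> complex) set" and u :: "nat \<Rightarrow> 'x \<Rightarrow> complex"
  assumes B: "fs.independent B" and span: "W \<subseteq> fs.span B"
    and u: "bij_betw u {..<k} C" and C: "C \<subseteq> B"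
  defines "\<phi> \<equiv> \<lambda>b f. fs.representation B f (u b)"
  shows "f \<in> W \<Longrightarrow> g \<in> W \<Longrightarrow> \<phi> b (f + g) = \<phi> b f + \<phi> b g"
    and "f \<in> W \<Longrightarrow> \<phi> b (\<lambda>x. a * f x) = a * \<phi> b f"
    and "b < k \<Longrightarrow> c < k \<Longrightarrow> \<phi> b (u c) = (if b = c then 1 else 0)"
    and "f \<in> W \<Longrightarrow> (\<And>b. b < k \<Longrightarrow> \<phi> b f = 0) \<Longrightarrow> f \<in> fs.span (B - C)"
proof -
  show "f \<in> W \<Longrightarrow> g \<in> W \<Longrightarrow> \<phi> b (f + g) = \<phi> b f + \<phi> b g"
    unfolding \<phi>_def by (subst fs.representation_add[OF B]) (use span in auto)
  show "f \<in> W \<Longrightarrow> \<phi> b (\<lambda>x. a * f x) = a * \<phi> b f"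
    unfolding \<phi>_def by (subst fs.representation_scale[OF B]) (use span in auto)
  show "\<phi> b (u c) = (if b = c then 1 else 0)" if "b < k" "c < k"
  proof -
    have "u c \<in> B" using u C that by (auto simp: bij_betw_def)
    moreover have "u b = u c \<longleftrightarrow> b = c"
      using u that by (auto simp: bij_betw_def inj_on_def)
    ultimately show ?thesis
      using fs.representation_basis[OF B, of "u c"] by (auto simp: \<phi>_def)
  qed
  show "f \<in> fs.span (B - C)" if f: "f \<in> W" and z: "\<And>b. b < k \<Longrightarrow> \<phi> b f = 0"
  proof -
    have "fs.representation B f c = 0" if "c \<in> C" for c
      using z u that by (auto simp: \<phi>_def bij_betw_def)
    then have "{b. fs.representation B f b \<noteq> 0} \<subseteq> B - C"
      using fs.representation_ne_zero[of B f] by auto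
    then have "(\<Sum>b | fs.representation B f b \<noteq> 0. (\<lambda>x. fs.representation B f b * b x)) \<in> fs.span (B - C)"
      by (intro fs.span_sum fs.span_scale fs.span_base) auto
    then show ?thesis
      using fs.sum_nonzero_representation_eq[OF B, of f] f span by auto
  qed
qed

lemma card_basis_supp_space:
  assumes B: "fs.independent B" "B \<subseteq> supp_space d" "supp_space d \<subseteq> fs.span B"
  shows "finite B" "card B = d"
proof -
  define e where "e i = (\<lambda>x::nat. if x = i then 1 else 0 :: complex)" for i
  have inj: "inj_on e {..<d}"
    by (rule inj_onI) (metis e_def zero_neq_one)
  define U where "U = e ` {..<d}"
  have U: "finite U" "card U = d" "U \<subseteq> supp_space d"
    using inj by (auto simp: U_def card_image) (auto simp: supp_space_def e_def)
  have expand: "(\<Sum>i<d. (\<lambda>x. f i * e i x)) = (\<lambda>x. if x < d then f x else 0)" for f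
  proof
    fix x
    have "(\<Sum>i<d. f i * e i x) = (\<Sum>i<d. if i = x then f x else 0)"
      by (intro sum.cong) (auto simp: e_def)
    then show "(\<Sum>i<d. (\<lambda>x. f i * e i x)) x = (if x < d then f x else 0)"
      by (simp add: sum_fun_apply)
  qed
  have spanU: "supp_space d \<subseteq> fs.span U"
  proof
    fix f assume "f \<in> supp_space d"
    then have "f = (\<Sum>i<d. (\<lambda>x. f i * e i x))"
      unfolding expand by (auto simp: supp_space_def)
    moreover have "(\<Sum>i<d. (\<lambda>x. f i * e i x)) \<in> fs.span U"
      by (intro fs.span_sum fs.span_scale fs.span_base) (auto simp: U_def)
    ultimately show "f \<in> fs.span U" by simp
  qed
  have indU: "fs.independent U"
  proof
    assume "fs.dependent U"
    then obtain r w where r: "(\<Sum>v\<in>U. (\<lambda>x. r v * v x)) = 0" "w \<in> U" "r w \<noteq> 0"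
      using fs.dependent_finite[OF U(1)] by auto
    obtain i where i: "i < d" "w = e i" using r(2) by (auto simp: U_def)
    have "(\<Sum>i<d. (\<lambda>x. r (e i) * e i x)) = 0"
      using r(1) inj by (simp add: U_def sum.reindex)
    then have "(if i < d then r (e i) else 0) = 0"
      using fun_cong[of "\<Sum>i<d. (\<lambda>x. r (e i) * e i x)" 0 i] unfolding expand[of "\<lambda>i. r (e i)"] by simp
    then show False using i r by simp
  qed
  show "finite B" using fs.independent_span_bound[OF U(1) B(1)] B(2) spanU by auto
  then show "card B = d"
    using fs.independent_span_bound[OF U(1) B(1)] fs.independent_span_bound[OF _ indU, of B]
      U B spanU by (metis le_antisym subset_trans)
qed

text \<open>There is a representation of dimension \<open>d\<close> that contains a vector of highest weight \<open>lam\<close>. It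
need not be generated by this vector.\<close>

definition has_hw_rep :: "nat \<Rightarrow> nat \<Rightarrow> (nat \<Rightarrow> complex) \<Rightarrow> bool" where
  "has_hw_rep n d lam \<longleftrightarrow> (\<exists>R f. gl_entries n d R \<and> f \<in> supp_space d \<and> hw_vec n (\<lambda>i j. mat_op d (R i j)) lam f)"

lemma has_hw_rep_subquotient:
  assumes gl: "gl_action n E" and W: "fs.subspace W"
    and inv: "\<And>i j f. i < n \<Longrightarrow> j < n \<Longrightarrow> f \<in> W \<Longrightarrow> E i j f \<in> W"
    and u: "\<And>c. c < k \<Longrightarrow> u c \<in> W"
    and phi_add: "\<And>b f g. b < k \<Longrightarrow> f \<in> W \<Longrightarrow> g \<in> W \<Longrightarrow> \<phi> b (f + g) = \<phi> b f + \<phi> b g"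
    and phi_scale: "\<And>b f a. b < k \<Longrightarrow> f \<in> W \<Longrightarrow> \<phi> b (\<lambda>x. a * f x) = a * \<phi> b f"
    and dual: "\<And>b c. b < k \<Longrightarrow> c < k \<Longrightarrow> \<phi> b (u c) = (if b = c then 1 else 0 :: complex)"
    and ker: "\<And>i j f b. i < n \<Longrightarrow> j < n \<Longrightarrow> f \<in> W \<Longrightarrow> (\<And>c. c < k \<Longrightarrow> \<phi> c f = 0) \<Longrightarrow> b < k \<Longrightarrow>
       \<phi> b (E i j f) = 0"
    and v: "hw_vec n E lam v" "v \<in> W" and nz: "b0 < k" "\<phi> b0 v \<noteq> 0"
  shows "has_hw_rep n k lam"
proof -
  define R where "R = (\<lambda>i j b c. \<phi> b (E i j (u c)))"
  define f where "f = (\<lambda>b. if b < k then \<phi> b v else 0)"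
  have R: "gl_entries n k R"
    unfolding R_def by (rule subquotient_gl_entries[where \<phi> = \<phi>, OF gl W]) (fact inv u phi_add phi_scale dual ker)+
  have app: "mat_op k (R i j) f = (\<lambda>b. if b < k then \<phi> b (E i j v) else 0)" if "i < n" "j < n" for i j
  proof
    fix b
    have "\<phi> b (E i j v) = (\<Sum>c<k. \<phi> b (E i j (u c)) * \<phi> c v)" if "b < k"
      by (rule subquotient_apply[where \<phi> = \<phi>, OF gl W])
        (fact inv u phi_add phi_scale dual ker v(2) that \<open>i < n\<close> \<open>j < n\<close>)+
    then show "mat_op k (R i j) f b = (if b < k then \<phi> b (E i j v) else 0)"
      by (simp add: mat_op_def f_def R_def)
  qed
  have phi_zero: "\<phi> b 0 = 0" if "b < k" for b
    using phi_add[OF that, of 0 0] fs.subspace_0[OF W] by simp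
  have "hw_vec n (\<lambda>i j. mat_op k (R i j)) lam f"
    unfolding hw_vec_def
  proof (intro conjI allI impI)
    show "f \<noteq> 0" using nz by (auto simp: f_def fun_eq_iff)
    show "mat_op k (R i j) f = 0" if "i < j \<and> j < n" for i j
    proof -
      have Ev: "E i j v = 0" using that v(1) unfolding hw_vec_def by blast
      have "i < n" "j < n" using that by auto
      then show ?thesis unfolding app[OF \<open>i < n\<close> \<open>j < n\<close>] Ev using phi_zero by auto
    qed
    show "mat_op k (R i i) f = (\<lambda>x. lam i * f x)" if "i < n" for i
    proof -
      have Ev: "E i i v = (\<lambda>x. lam i * v x)" using that v(1) unfolding hw_vec_def by blast
      show ?thesis unfolding app[OF that that] Ev using v(2) phi_scale by (auto simp: f_def)
    qed
  qed
  moreover have "f \<in> supp_space k" by (simp add: f_def supp_space_def)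
  ultimately show ?thesis using R by (auto simp: has_hw_rep_def)
qed

lemma minimal_rep_simple:
  assumes gl: "gl_entries n d R" and f: "f \<in> supp_space d" "hw_vec n (\<lambda>i j. mat_op d (R i j)) lam f"
    and minimal: "\<And>k. k < d \<Longrightarrow> \<not> has_hw_rep n k lam"
    and W: "fs.subspace W" "W \<subseteq> supp_space d"
    and inv: "\<And>i j g. i < n \<Longrightarrow> j < n \<Longrightarrow> g \<in> W \<Longrightarrow> mat_op d (R i j) g \<in> W"
  shows "W = {0} \<or> W = supp_space d"
proof -
  define E where "E = (\<lambda>i j. mat_op d (R i j))"
  have E: "gl_action n E" unfolding E_def by (rule gl_action_mat_op[OF gl])
  obtain B where B: "B \<subseteq> W" "fs.independent B" "W \<subseteq> fs.span B"
    using fs.maximal_independent_subset[of W] by blast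
  obtain B' where B': "B \<subseteq> B'" "B' \<subseteq> supp_space d" "fs.independent B'" "supp_space d \<subseteq> fs.span B'"
    using fs.maximal_independent_subset_extend[of B "supp_space d"] B W(2) by (metis subset_trans)
  have cardB': "finite B'" "card B' = d"
    using card_basis_supp_space B' by auto
  have spanB: "fs.span B = W" using B W(1) by (simp add: fs.span_subspace)
  show ?thesis
  proof (cases "f \<in> W")
    \<comment> \<open>A proper submodule with the vector \<open>f\<close> would be smaller; otherwise \<open>f\<close> survives in the
      quotient by \<open>W\<close>.\<close>
    case True
    have "W = supp_space d"
    proof (rule ccontr)
      assume "W \<noteq> supp_space d"
      then have "B \<noteq> B'" using spanB B' W(2) by auto
      then have "card B < d" using B' cardB' by (metis psubset_card_mono psubsetI)
      obtain u where u: "bij_betw u {..<card B} B"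
        using ex_bij_betw_nat_finite[of B] finite_subset[OF B'(1) cardB'(1)]
        by (auto simp: atLeast0LessThan)
      define \<phi> where "\<phi> b f = fs.representation B f (u b)" for b f
      note rf = representation_functionals[OF B(2,3) u subset_refl, folded \<phi>_def]
      have ker: "g = 0" if "g \<in> W" "\<And>b. b < card B \<Longrightarrow> \<phi> b g = 0" for g
        using rf(4)[OF that] by simp
      have "\<exists>b0<card B. \<phi> b0 f \<noteq> 0"
        using ker[OF True] f(2) by (auto simp: hw_vec_def)
      then obtain b0 where b0: "b0 < card B" "\<phi> b0 f \<noteq> 0" by blast
      have "has_hw_rep n (card B) lam"
      proof (rule has_hw_rep_subquotient[where \<phi> = \<phi> and u = u and ?b0.0 = b0, OF E W(1) _ _ _ _ _ _ f(2)[folded E_def] True b0])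
        show "E i j g \<in> W" if "i < n" "j < n" "g \<in> W" for i j g using inv that by (simp add: E_def)
        show "u c \<in> W" if "c < card B" for c using u B(1) that by (auto simp: bij_betw_def)
        show "\<phi> b (E i j g) = 0" if *: "i < n" "j < n" "g \<in> W" "\<And>c. c < card B \<Longrightarrow> \<phi> c g = 0" "b < card B"
          for i j g b
        proof -
          have "g = 0" using ker * by blast
          then show ?thesis using gl_action_zero[OF E *(1,2)] *(4,5) by simp
        qed
      qed (use rf in auto)
      then show False using minimal \<open>card B < d\<close> by blast
    qed
    then show ?thesis ..
  next
    case False
    have "W = {0}"
    proof (rule ccontr)
      assume "W \<noteq> {0}"
      then have "B \<noteq> {}" using spanB by auto
      define C where "C = B' - B"
      have "card C < d"
      proof -
        have "finite B" using finite_subset[OF B'(1) cardB'(1)] .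
        then have "card C = d - card B" "card B > 0" "card B \<le> d"
          using card_Diff_subset[of B B'] card_mono[OF cardB'(1) B'(1)] B'(1) cardB'(2) \<open>B \<noteq> {}\<close>
          by (auto simp: C_def card_gt_0_iff)
        then show ?thesis by linarith
      qed
      obtain u where u: "bij_betw u {..<card C} C"
        using ex_bij_betw_nat_finite[of C] cardB'(1) by (auto simp: atLeast0LessThan C_def)
      define \<phi> where "\<phi> b f = fs.representation B' f (u b)" for b f
      have "C \<subseteq> B'" by (auto simp: C_def)
      note rf = representation_functionals[OF B'(3,4) u this, folded \<phi>_def]
      have B'C: "B' - C = B" using B'(1) by (auto simp: C_def)
      have kerW: "g \<in> W" if "g \<in> supp_space d" "\<And>b. b < card C \<Longrightarrow> \<phi> b g = 0" for g
        using rf(4)[OF that] B'C spanB by simp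
      have W0: "\<phi> b g = 0" if "g \<in> W" "b < card C" for g b
      proof -
        have "g \<in> fs.span B" using that spanB by simp
        then have "fs.representation B' g = fs.representation B g"
          by (rule fs.representation_extend[OF B'(3) _ B'(1)])
        moreover have "u b \<notin> B" using u that by (auto simp: bij_betw_def C_def)
        ultimately show ?thesis
          using fs.representation_ne_zero[of B g "u b"] by (auto simp: \<phi>_def)
      qed
      have "\<exists>b0<card C. \<phi> b0 f \<noteq> 0"
        using kerW[OF f(1)] False by auto
      then obtain b0 where b0: "b0 < card C" "\<phi> b0 f \<noteq> 0" by blast
      have "has_hw_rep n (card C) lam"
      proof (rule has_hw_rep_subquotient[where \<phi> = \<phi> and u = u and ?b0.0 = b0, OF E subspace_supp_space _ _ _ _ _ _ f(2)[folded E_def] f(1) b0])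
        show "E i j g \<in> supp_space d" for i j g by (simp add: E_def mat_op_in_supp_space)
        show "u c \<in> supp_space d" if "c < card C" for c
          using u B'(2) that by (auto simp: bij_betw_def C_def)
        show "\<phi> b (E i j g) = 0" if *: "i < n" "j < n" "g \<in> supp_space d"
          "\<And>c. c < card C \<Longrightarrow> \<phi> c g = 0" "b < card C" for i j g b
        proof -
          have "g \<in> W" using kerW * by blast
          then have "E i j g \<in> W" using inv * by (simp add: E_def)
          then show ?thesis using W0 * by blast
        qed
      qed (use rf in auto)
      then show False using minimal \<open>card C < d\<close> by blast
    qed
    then show ?thesis ..
  qed
qed

section \<open>Matrix modules and their entries\<close>

text \<open>The entries of the images of the matrix units under \<open>\<rho>\<close>.\<close>

definition entry :: "nat \<Rightarrow> (complex mat \<Rightarrow> complex mat) \<Rightarrow> nat \<Rightarrow> nat \<Rightarrow> nat \<Rightarrow> nat \<Rightarrow> complex" where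
  "entry n \<rho> i j b c = \<rho> (matrix_unit n i j) $$ (b, c)"

lemma matrix_unit_carrier [simp]: "matrix_unit n i j \<in> carrier_mat n n"
  by (simp add: matrix_unit_def)

lemma matrix_unit_mult:
  assumes "i < n" "j < n" "k < n" "l < n"
  shows "matrix_unit n i j * matrix_unit n k l = (if j = k then matrix_unit n i l else 0\<^sub>m n n)"
proof (rule eq_matI)
  fix a b assume "a < dim_row (if j = k then matrix_unit n i l else 0\<^sub>m n n)"
    "b < dim_col (if j = k then matrix_unit n i l else 0\<^sub>m n n)"
  then have ab: "a < n" "b < n" by (auto simp: matrix_unit_def split: if_splits)
  have "(\<Sum>c = 0..<n. (if a = i \<and> c = j then 1 else 0) * (if c = k \<and> b = l then 1 else (0::complex))) =
      (\<Sum>c = 0..<n. if c = j then (if a = i \<and> j = k \<and> b = l then 1 else 0) else 0)"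
    by (intro sum.cong) auto
  then show "(matrix_unit n i j * matrix_unit n k l) $$ (a, b) =
      (if j = k then matrix_unit n i l else 0\<^sub>m n n) $$ (a, b)"
    using ab assms by (simp add: matrix_unit_def scalar_prod_def)
qed (auto simp: matrix_unit_def)

lemma gl_module_sum:
  assumes gl: "gl_module n d \<rho>" and A: "A \<in> carrier_mat n n" and bc: "b < d" "c < d"
  shows "\<rho> A $$ (b, c) = (\<Sum>i<n. \<Sum>j<n. A $$ (i, j) * entry n \<rho> i j b c)"
proof -
  define P where "P S = mat n n (\<lambda>(i, j). if (i, j) \<in> S then A $$ (i, j) else 0)" for S
  have "\<rho> (P S) $$ (b, c) = (\<Sum>(i, j)\<in>S. A $$ (i, j) * entry n \<rho> i j b c)"
    if "finite S" "S \<subseteq> {..<n} \<times> {..<n}" for S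
    using that
  proof (induction S rule: finite_induct)
    case empty
    have "P {} = 0 \<cdot>\<^sub>m P {}" by (rule eq_matI) (auto simp: P_def)
    moreover have "P {} \<in> carrier_mat n n" by (simp add: P_def)
    ultimately have "\<rho> (P {}) = 0 \<cdot>\<^sub>m \<rho> (P {})" "\<rho> (P {}) \<in> carrier_mat d d"
      using gl unfolding gl_module_def by metis+
    then have "\<rho> (P {}) $$ (b, c) = 0"
      using bc by (metis carrier_matD index_smult_mat(1) mult_zero_left)
    then show ?case by simp
  next
    case (insert x S)
    obtain i j where x: "x = (i, j)" "i < n" "j < n" using insert by auto
    have eq: "P (insert x S) = A $$ (i, j) \<cdot>\<^sub>m matrix_unit n i j + P S"
      using insert.hyps by (intro eq_matI) (auto simp: P_def matrix_unit_def x)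
    have "\<rho> (P (insert x S)) = A $$ (i, j) \<cdot>\<^sub>m \<rho> (matrix_unit n i j) + \<rho> (P S)"
      using gl unfolding gl_module_def eq by (simp add: P_def)
    moreover have "\<rho> (matrix_unit n i j) \<in> carrier_mat d d" "\<rho> (P S) \<in> carrier_mat d d"
      using gl unfolding gl_module_def by (auto simp: P_def)
    ultimately show ?case
      using insert bc by (auto simp: x entry_def)
  qed
  from this[of "{..<n} \<times> {..<n}"] have "\<rho> (P ({..<n} \<times> {..<n})) $$ (b, c) =
      (\<Sum>i<n. \<Sum>j<n. A $$ (i, j) * entry n \<rho> i j b c)"
    by (simp add: sum.cartesian_product)
  moreover have "P ({..<n} \<times> {..<n}) = A"
    using A by (intro eq_matI) (auto simp: P_def)
  ultimately show ?thesis by simp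
qed

lemma gl_entries_entry:
  assumes gl: "gl_module n d \<rho>"
  shows "gl_entries n d (entry n \<rho>)"
  unfolding gl_entries_def
proof (intro allI impI)
  fix i j k l b e assume *: "i < n" "j < n" "k < n" "l < n" "b < d" "e < d"
  let ?U = "matrix_unit n"
  let ?D = "?U i j * ?U k l - ?U k l * ?U i j"
  have car: "\<rho> (?U a c) \<in> carrier_mat d d" for a c
    using gl by (auto simp: gl_module_def)
  have prod: "(\<rho> (?U a a') * \<rho> (?U c c')) $$ (b, e) = (\<Sum>f<d. entry n \<rho> a a' b f * entry n \<rho> c c' f e)"
    for a a' c c'
    using car[of a a'] car[of c c'] *
    by (auto simp: scalar_prod_def entry_def atLeast0LessThan intro!: sum.cong)
  have D: "?D \<in> carrier_mat n n"
    by (rule minus_carrier_mat, rule mult_carrier_mat[of _ n n]) simp_all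
  have "\<rho> ?D = \<rho> (?U i j) * \<rho> (?U k l) - \<rho> (?U k l) * \<rho> (?U i j)"
    using gl by (simp add: gl_module_def)
  then have "(\<Sum>c<d. entry n \<rho> i j b c * entry n \<rho> k l c e) -
      (\<Sum>c<d. entry n \<rho> k l b c * entry n \<rho> i j c e) = \<rho> ?D $$ (b, e)"
    using car[of i j] car[of k l] * by (simp add: prod[symmetric])
  also have "\<dots> = (\<Sum>p<n. \<Sum>q<n. ?D $$ (p, q) * entry n \<rho> p q b e)"
    by (rule gl_module_sum[OF gl D *(5,6)])
  also have "\<dots> = (\<Sum>p<n. \<Sum>q<n. (if p = i then if q = l then if j = k then entry n \<rho> i l b e else 0 else 0 else 0)
      - (if p = k then if q = j then if l = i then entry n \<rho> k j b e else 0 else 0 else 0))"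
    using * by (intro sum.cong refl) (auto simp: matrix_unit_mult, auto simp: matrix_unit_def)
  also have "\<dots> = (if j = k then entry n \<rho> i l b e else 0) - (if l = i then entry n \<rho> k j b e else 0)"
  proof -
    have if_sum: "(\<Sum>q\<in>A. if P then g q else 0) = (if P then sum g A else (0::complex))"
      for P g and A :: "nat set" by simp
    show ?thesis using * by (simp add: sum_subtractf if_sum)
  qed
  finally show "(\<Sum>c<d. entry n \<rho> i j b c * entry n \<rho> k l c e) -
      (\<Sum>c<d. entry n \<rho> k l b c * entry n \<rho> i j c e) =
      (if j = k then entry n \<rho> i l b e else 0) - (if l = i then entry n \<rho> k j b e else 0)" .
qed

text \<open>The linear extension to all matrices of given images of the matrix units.\<close>

definition rep_of_entries :: "nat \<Rightarrow> nat \<Rightarrow> (nat \<Rightarrow> nat \<Rightarrow> nat \<Rightarrow> nat \<Rightarrow> complex) \<Rightarrow> complex mat \<Rightarrow> complex mat" where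
  "rep_of_entries n d R A = mat d d (\<lambda>(b, c). \<Sum>i<n. \<Sum>j<n. A $$ (i, j) * R i j b c)"

lemma entry_rep_of_entries:
  assumes "i < n" "j < n" "b < d" "c < d"
  shows "entry n (rep_of_entries n d R) i j b c = R i j b c"
proof -
  have "(\<Sum>p<n. \<Sum>q<n. matrix_unit n i j $$ (p, q) * R p q b c) =
      (\<Sum>p<n. \<Sum>q<n. if p = i then if q = j then R i j b c else 0 else 0)"
    by (intro sum.cong refl) (auto simp: matrix_unit_def)
  also have "\<dots> = (\<Sum>p<n. if p = i then R i j b c else 0)"
    using assms by (intro sum.cong) auto
  finally show ?thesis using assms by (simp add: entry_def rep_of_entries_def)
qed

lemma sum_mult_double_sums:
  fixes a b :: "nat \<Rightarrow> nat \<Rightarrow> complex"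
  shows "(\<Sum>c<d. (\<Sum>i<n. \<Sum>j<n. a i j * r i j c) * (\<Sum>k<n. \<Sum>l<n. b k l * s k l c)) =
    (\<Sum>i<n. \<Sum>j<n. \<Sum>k<n. \<Sum>l<n. a i j * b k l * (\<Sum>c<d. r i j c * s k l c))"
proof -
  have *: "(\<Sum>c<d. (\<Sum>x\<in>X. f x * g x c) * (\<Sum>y\<in>X. h y * w y c)) =
      (\<Sum>x\<in>X. \<Sum>y\<in>X. f x * h y * (\<Sum>c<d. g x c * w y c))"
    for X :: "(nat \<times> nat) set" and f h :: "nat \<times> nat \<Rightarrow> complex" and g w
  proof -
    have "(\<Sum>c<d. (\<Sum>x\<in>X. f x * g x c) * (\<Sum>y\<in>X. h y * w y c)) =
        (\<Sum>x\<in>X. \<Sum>c<d. \<Sum>y\<in>X. (f x * g x c) * (h y * w y c))"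
      unfolding sum_product by (rule sum.swap)
    also have "\<dots> = (\<Sum>x\<in>X. \<Sum>y\<in>X. \<Sum>c<d. (f x * g x c) * (h y * w y c))"
      by (rule sum.cong[OF refl], rule sum.swap)
    finally show ?thesis by (simp add: sum_distrib_left mult_ac)
  qed
  have pairs: "(\<Sum>i<n. \<Sum>j<n. F i j) = (\<Sum>x\<in>{..<n} \<times> {..<n}. F (fst x) (snd x))" for F :: "nat \<Rightarrow> nat \<Rightarrow> complex"
    by (simp add: sum.cartesian_product case_prod_beta)
  show ?thesis unfolding pairs by (rule *)
qed

lemma gl_module_rep_of_entries:
  assumes R: "gl_entries n d R"
  shows "gl_module n d (rep_of_entries n d R)"
proof -
  let ?r = "rep_of_entries n d R"
  have "?r (A * B - B * A) = ?r A * ?r B - ?r B * ?r A"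
    if A: "A \<in> carrier_mat n n" and B: "B \<in> carrier_mat n n" for A B
  proof (rule eq_matI)
    fix b e assume "b < dim_row (?r A * ?r B - ?r B * ?r A)" "e < dim_col (?r A * ?r B - ?r B * ?r A)"
    then have be: "b < d" "e < d" by (auto simp: rep_of_entries_def)
    have prod: "(?r A * ?r B) $$ (b, e) = (\<Sum>c<d. (\<Sum>i<n. \<Sum>j<n. A $$ (i, j) * R i j b c) *
          (\<Sum>k<n. \<Sum>l<n. B $$ (k, l) * R k l c e))" for A B
      using be by (simp add: rep_of_entries_def scalar_prod_def atLeast0LessThan)
    have AB1: "(?r A * ?r B) $$ (b, e) = (\<Sum>i<n. \<Sum>j<n. \<Sum>k<n. \<Sum>l<n. A $$ (i, j) * B $$ (k, l) *
        (\<Sum>c<d. R i j b c * R k l c e))"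
      unfolding prod by (rule sum_mult_double_sums)
    have BA1: "(?r B * ?r A) $$ (b, e) = (\<Sum>i<n. \<Sum>j<n. \<Sum>k<n. \<Sum>l<n. A $$ (i, j) * B $$ (k, l) *
        (\<Sum>c<d. R k l b c * R i j c e))"
      unfolding prod mult.commute[of "\<Sum>i<n. \<Sum>j<n. B $$ (i, j) * R i j b _"]
      unfolding sum_mult_double_sums by (simp only: mult.commute[of "R _ _ _ e"])
    have AB: "(A * B - B * A) $$ (p, q) = (\<Sum>c<n. A $$ (p, c) * B $$ (c, q)) - (\<Sum>c<n. B $$ (p, c) * A $$ (c, q))"
      if "p < n" "q < n" for p q
      using A B that by (simp add: scalar_prod_def atLeast0LessThan)
    have "(?r A * ?r B - ?r B * ?r A) $$ (b, e) = (?r A * ?r B) $$ (b, e) - (?r B * ?r A) $$ (b, e)"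
      using be by (simp add: rep_of_entries_def)
    also have "\<dots> = (\<Sum>i<n. \<Sum>j<n. \<Sum>k<n. \<Sum>l<n. A $$ (i, j) * B $$ (k, l) *
        ((\<Sum>c<d. R i j b c * R k l c e) - (\<Sum>c<d. R k l b c * R i j c e)))"
      unfolding AB1 BA1 by (simp add: sum_subtractf right_diff_distrib)
    also have "\<dots> = (\<Sum>i<n. \<Sum>j<n. \<Sum>k<n. \<Sum>l<n. A $$ (i, j) * B $$ (k, l) *
        ((if j = k then R i l b e else 0) - (if l = i then R k j b e else 0)))"
      using R be unfolding gl_entries_def by (intro sum.cong refl) simp
    also have "\<dots> = (\<Sum>i<n. \<Sum>j<n. \<Sum>k<n. \<Sum>l<n. if k = j then A $$ (i, j) * B $$ (k, l) * R i l b e else 0)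
       - (\<Sum>i<n. \<Sum>j<n. \<Sum>k<n. \<Sum>l<n. if l = i then A $$ (i, j) * B $$ (k, l) * R k j b e else 0)"
      unfolding sum_subtractf[symmetric] by (intro sum.cong refl) (simp add: right_diff_distrib)
    also have "(\<Sum>i<n. \<Sum>j<n. \<Sum>k<n. \<Sum>l<n. if k = j then A $$ (i, j) * B $$ (k, l) * R i l b e else 0)
        = (\<Sum>i<n. \<Sum>l<n. (\<Sum>j<n. A $$ (i, j) * B $$ (j, l)) * R i l b e)"
    proof -
      have "(\<Sum>k<n. \<Sum>l<n. if k = j then A $$ (i, j) * B $$ (k, l) * R i l b e else 0) =
          (\<Sum>l<n. A $$ (i, j) * B $$ (j, l) * R i l b e)" if "j < n" for i j
        using that by (subst sum.swap) simp
      then have "(\<Sum>i<n. \<Sum>j<n. \<Sum>k<n. \<Sum>l<n. if k = j then A $$ (i, j) * B $$ (k, l) * R i l b e else 0)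
        = (\<Sum>i<n. \<Sum>j<n. \<Sum>l<n. A $$ (i, j) * B $$ (j, l) * R i l b e)" by simp
      also have "\<dots> = (\<Sum>i<n. \<Sum>l<n. \<Sum>j<n. A $$ (i, j) * B $$ (j, l) * R i l b e)"
        by (rule sum.cong[OF refl], rule sum.swap)
      finally show ?thesis by (simp add: sum_distrib_right)
    qed
    also have "(\<Sum>i<n. \<Sum>j<n. \<Sum>k<n. \<Sum>l<n. if l = i then A $$ (i, j) * B $$ (k, l) * R k j b e else 0)
        = (\<Sum>k<n. \<Sum>j<n. (\<Sum>i<n. B $$ (k, i) * A $$ (i, j)) * R k j b e)"
    proof -
      have "(\<Sum>i<n. \<Sum>j<n. \<Sum>k<n. \<Sum>l<n. if l = i then A $$ (i, j) * B $$ (k, l) * R k j b e else 0)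
        = (\<Sum>i<n. \<Sum>j<n. \<Sum>k<n. A $$ (i, j) * B $$ (k, i) * R k j b e)" by simp
      also have "\<dots> = (\<Sum>i<n. \<Sum>k<n. \<Sum>j<n. A $$ (i, j) * B $$ (k, i) * R k j b e)"
        by (rule sum.cong[OF refl], rule sum.swap)
      also have "\<dots> = (\<Sum>k<n. \<Sum>j<n. \<Sum>i<n. A $$ (i, j) * B $$ (k, i) * R k j b e)"
        by (subst sum.swap, rule sum.cong[OF refl], rule sum.swap)
      finally show ?thesis by (simp add: sum_distrib_left mult_ac)
    qed
    finally have "(?r A * ?r B - ?r B * ?r A) $$ (b, e) =
        (\<Sum>p<n. \<Sum>q<n. (A * B - B * A) $$ (p, q) * R p q b e)"
      using AB by (simp add: sum_subtractf left_diff_distrib)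
    then show "?r (A * B - B * A) $$ (b, e) = (?r A * ?r B - ?r B * ?r A) $$ (b, e)"
      using be by (simp add: rep_of_entries_def)
  qed (auto simp: rep_of_entries_def)
  moreover have "?r (A + B) = ?r A + ?r B" if "A \<in> carrier_mat n n" "B \<in> carrier_mat n n" for A B
    using that by (intro eq_matI) (auto simp: rep_of_entries_def sum.distrib algebra_simps)
  moreover have "?r (c \<cdot>\<^sub>m A) = c \<cdot>\<^sub>m ?r A" if "A \<in> carrier_mat n n" for c A
    using that by (intro eq_matI) (auto simp: rep_of_entries_def sum_distrib_left algebra_simps)
  ultimately show ?thesis
    unfolding gl_module_def by (auto simp: rep_of_entries_def)
qed

text \<open>A vector as a function that is 0 beyond the dimension.\<close>

definition fun_of_vec :: "complex vec \<Rightarrow> nat \<Rightarrow> complex" where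
  "fun_of_vec v = (\<lambda>b. if b < dim_vec v then v $ b else 0)"

lemma vec_fun_of_vec: "v \<in> carrier_vec d \<Longrightarrow> vec d (fun_of_vec v) = v"
  by (auto simp: fun_of_vec_def)

lemma fun_of_vec_vec: "f \<in> supp_space d \<Longrightarrow> fun_of_vec (vec d f) = f"
  by (auto simp: fun_of_vec_def supp_space_def fun_eq_iff)

lemma fun_of_vec_in: "v \<in> carrier_vec d \<Longrightarrow> fun_of_vec v \<in> supp_space d"
  by (auto simp: fun_of_vec_def supp_space_def)

lemma mult_mat_vec_matrix_unit:
  assumes "gl_module n d \<rho>"
  shows "\<rho> (matrix_unit n i j) *\<^sub>v vec d f = vec d (mat_op d (entry n \<rho> i j) f)"
proof -
  have "\<rho> (matrix_unit n i j) \<in> carrier_mat d d" using assms by (auto simp: gl_module_def)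
  then show ?thesis
    by (intro eq_vecI) (auto simp: mat_op_def entry_def scalar_prod_def atLeast0LessThan intro!: sum.cong)
qed

lemma mult_mat_vec_sum:
  assumes gl: "gl_module n d \<rho>" and A: "A \<in> carrier_mat n n"
  shows "\<rho> A *\<^sub>v vec d f = vec d (\<Sum>i<n. \<Sum>j<n. (\<lambda>x. A $$ (i, j) * mat_op d (entry n \<rho> i j) f x))"
proof (rule eq_vecI)
  have car: "\<rho> A \<in> carrier_mat d d" using gl A by (auto simp: gl_module_def)
  then show "dim_vec (\<rho> A *\<^sub>v vec d f) = dim_vec (vec d (\<Sum>i<n. \<Sum>j<n. (\<lambda>x. A $$ (i, j) * mat_op d (entry n \<rho> i j) f x)))"
    by simp
  fix b assume "b < dim_vec (vec d (\<Sum>i<n. \<Sum>j<n. (\<lambda>x. A $$ (i, j) * mat_op d (entry n \<rho> i j) f x)))"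
  then have b: "b < d" by simp
  have "(\<rho> A *\<^sub>v vec d f) $ b = (\<Sum>c<d. (\<Sum>i<n. \<Sum>j<n. A $$ (i, j) * entry n \<rho> i j b c) * f c)"
    using car b gl_module_sum[OF gl A b] by (auto simp: scalar_prod_def atLeast0LessThan intro!: sum.cong)
  also have "\<dots> = (\<Sum>i<n. \<Sum>j<n. \<Sum>c<d. A $$ (i, j) * entry n \<rho> i j b c * f c)"
    unfolding sum_distrib_right by (subst sum.swap, rule sum.cong[OF refl], rule sum.swap)
  finally show "(\<rho> A *\<^sub>v vec d f) $ b = vec d (\<Sum>i<n. \<Sum>j<n. (\<lambda>x. A $$ (i, j) * mat_op d (entry n \<rho> i j) f x)) $ b"
    using b by (simp add: sum_fun_apply mat_op_def sum_distrib_left mult.assoc)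
qed

lemma vec_subspace_iff:
  "VectorSpace.subspace class_ring W (module_vec TYPE(complex) d) \<longleftrightarrow>
     W \<subseteq> carrier_vec d \<and> 0\<^sub>v d \<in> W \<and> (\<forall>v\<in>W. \<forall>w\<in>W. v + w \<in> W) \<and> (\<forall>c. \<forall>v\<in>W. c \<cdot>\<^sub>v v \<in> W)"
proof -
  interpret vec_space "TYPE(complex)" d .
  show ?thesis
    unfolding VectorSpace.subspace_def submodule_def
    using vec_vs[where 'a=complex] vec_module[where 'a=complex] by (auto simp: module_vec_simps)
qed

text \<open>Simplicity in terms of subspaces of functions and of the matrix units only.\<close>

lemma simple_gl_module_iff:
  assumes gl: "gl_module n d \<rho>" and d: "d \<noteq> 0"
  shows "simple_gl_module n d \<rho> \<longleftrightarrow>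
    (\<forall>W. fs.subspace W \<and> W \<subseteq> supp_space d \<and>
       (\<forall>i<n. \<forall>j<n. \<forall>f\<in>W. mat_op d (entry n \<rho> i j) f \<in> W) \<longrightarrow> W = {0} \<or> W = supp_space d)"
    (is "_ \<longleftrightarrow> (\<forall>W. ?I W \<longrightarrow> _)")
proof (intro iffI allI impI)
  fix W assume simple: "simple_gl_module n d \<rho>" and W: "?I W"
  define W' where "W' = vec d ` W"
  have "0 \<in> W" "\<And>f g. f \<in> W \<Longrightarrow> g \<in> W \<Longrightarrow> f + g \<in> W"
    "\<And>c f. f \<in> W \<Longrightarrow> (\<lambda>x. c * f x) \<in> W"
    using W by (auto simp: fs.subspace_def)
  note Wc = this
  have "VectorSpace.subspace class_ring W' (module_vec TYPE(complex) d)"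
    unfolding vec_subspace_iff
  proof (intro conjI ballI allI)
    show "W' \<subseteq> carrier_vec d" by (auto simp: W'_def)
    have "vec d 0 = (0\<^sub>v d :: complex vec)" by auto
    then show "0\<^sub>v d \<in> W'" using Wc(1) unfolding W'_def by (metis imageI)
    fix v assume "v \<in> W'"
    then obtain f where f: "f \<in> W" "v = vec d f" by (auto simp: W'_def)
    have "c \<cdot>\<^sub>v v = vec d (\<lambda>x. c * f x)" for c using f by auto
    then show "c \<cdot>\<^sub>v v \<in> W'" for c using Wc(3)[OF f(1)] by (auto simp: W'_def)
    fix w assume "w \<in> W'"
    then obtain g where g: "g \<in> W" "w = vec d g" by (auto simp: W'_def)
    have "v + w = vec d (f + g)" using f g by auto
    then show "v + w \<in> W'" using Wc(2)[OF f(1) g(1)] by (auto simp: W'_def)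
  qed
  moreover have "\<rho> A *\<^sub>v w \<in> W'" if A: "A \<in> carrier_mat n n" and w: "w \<in> W'" for A w
  proof -
    obtain f where f: "f \<in> W" "w = vec d f" using w by (auto simp: W'_def)
    have "(\<Sum>i<n. \<Sum>j<n. (\<lambda>x. A $$ (i, j) * mat_op d (entry n \<rho> i j) f x)) \<in> W"
      using W f by (intro fs.subspace_sum fs.subspace_scale) auto
    then show ?thesis unfolding f(2) mult_mat_vec_sum[OF gl A] by (auto simp: W'_def)
  qed
  ultimately have "W' = {0\<^sub>v d} \<or> W' = carrier_vec d"
    using simple by (auto simp: simple_gl_module_def)
  moreover have WW': "W = fun_of_vec ` W'"
    using W fun_of_vec_vec by (force simp: W'_def image_image)
  moreover have "fun_of_vec (0\<^sub>v d) = 0" by (auto simp: fun_of_vec_def fun_eq_iff)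
  moreover have "fun_of_vec ` carrier_vec d = supp_space d"
  proof
    show "supp_space d \<subseteq> fun_of_vec ` carrier_vec d"
      using fun_of_vec_vec by (metis image_eqI subsetI vec_carrier)
  qed (auto intro: fun_of_vec_in)
  ultimately show "W = {0} \<or> W = supp_space d" by auto
next
  assume *: "\<forall>W. ?I W \<longrightarrow> W = {0} \<or> W = supp_space d"
  have "W = {0\<^sub>v d} \<or> W = carrier_vec d"
    if W: "VectorSpace.subspace class_ring W (module_vec TYPE(complex) d)"
      and inv: "\<And>A w. A \<in> carrier_mat n n \<Longrightarrow> w \<in> W \<Longrightarrow> \<rho> A *\<^sub>v w \<in> W" for W
  proof -
    define W' where "W' = {f \<in> supp_space d. vec d f \<in> W}"
    have Wc: "W \<subseteq> carrier_vec d" "0\<^sub>v d \<in> W" "\<And>v w. v \<in> W \<Longrightarrow> w \<in> W \<Longrightarrow> v + w \<in> W"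
      "\<And>c v. v \<in> W \<Longrightarrow> c \<cdot>\<^sub>v v \<in> W"
      using W unfolding vec_subspace_iff by auto
    have z: "vec d 0 = (0\<^sub>v d :: complex vec)" by auto
    have ad: "vec d (f + g) = vec d f + vec d g" for f g :: "nat \<Rightarrow> complex" by auto
    have sc: "vec d (\<lambda>x. c * f x) = c \<cdot>\<^sub>v vec d f" for c and f :: "nat \<Rightarrow> complex" by auto
    have "?I W'"
      using subspace_supp_space[of d] Wc inv
      by (auto simp: W'_def fs.subspace_def z ad sc mat_op_in_supp_space
          mult_mat_vec_matrix_unit[OF gl, symmetric])
    then have "W' = {0} \<or> W' = supp_space d" using * by blast
    moreover have "W = vec d ` W'"
    proof
      show "W \<subseteq> vec d ` W'"
      proof
        fix w assume w: "w \<in> W"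
        then have "vec d (fun_of_vec w) = w" "fun_of_vec w \<in> supp_space d"
          using Wc(1) vec_fun_of_vec fun_of_vec_in by blast+
        with w show "w \<in> vec d ` W'" unfolding W'_def by (metis (mono_tags, lifting) image_eqI mem_Collect_eq)
      qed
    qed (auto simp: W'_def)
    moreover have "vec d ` supp_space d = (carrier_vec d :: complex vec set)"
      using vec_fun_of_vec fun_of_vec_in by (auto simp: image_iff) metis
    ultimately show ?thesis using z by auto
  qed
  then show "simple_gl_module n d \<rho>"
    using gl d by (auto simp: simple_gl_module_def)
qed

lemma has_highest_weight_iff:
  assumes gl: "gl_module n d \<rho>"
  shows "has_highest_weight n d \<rho> p \<longleftrightarrow>
    (\<exists>f \<in> supp_space d. hw_vec n (\<lambda>i j. mat_op d (entry n \<rho> i j)) (\<lambda>i. of_nat (part p i)) f)"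
proof
  assume "has_highest_weight n d \<rho> p"
  then obtain v where v: "v \<in> carrier_vec d" "v \<noteq> 0\<^sub>v d"
    "\<And>i j. i < j \<Longrightarrow> j < n \<Longrightarrow> \<rho> (matrix_unit n i j) *\<^sub>v v = 0\<^sub>v d"
    "\<And>i. i < n \<Longrightarrow> \<rho> (matrix_unit n i i) *\<^sub>v v = of_nat (part p i) \<cdot>\<^sub>v v"
    by (auto simp: has_highest_weight_def)
  define f where "f = fun_of_vec v"
  have f: "f \<in> supp_space d" "v = vec d f" using v by (auto simp: f_def vec_fun_of_vec fun_of_vec_in)
  have eqI: "g = h" if "g \<in> supp_space d" "h \<in> supp_space d" "vec d g = vec d h" for g h :: "nat \<Rightarrow> complex"
    using fun_of_vec_vec that by metis
  have "f \<noteq> 0" using v f by auto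
  moreover have "mat_op d (entry n \<rho> i j) f = 0" if "i < j" "j < n" for i j
  proof (rule eqI)
    show "vec d (mat_op d (entry n \<rho> i j) f) = vec d 0"
      using v(3)[OF that] unfolding f(2) mult_mat_vec_matrix_unit[OF gl] by (auto simp: zero_vec_def)
  qed (auto simp: mat_op_in_supp_space, simp add: supp_space_def)
  moreover have "mat_op d (entry n \<rho> i i) f = (\<lambda>x. of_nat (part p i) * f x)" if "i < n" for i
  proof (rule eqI)
    show "vec d (mat_op d (entry n \<rho> i i) f) = vec d (\<lambda>x. of_nat (part p i) * f x)"
      using v(4)[OF that] unfolding f(2) mult_mat_vec_matrix_unit[OF gl] by auto
  qed (use f(1) in \<open>auto simp: mat_op_in_supp_space\<close>, simp add: supp_space_def)
  ultimately show "\<exists>f \<in> supp_space d. hw_vec n (\<lambda>i j. mat_op d (entry n \<rho> i j)) (\<lambda>i. of_nat (part p i)) f"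
    using f(1) by (auto simp: hw_vec_def)
next
  assume "\<exists>f \<in> supp_space d. hw_vec n (\<lambda>i j. mat_op d (entry n \<rho> i j)) (\<lambda>i. of_nat (part p i)) f"
  then obtain f where f: "f \<in> supp_space d"
    "hw_vec n (\<lambda>i j. mat_op d (entry n \<rho> i j)) (\<lambda>i. of_nat (part p i)) f" by blast
  have "vec d f \<noteq> 0\<^sub>v d"
  proof
    assume "vec d f = 0\<^sub>v d"
    then have "f = fun_of_vec (0\<^sub>v d)" using fun_of_vec_vec[OF f(1)] by simp
    then have "f = 0" by (auto simp: fun_of_vec_def fun_eq_iff)
    then show False using f by (simp add: hw_vec_def)
  qed
  then show "has_highest_weight n d \<rho> p"
    using f unfolding has_highest_weight_def
    by (intro bexI[of _ "vec d f"]) (auto simp: mult_mat_vec_matrix_unit[OF gl] hw_vec_def)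
qed

section \<open>Fermionic Fock space and the existence of simple modules\<close>

text \<open>The fermionic Fock space consists of functions on the sets of occupied states. This is the sign
picked up by moving state \<open>x\<close> past the smaller states in \<open>S\<close>.\<close>

definition fsign :: "nat \<Rightarrow> nat set \<Rightarrow> complex" where
  "fsign x S = (-1) ^ card {y \<in> S. y < x}"

text \<open>Annihilation of a particle in state \<open>x\<close>, in terms of the coefficient functions.\<close>

definition annih :: "nat \<Rightarrow> (nat set \<Rightarrow> complex) \<Rightarrow> nat set \<Rightarrow> complex" where
  "annih x f S = (if x \<in> S then 0 else fsign x S * f (insert x S))"

text \<open>Creation of a particle in state \<open>x\<close>.\<close>

definition creat :: "nat \<Rightarrow> (nat set \<Rightarrow> complex) \<Rightarrow> nat set \<Rightarrow> complex" where
  "creat x f S = (if x \<in> S then fsign x S * f (S - {x}) else 0)"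

lemma fsign_insert:
  assumes "y \<notin> S"
  shows "fsign x (insert y S) = (if y < x then - fsign x S else fsign x S)"
proof -
  have "{z \<in> insert y S. z < x} = (if y < x then insert y {z \<in> S. z < x} else {z \<in> S. z < x})"
    by auto
  then show ?thesis using assms by (simp add: fsign_def)
qed

lemma fsign_remove:
  assumes "y \<in> S"
  shows "fsign x (S - {y}) = (if y < x then - fsign x S else fsign x S)"
  using fsign_insert[of y "S - {y}" x] assms by (auto simp: insert_absorb split: if_splits)

lemma fsign_sq [simp]: "fsign x S * fsign x S = 1"
  by (simp add: fsign_def flip: power_mult_distrib)

lemma annih_annih: "annih x (annih y f) = (\<lambda>S. - annih y (annih x f) S)"
  by (rule ext, cases x y rule: linorder_cases)
    (auto simp: annih_def fsign_insert insert_commute)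

lemma creat_creat: "creat x (creat y f) = (\<lambda>S. - creat y (creat x f) S)"
proof
  fix S
  have "S - {x} - {y} = S - {y} - {x}" by auto
  then show "creat x (creat y f) S = - creat y (creat x f) S"
    by (cases x y rule: linorder_cases) (auto simp: creat_def fsign_remove)
qed

text \<open>The canonical anticommutation relation.\<close>

lemma annih_creat: "annih x (creat y f) = (\<lambda>S. (if x = y then f S else 0) - creat y (annih x f) S)"
proof
  fix S
  consider "x = y" | "x < y" | "y < x" by linarith
  then show "annih x (creat y f) S = (if x = y then f S else 0) - creat y (annih x f) S"
  proof cases
    case 1
    then show ?thesis
      by (auto simp: annih_def creat_def fsign_remove fsign_insert insert_absorb)
  next
    case 2
    have "insert x S - {y} = insert x (S - {y})" using 2 by auto
    then show ?thesis using 2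
      by (auto simp: annih_def creat_def fsign_remove fsign_insert)
  next
    case 3
    have "insert x S - {y} = insert x (S - {y})" using 3 by auto
    then show ?thesis using 3
      by (auto simp: annih_def creat_def fsign_remove fsign_insert)
  qed
qed

lemma annih_linear:
  "annih x (f + g) = annih x f + annih x g" "annih x (\<lambda>S. c * f S) = (\<lambda>S. c * annih x f S)"
  "annih x (f - g) = annih x f - annih x g" "annih x (\<lambda>S. - f S) = (\<lambda>S. - annih x f S)"
  "annih x (\<lambda>S. f S - g S) = (\<lambda>S. annih x f S - annih x g S)" "annih x 0 = 0"
  "annih x (\<lambda>S. 0) = (\<lambda>S. 0)"
  by (auto simp: annih_def fun_eq_iff algebra_simps)

lemma creat_linear:
  "creat x (f + g) = creat x f + creat x g" "creat x (\<lambda>S. c * f S) = (\<lambda>S. c * creat x f S)"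
  "creat x (f - g) = creat x f - creat x g" "creat x (\<lambda>S. - f S) = (\<lambda>S. - creat x f S)"
  "creat x (\<lambda>S. f S - g S) = (\<lambda>S. creat x f S - creat x g S)" "creat x 0 = 0"
  "creat x (\<lambda>S. 0) = (\<lambda>S. 0)"
  by (auto simp: creat_def fun_eq_iff algebra_simps)

lemma creat_annih_comm:
  "creat x (annih y (creat z (annih w f))) = creat z (annih w (creat x (annih y f)))
     + (if y = z then creat x (annih w f) else 0) - (if w = x then creat z (annih y f) else 0)"
proof -
  have 1: "creat x (annih y (creat z (annih w f))) =
      (\<lambda>S. (if y = z then creat x (annih w f) S else 0) - creat x (creat z (annih y (annih w f))) S)"
    for x y z w
  proof -
    have "creat x (annih y (creat z (annih w f))) =
      creat x (\<lambda>S. (if y = z then annih w f S else 0) - creat z (annih y (annih w f)) S)"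
      by (subst annih_creat) (rule refl)
    also have "\<dots> = (\<lambda>S. creat x (\<lambda>S. if y = z then annih w f S else 0) S
        - creat x (creat z (annih y (annih w f))) S)"
      by (rule creat_linear(5))
    also have "creat x (\<lambda>S. if y = z then annih w f S else 0) = (\<lambda>S. if y = z then creat x (annih w f) S else 0)"
      by (cases "y = z") (simp_all add: creat_linear)
    finally show ?thesis .
  qed
  have 2: "creat x (creat z (annih y (annih w f))) = creat z (creat x (annih w (annih y f)))"
    by (subst creat_creat, subst annih_annih) (simp add: creat_linear)
  show ?thesis
    unfolding 1[of x y z w] 1[of z w x y] 2 by (auto simp: fun_eq_iff)
qed

text \<open>The action of \<open>gl\<^sub>n\<close> on the exterior algebra of \<open>\<complex>\<^sup>n \<otimes> \<complex>\<^sup>r\<close>. The states are the pairs \<open>(i, c)\<close>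
with \<open>i < n\<close> and \<open>c < r\<close>, encoded as natural numbers to have a linear order for the signs.\<close>

definition fock_op :: "nat \<Rightarrow> nat \<Rightarrow> nat \<Rightarrow> (nat set \<Rightarrow> complex) \<Rightarrow> nat set \<Rightarrow> complex" where
  "fock_op r i j f = (\<Sum>c<r. creat (prod_encode (i, c)) (annih (prod_encode (j, c)) f))"

lemma creat_annih_sum:
  "creat x (annih y (\<Sum>c\<in>A. g c)) = (\<Sum>c\<in>A. creat x (annih y (g c)))"
proof (induction A rule: infinite_finite_induct)
  case (insert a A)
  have "creat x (annih y (\<Sum>c\<in>insert a A. g c)) = creat x (annih y (g a + (\<Sum>c\<in>A. g c)))"
    by (subst sum.insert[OF insert.hyps]) (rule refl)
  also have "\<dots> = creat x (annih y (g a)) + creat x (annih y (\<Sum>c\<in>A. g c))"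
    unfolding annih_linear creat_linear ..
  also have "\<dots> = (\<Sum>c\<in>insert a A. creat x (annih y (g c)))"
    unfolding insert.IH by (subst sum.insert[OF insert.hyps]) (rule refl)
  finally show ?case .
qed (simp_all add: annih_linear creat_linear)

lemma gl_action_fock: "gl_action n (fock_op r)"
proof -
  have "fock_op r i j (f + g) = fock_op r i j f + fock_op r i j g" for i j f g
    by (simp add: fock_op_def annih_linear creat_linear sum.distrib)
  moreover have "fock_op r i j (\<lambda>x. c * f x) = (\<lambda>x. c * fock_op r i j f x)" for i j c f
    by (simp add: fock_op_def annih_linear creat_linear fun_eq_iff sum_fun_apply sum_distrib_left)
  moreover have "fock_op r i j (fock_op r k l f) = fock_op r k l (fock_op r i j f) +
      (if j = k then fock_op r i l f else 0) - (if l = i then fock_op r k j f else 0)" for i j k l f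
  proof -
    let ?e = "\<lambda>i c. prod_encode (i, c)"
    have "fock_op r i j (fock_op r k l f) = (\<Sum>c<r. \<Sum>c'<r.
        creat (?e i c) (annih (?e j c) (creat (?e k c') (annih (?e l c') f))))"
      by (simp add: fock_op_def creat_annih_sum)
    also have "\<dots> = (\<Sum>c<r. \<Sum>c'<r. creat (?e k c') (annih (?e l c') (creat (?e i c) (annih (?e j c) f)))
        + (if c' = c then if j = k then creat (?e i c) (annih (?e l c') f) else 0 else 0)
        - (if c' = c then if l = i then creat (?e k c') (annih (?e j c) f) else 0 else 0))"
      by (subst creat_annih_comm) (intro sum.cong refl, auto)
    also have "\<dots> = (\<Sum>c<r. \<Sum>c'<r. creat (?e k c') (annih (?e l c') (creat (?e i c) (annih (?e j c) f))))
      + (\<Sum>c<r. if j = k then creat (?e i c) (annih (?e l c) f) else 0)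
      - (\<Sum>c<r. if l = i then creat (?e k c) (annih (?e j c) f) else 0)"
      by (simp add: sum.distrib sum_subtractf)
    also have "(\<Sum>c<r. \<Sum>c'<r. creat (?e k c') (annih (?e l c') (creat (?e i c) (annih (?e j c) f))))
        = fock_op r k l (fock_op r i j f)"
      by (subst sum.swap) (simp add: fock_op_def creat_annih_sum)
    finally show ?thesis by (auto simp: fock_op_def)
  qed
  ultimately show ?thesis unfolding gl_action_def by blast
qed

text \<open>Every partition occurs as a highest weight: the basis vector in which the occupied states are the
boxes of its diagram is killed by the raising operators.\<close>

lemma has_hw_rep_exists:
  assumes mono: "\<And>i j. i \<le> j \<Longrightarrow> j < n \<Longrightarrow> lam j \<le> lam i"
  shows "\<exists>d. has_hw_rep n d (\<lambda>i. of_nat (lam i))"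
proof -
  define r where "r = lam 0"
  define X where "X = prod_encode ` ({..<n} \<times> {..<r})"
  \<comment> \<open>The boxes of the diagram; \<open>X\<close> consists of all states that are used.\<close>
  define S0 where "S0 = {prod_encode (i, c) | i c. i < n \<and> c < lam i}"
  define W where "W = {f :: nat set \<Rightarrow> complex. \<forall>S. \<not> S \<subseteq> X \<longrightarrow> f S = 0}"
  define v where "v S = (if S = S0 then 1 else 0 :: complex)" for S
  have lam_le: "lam i \<le> r" if "i < n" for i using mono[of 0 i] that by (simp add: r_def)
  have S0X: "S0 \<subseteq> X" using lam_le by (force simp: S0_def X_def)
  have inS0: "prod_encode (i, c) \<in> S0 \<longleftrightarrow> i < n \<and> c < lam i" for i c
    by (auto simp: S0_def)
  have "finite (Pow X)" by (simp add: X_def)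
  then obtain h where h: "bij_betw h {..<card (Pow X)} (Pow X)"
    using ex_bij_betw_nat_finite by (metis atLeast0LessThan)
  define k where "k = card (Pow X)"
  have W: "fs.subspace W" by (auto simp: fs.subspace_def W_def)
  have inv: "fock_op r i j f \<in> W" if "i < n" "j < n" "f \<in> W" for i j f
  proof -
    have "creat (prod_encode (i, c)) (annih (prod_encode (j, c)) f) S = 0" if "c < r" "\<not> S \<subseteq> X" for c S
    proof -
      have "prod_encode (i, c) \<in> X" using \<open>i < n\<close> \<open>c < r\<close> by (auto simp: X_def)
      then have "\<not> insert y (S - {prod_encode (i, c)}) \<subseteq> X" for y using \<open>\<not> S \<subseteq> X\<close> by auto
      then show ?thesis using \<open>f \<in> W\<close> by (simp add: W_def creat_def annih_def)
    qed
    then show ?thesis by (simp add: W_def fock_op_def sum_fun_apply)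
  qed
  define u where "u b = (\<lambda>S. if S = h b then 1 else 0 :: complex)" for b
  define \<phi> where "\<phi> b f = f (h b)" for b and f :: "nat set \<Rightarrow> complex"
  have hX: "h b \<subseteq> X" if "b < k" for b using h that by (auto simp: bij_betw_def k_def)
  have ker: "f = 0" if "f \<in> W" "\<And>c. c < k \<Longrightarrow> \<phi> c f = 0" for f
  proof
    fix S
    show "f S = 0 S"
    proof (cases "S \<subseteq> X")
      case True
      then have "S \<in> h ` {..<k}" using h by (simp add: bij_betw_def k_def)
      then obtain c where "c < k" "S = h c" by blast
      then show ?thesis using that(2)[of c] by (simp add: \<phi>_def)
    qed (use that in \<open>simp add: W_def\<close>)
  qed
  have hinj: "h b = h c \<longleftrightarrow> b = c" if "b < k" "c < k" for b c
    using h that unfolding bij_betw_def inj_on_def k_def by blast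
  have vW: "v \<in> W" using S0X by (auto simp: W_def v_def)
  have "hw_vec n (fock_op r) (\<lambda>i. of_nat (lam i)) v"
    unfolding hw_vec_def
  proof (intro conjI allI impI)
    have "v S0 = 1" by (simp add: v_def)
    then show "v \<noteq> 0" by auto
    have v_ann: "annih x v = 0" if "x \<notin> S0" for x
      using that by (auto simp: annih_def v_def fun_eq_iff)
    have v_cre: "creat x v = 0" if "x \<in> S0" for x
      using that by (auto simp: creat_def v_def fun_eq_iff)
    show "fock_op r i j v = 0" if "i < j \<and> j < n" for i j
    proof -
      have "creat (prod_encode (i, c)) (annih (prod_encode (j, c)) v) = 0" for c
      proof (cases "prod_encode (j, c) \<in> S0")
        case True
        then have "prod_encode (i, c) \<in> S0" using mono[of i j] that by (auto simp: inS0)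
        moreover have "prod_encode (j, c) \<noteq> prod_encode (i, c)" using that by simp
        ultimately have "annih (prod_encode (j, c)) (creat (prod_encode (i, c)) v) = 0"
          by (simp add: v_cre annih_linear)
        with \<open>prod_encode (j, c) \<noteq> _\<close> show ?thesis
          by (auto simp: annih_creat fun_eq_iff)
      qed (simp add: v_ann creat_linear)
      then show ?thesis by (simp add: fock_op_def)
    qed
    show "fock_op r i i v = (\<lambda>x. of_nat (lam i) * v x)" if "i < n" for i
    proof -
      have "creat (prod_encode (i, c)) (annih (prod_encode (i, c)) v) = (if c < lam i then v else 0)" for c
      proof (cases "c < lam i")
        case True
        then have "prod_encode (i, c) \<in> S0" using that by (simp add: inS0)
        then have "annih (prod_encode (i, c)) (creat (prod_encode (i, c)) v) = 0"
          by (simp add: v_cre annih_linear)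
        then show ?thesis using True by (auto simp: annih_creat fun_eq_iff)
      next
        case False
        then show ?thesis by (simp add: inS0 v_ann creat_linear)
      qed
      then have "fock_op r i i v = (\<Sum>c<r. if c < lam i then v else 0)" by (simp add: fock_op_def)
      also have "\<dots> = (\<Sum>c\<in>{..<r} \<inter> {c. c < lam i}. v)"
        by (subst sum.inter_restrict) auto
      also have "{..<r} \<inter> {c. c < lam i} = {..<lam i}" using lam_le[OF that] by auto
      also have "(\<Sum>c<lam i. v) = (\<lambda>x. of_nat (lam i) * v x)"
        by (simp add: fun_eq_iff sum_fun_apply)
      finally show ?thesis .
    qed
  qed
  moreover have "S0 \<in> h ` {..<k}" using h S0X by (simp add: bij_betw_def k_def)
  then obtain b0 where "b0 < k" "h b0 = S0" by blast
  ultimately have "has_hw_rep n k (\<lambda>i. of_nat (lam i))"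
  proof (intro has_hw_rep_subquotient[where \<phi> = \<phi> and u = u and v = v and ?b0.0 = b0, OF gl_action_fock W])
    show "u c \<in> W" if "c < k" for c using hX[OF that] by (auto simp: W_def u_def)
    show "\<phi> b (fock_op r i j f) = 0" if "i < n" "j < n" "f \<in> W" "\<And>c. c < k \<Longrightarrow> \<phi> c f = 0" "b < k" for i j f b
      using ker[OF that(3,4)] gl_action_zero[OF gl_action_fock that(1,2), of r] by (simp add: \<phi>_def)
  qed (use inv hinj vW in \<open>auto simp: \<phi>_def u_def v_def\<close>)
  then show ?thesis ..
qed

lemma simple_gl_module_exists:
  assumes mono: "\<And>i j. i \<le> j \<Longrightarrow> j < n \<Longrightarrow> part p j \<le> part p i"
  shows "\<exists>d \<rho>. simple_gl_module n d \<rho> \<and> has_highest_weight n d \<rho> p"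
proof -
  let ?lam = "\<lambda>i. of_nat (part p i) :: complex"
  define d where "d = (LEAST d. has_hw_rep n d ?lam)"
  have d: "has_hw_rep n d ?lam" and minimal: "\<And>k. k < d \<Longrightarrow> \<not> has_hw_rep n k ?lam"
    using has_hw_rep_exists[OF mono] unfolding d_def by (auto intro: LeastI_ex dest: not_less_Least)
  obtain R f where R: "gl_entries n d R" and f: "f \<in> supp_space d" "hw_vec n (\<lambda>i j. mat_op d (R i j)) ?lam f"
    using d by (auto simp: has_hw_rep_def)
  define \<rho> where "\<rho> = rep_of_entries n d R"
  have gl: "gl_module n d \<rho>" unfolding \<rho>_def by (rule gl_module_rep_of_entries[OF R])
  have ent: "mat_op d (entry n \<rho> i j) g = mat_op d (R i j) g" if "i < n" "j < n" for i j g
    using that by (auto simp: mat_op_def fun_eq_iff \<rho>_def entry_rep_of_entries)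
  have "d \<noteq> 0"
  proof
    assume "d = 0"
    then have "f = 0" using f(1) by (auto simp: supp_space_def)
    then show False using f(2) by (simp add: hw_vec_def)
  qed
  then have "simple_gl_module n d \<rho>"
    unfolding simple_gl_module_iff[OF gl \<open>d \<noteq> 0\<close>]
    using minimal_rep_simple[OF R f minimal] ent by auto
  moreover have "hw_vec n (\<lambda>i j. mat_op d (entry n \<rho> i j)) ?lam f"
    using f(2) ent by (auto simp: hw_vec_def)
  then have "has_highest_weight n d \<rho> p"
    unfolding has_highest_weight_iff[OF gl] using f(1) by blast
  ultimately show ?thesis by blast
qed

section \<open>Weight bases and the Casimir operator\<close>

text \<open>The matrix entries of a representation with respect to a basis of weight vectors; \<open>wt b\<close> is the
weight of the \<open>b\<close>-th basis vector, set to 0 beyond \<open>n\<close>, and \<open>b0\<close> is the index of the highest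
weight vector. All other weights are strictly smaller in the pairing with any strictly decreasing
\<open>y\<close>, which replaces the dominance order. The last assumption says that the diagonal entries of
the Casimir operator are equal.\<close>

locale weight_module =
  fixes n d :: nat and R :: "nat \<Rightarrow> nat \<Rightarrow> nat \<Rightarrow> nat \<Rightarrow> complex"
    and wt :: "nat \<Rightarrow> nat \<Rightarrow> int" and b0 :: nat
  assumes rep: "gl_entries n d R"
    and diag: "\<And>i b c. i < n \<Longrightarrow> b < d \<Longrightarrow> c < d \<Longrightarrow> R i i b c = (if b = c then of_int (wt b i) else 0)"
    and wt_zero: "\<And>b i. b < d \<Longrightarrow> n \<le> i \<Longrightarrow> wt b i = 0"
    and wt_total: "\<And>b. b < d \<Longrightarrow> (\<Sum>i<n. wt b i) = (\<Sum>i<n. wt b0 i)"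
    and b0: "b0 < d"
    and wt_less: "\<And>b y. b < d \<Longrightarrow> b \<noteq> b0 \<Longrightarrow> (\<And>i j. i < j \<Longrightarrow> j < n \<Longrightarrow> y j < y i) \<Longrightarrow>
      (\<Sum>i<n. y i * wt b i) < (\<Sum>i<n. y i * wt b0 i)"
    and casimir: "\<exists>c. \<forall>b<d. (\<Sum>i<n. \<Sum>j<n. \<Sum>e<d. R i j b e * R j i e b) = c"

text \<open>The vectors obtained from \<open>v\<close> by lowering operators, along with their weights.\<close>

inductive lowered :: "nat \<Rightarrow> (nat \<Rightarrow> nat \<Rightarrow> ('x \<Rightarrow> complex) \<Rightarrow> 'x \<Rightarrow> complex) \<Rightarrow> (nat \<Rightarrow> int) \<Rightarrow>
    ('x \<Rightarrow> complex) \<Rightarrow> ('x \<Rightarrow> complex) \<Rightarrow> (nat \<Rightarrow> int) \<Rightarrow> bool"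
  for n E lam v where
  base: "lowered n E lam v v lam"
| step: "lowered n E lam v f \<kappa> \<Longrightarrow> i < j \<Longrightarrow> j < n \<Longrightarrow>
    lowered n E lam v (E j i f) (\<lambda>a. \<kappa> a - (if a = i then 1 else 0) + (if a = j then 1 else 0))"

lemma lowered_weight:
  assumes gl: "gl_action n E" and hw: "hw_vec n E (\<lambda>i. of_int (lam i)) v"
    and l: "lowered n E lam v f \<kappa>" and a: "a < n"
  shows "E a a f = (\<lambda>x. of_int (\<kappa> a) * f x)"
  using l
proof (induction rule: lowered.induct)
  case base
  then show ?case using hw a by (simp add: hw_vec_def)
next
  case (step f \<kappa> i j)
  have ij: "i < n" "j < n" using step.hyps by auto
  have "E a a (E j i f) = E j i (\<lambda>x. of_int (\<kappa> a) * f x) + (if a = j then E a i f else 0) - (if i = a then E j a f else 0)"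
    using gl_action_comm[OF gl a a ij(2,1)] step.IH by simp
  also have "E j i (\<lambda>x. of_int (\<kappa> a) * f x) = (\<lambda>x. of_int (\<kappa> a) * E j i f x)"
    by (rule gl_action_scale[OF gl ij(2,1)])
  finally show ?case using step.hyps by (auto simp: fun_eq_iff algebra_simps)
qed

lemma lowered_total:
  assumes "lowered n E lam v f \<kappa>"
  shows "(\<Sum>i<n. \<kappa> i) = (\<Sum>i<n. lam i)"
  using assms by (induction rule: lowered.induct) (simp_all add: sum.distrib sum_subtractf)

lemma lowered_zero:
  assumes "lowered n E lam v f \<kappa>" "\<And>i. n \<le> i \<Longrightarrow> lam i = 0" "n \<le> i"
  shows "\<kappa> i = 0"
  using assms by (induction rule: lowered.induct) auto

lemma lowered_less:
  fixes y :: "nat \<Rightarrow> int"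
  assumes "lowered n E lam v f \<kappa>" and y: "\<And>i j. i < j \<Longrightarrow> j < n \<Longrightarrow> y j < y i"
  shows "f = v \<and> \<kappa> = lam \<or> (\<Sum>i<n. y i * \<kappa> i) < (\<Sum>i<n. y i * lam i)"
  using assms(1)
proof (induction rule: lowered.induct)
  case (step f \<kappa> i j)
  have "(\<Sum>a<n. y a * (\<kappa> a - (if a = i then 1 else 0) + (if a = j then 1 else 0))) =
      (\<Sum>a<n. y a * \<kappa> a - (if a = i then y i else 0) + (if a = j then y j else 0))"
    by (intro sum.cong) (auto simp: algebra_simps)
  also have "\<dots> = (\<Sum>a<n. y a * \<kappa> a) - y i + y j"
    using step.hyps by (simp add: sum.distrib sum_subtractf)
  finally show ?case using y[OF step.hyps(2,3)] step.IH by auto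
qed simp

lemma lowered_span_lowering:
  assumes gl: "gl_action n E" and ij: "i < j" "j < n"
    and g: "g \<in> fs.span {f. \<exists>\<kappa>. lowered n E lam v f \<kappa>}"
  shows "E j i g \<in> fs.span {f. \<exists>\<kappa>. lowered n E lam v f \<kappa>}" (is "_ \<in> fs.span ?L")
  using g
proof (induction rule: fs.span_induct)
  case base
  have "i < n" using ij by simp
  then show ?case
    using fs.subspace_span[of ?L] ij
    by (auto simp: fs.subspace_def gl_action_zero[OF gl] gl_action_add[OF gl] gl_action_scale[OF gl])
next
  case (step f)
  then show ?case using lowered.step[OF _ ij] by (intro fs.span_base) blast
qed

lemma lowered_span_aux:
  assumes gl: "gl_action n E" and hw: "hw_vec n E (\<lambda>i. of_int (lam i)) v"
    and l: "lowered n E lam v f \<kappa>" and ab: "a < n" "b < n"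
  shows "E a b f \<in> fs.span {f. \<exists>\<kappa>. lowered n E lam v f \<kappa>}" (is "_ \<in> fs.span ?L")
  using l ab
proof (induction arbitrary: a b rule: lowered.induct)
  case base
  have v: "v \<in> fs.span ?L" by (intro fs.span_base) (auto intro: lowered.base)
  consider "a < b" | "a = b" | "b < a" by linarith
  then show ?case
  proof cases
    case 1
    then have "E a b v = 0" using hw base by (simp add: hw_vec_def)
    then show ?thesis using fs.span_zero by metis
  next
    case 2
    then have "E a b v = (\<lambda>x. of_int (lam a) * v x)" using hw base by (simp add: hw_vec_def)
    then show ?thesis using fs.span_scale[OF v] by metis
  next
    case 3
    then show ?thesis using lowered_span_lowering[OF gl _ _ v] base by blast
  qed
next
  case (step f \<kappa> i j)
  have ij: "i < n" "j < n" using step.hyps by auto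
  have eq: "E a b (E j i f) = E j i (E a b f) + (if b = j then E a i f else 0) - (if i = a then E j b f else 0)"
    by (rule gl_action_comm[OF gl step.prems ij(2,1)])
  moreover have "E j i (E a b f) \<in> fs.span ?L"
    by (rule lowered_span_lowering[OF gl step.hyps(2,3) step.IH[OF step.prems]])
  moreover have "(if b = j then E a i f else 0) \<in> fs.span ?L"
    using step.IH[OF step.prems(1) ij(1)] fs.span_zero by (cases "b = j") (simp_all only: simp_thms if_True if_False)
  moreover have "(if i = a then E j b f else 0) \<in> fs.span ?L"
    using step.IH[OF ij(2) step.prems(2)] fs.span_zero by (cases "i = a") (simp_all only: simp_thms if_True if_False)
  ultimately show ?case unfolding eq by (intro fs.span_diff fs.span_add)
qed

lemma lowered_span_invariant:
  assumes gl: "gl_action n E" and hw: "hw_vec n E (\<lambda>i. of_int (lam i)) v" and ab: "a < n" "b < n"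
    and g: "g \<in> fs.span {f. \<exists>\<kappa>. lowered n E lam v f \<kappa>}"
  shows "E a b g \<in> fs.span {f. \<exists>\<kappa>. lowered n E lam v f \<kappa>}" (is "_ \<in> fs.span ?L")
  using g
proof (induction rule: fs.span_induct)
  case base
  show ?case
    using fs.subspace_span[of ?L] ab
    by (auto simp: fs.subspace_def gl_action_zero[OF gl] gl_action_add[OF gl] gl_action_scale[OF gl])
next
  case (step f)
  then show ?case using lowered_span_aux[OF gl hw _ ab] by blast
qed

text \<open>The quadratic Casimir operator.\<close>

definition casimir_op :: "nat \<Rightarrow> (nat \<Rightarrow> nat \<Rightarrow> ('x \<Rightarrow> complex) \<Rightarrow> 'x \<Rightarrow> complex) \<Rightarrow> ('x \<Rightarrow> complex) \<Rightarrow> 'x \<Rightarrow> complex" where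
  "casimir_op n E g = (\<Sum>i<n. \<Sum>j<n. E i j (E j i g))"

lemma casimir_op_commute:
  assumes gl: "gl_action n E" and ab: "a < n" "b < n"
  shows "E a b (casimir_op n E g) = casimir_op n E (E a b g)"
proof -
  have if_app: "E i j (if P then f else 0) = (if P then E i j f else 0)" if "i < n" "j < n" for i j P f
    using gl_action_zero[OF gl that] by simp
  have summand: "E a b (E i j (E j i g)) = E i j (E j i (E a b g))
      + ((if j = b then E i j (E a i g) else 0) - (if i = a then E i j (E j b g) else 0)
      + (if i = b then E a j (E j i g) else 0) - (if j = a then E i b (E j i g) else 0))"
    if ij: "i < n" "j < n" for i j
  proof -
    have "E i j (E a b (E j i g)) = E i j (E j i (E a b g) + (if b = j then E a i g else 0) + (\<lambda>x. -1 * (if i = a then E j b g else 0) x))"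
      unfolding gl_action_comm[OF gl ab ij(2,1)] by (rule arg_cong[where f = "E i j"]) (auto simp: fun_eq_iff)
    also have "\<dots> = E i j (E j i (E a b g)) + (if b = j then E i j (E a i g) else 0) + (\<lambda>x. -1 * (if i = a then E i j (E j b g) else 0) x)"
      unfolding gl_action_add[OF gl ij] gl_action_scale[OF gl ij] if_app[OF ij] ..
    finally show ?thesis
      unfolding gl_action_comm[OF gl ab ij, of "E j i g"] by (auto simp: fun_eq_iff)
  qed
  have if_sum: "(\<Sum>j\<in>A. if P then F j else 0) = (if P then sum F A else 0)"
    for P and A :: "nat set" and F :: "nat \<Rightarrow> 'a \<Rightarrow> complex" by simp
  have "E a b (casimir_op n E g) = (\<Sum>i<n. \<Sum>j<n. E a b (E i j (E j i g)))"
    unfolding casimir_op_def gl_action_sum[OF gl ab] ..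
  also have "\<dots> = (\<Sum>i<n. \<Sum>j<n. E i j (E j i (E a b g))
      + ((if j = b then E i j (E a i g) else 0) - (if i = a then E i j (E j b g) else 0)
      + (if i = b then E a j (E j i g) else 0) - (if j = a then E i b (E j i g) else 0)))"
    by (intro sum.cong refl summand) auto
  also have "\<dots> = casimir_op n E (E a b g) + ((\<Sum>i<n. E i b (E a i g)) - (\<Sum>j<n. E a j (E j b g))
      + (\<Sum>j<n. E a j (E j b g)) - (\<Sum>i<n. E i b (E a i g)))"
    unfolding casimir_op_def sum.distrib sum_subtractf if_sum
    using ab by (simp only: sum.delta finite_lessThan lessThan_iff if_True)
  finally show ?thesis by simp
qed

lemma casimir_op_hw:
  assumes gl: "gl_action n E" and hw: "hw_vec n E lam v"
  shows "\<exists>c. casimir_op n E v = (\<lambda>x. c * v x)"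
proof -
  have E_hw: "E i j v = 0" if "i < j" "j < n" for i j using hw that by (simp add: hw_vec_def)
  have E_diag: "E i i v = (\<lambda>x. lam i * v x)" if "i < n" for i using hw that by (simp add: hw_vec_def)
  have "\<exists>c. E i j (E j i v) = (\<lambda>x. c * v x)" if ij: "i < n" "j < n" for i j
  proof -
    consider "j < i" | "i = j" | "i < j" by linarith
    then show ?thesis
    proof cases
      case 1
      then have "E i j (E j i v) = 0" using ij E_hw gl_action_zero[OF gl] by simp
      then show ?thesis by (intro exI[of _ 0]) auto
    next
      case 2
      have "E i i (E i i v) = (\<lambda>x. lam i * (lam i * v x))"
        unfolding E_diag[OF ij(1)] gl_action_scale[OF gl ij(1,1)] ..
      then show ?thesis unfolding 2[symmetric] mult.assoc[symmetric] by (rule exI)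
    next
      case 3
      have "E i j (E j i v) = E j i (E i j v) + E i i v - E j j v"
        using gl_action_comm[OF gl ij ij(2,1), of v] by simp
      also have "\<dots> = (\<lambda>x. (lam i - lam j) * v x)"
        unfolding E_hw[OF 3 ij(2)] gl_action_zero[OF gl ij(2,1)] E_diag[OF ij(1)] E_diag[OF ij(2)]
        by (auto simp: algebra_simps)
      finally show ?thesis by blast
    qed
  qed
  then obtain c where c: "\<And>i j. i < n \<Longrightarrow> j < n \<Longrightarrow> E i j (E j i v) = (\<lambda>x. c i j * v x)" by metis
  have "casimir_op n E v = (\<Sum>i<n. \<Sum>j<n. (\<lambda>x. c i j * v x))"
    unfolding casimir_op_def by (intro sum.cong refl) (simp add: c)
  also have "\<dots> = (\<lambda>x. (\<Sum>i<n. \<Sum>j<n. c i j) * v x)"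
    by (rule ext) (simp add: sum_fun_apply sum_distrib_right)
  finally show ?thesis by blast
qed

lemma casimir_op_scalar:
  assumes gl: "gl_action n E" and c: "casimir_op n E v = (\<lambda>x. c * v x)"
    and l: "lowered n E lam v f \<kappa>"
  shows "casimir_op n E f = (\<lambda>x. c * f x)"
  using l
proof (induction rule: lowered.induct)
  case (step f \<kappa> i j)
  have "i < n" "j < n" using step.hyps by auto
  then show ?case
    using casimir_op_commute[OF gl, of j i f] step.IH gl_action_scale[OF gl, of j i c f] by simp
qed (rule c)

theorem simple_weight_module:
  assumes simple: "simple_gl_module n d \<rho>" and hwt: "has_highest_weight n d \<rho> p"
  obtains R wt b0 where "weight_module n d R wt b0" "\<And>i. i < n \<Longrightarrow> wt b0 i = int (part p i)"
proof -
  have gl0: "gl_module n d \<rho>" and d: "d \<noteq> 0" using simple by (auto simp: simple_gl_module_def)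
  define E where "E = (\<lambda>i j. mat_op d (entry n \<rho> i j))"
  have gl: "gl_action n E" unfolding E_def by (rule gl_action_mat_op[OF gl_entries_entry[OF gl0]])
  define lam where "lam i = (if i < n then int (part p i) else 0)" for i
  obtain v where v: "v \<in> supp_space d" and hw0: "hw_vec n E (\<lambda>i. of_nat (part p i)) v"
    using hwt unfolding has_highest_weight_iff[OF gl0] E_def by blast
  then have hw: "hw_vec n E (\<lambda>i. of_int (lam i)) v" by (auto simp: hw_vec_def lam_def)
  define L where "L = {f. \<exists>\<kappa>. lowered n E lam v f \<kappa>}"
  have vL: "v \<in> L" by (auto simp: L_def intro: lowered.base)
  have v0: "v \<noteq> 0" using hw by (simp add: hw_vec_def)
  have "L \<subseteq> supp_space d"
  proof
    fix f assume "f \<in> L"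
    then obtain \<kappa> where "lowered n E lam v f \<kappa>" by (auto simp: L_def)
    then show "f \<in> supp_space d" using v by cases (auto simp: E_def mat_op_in_supp_space)
  qed
  then have spanL_sub: "fs.span L \<subseteq> supp_space d" by (rule fs.span_minimal[OF _ subspace_supp_space])
  have "fs.span L = {0} \<or> fs.span L = supp_space d"
  proof -
    have "\<forall>i<n. \<forall>j<n. \<forall>f\<in>fs.span L. mat_op d (entry n \<rho> i j) f \<in> fs.span L"
      using lowered_span_invariant[OF gl hw] unfolding L_def E_def by blast
    then show ?thesis
      using simple fs.subspace_span[of L] spanL_sub unfolding simple_gl_module_iff[OF gl0 d] by blast
  qed
  moreover have "v \<in> fs.span L" using vL by (rule fs.span_base)
  ultimately have spanL: "fs.span L = supp_space d" using v0 by blast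
  \<comment> \<open>The basis is chosen among the lowered vectors, with \<open>v\<close> as one of them.\<close>
  have "fs.independent {v}" using v0 by (simp add: fs.dependent_single)
  then obtain B where B: "{v} \<subseteq> B" "B \<subseteq> L" "fs.independent B" "L \<subseteq> fs.span B"
    using fs.maximal_independent_subset_extend[of "{v}" L] vL by blast
  have spanB: "supp_space d \<subseteq> fs.span B"
    using fs.span_minimal[OF B(4) fs.subspace_span] spanL by simp
  have Bsub: "B \<subseteq> supp_space d" using B(2) \<open>L \<subseteq> supp_space d\<close> by blast
  have cardB: "finite B" "card B = d" using card_basis_supp_space[OF B(3) Bsub spanB] by auto
  obtain u where u: "bij_betw u {..<d} B"
    using ex_bij_betw_nat_finite[OF cardB(1)] cardB(2) by (auto simp: atLeast0LessThan)
  have "v \<in> u ` {..<d}" using u B(1) by (simp add: bij_betw_def)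
  then obtain b0 where b0: "b0 < d" "u b0 = v" by auto
  have uL: "u b \<in> L" if "b < d" for b using u B(2) that by (auto simp: bij_betw_def)
  have "\<exists>\<kappa>. lowered n E lam v (u b) \<kappa> \<and> (b = b0 \<longrightarrow> \<kappa> = lam)" if "b < d" for b
    using uL[OF that] b0(2) by (cases "b = b0") (auto simp: L_def intro: lowered.base)
  then obtain wt where wt: "\<And>b. b < d \<Longrightarrow> lowered n E lam v (u b) (wt b)" "wt b0 = lam"
    using b0 by metis
  have unv: "u b \<noteq> v" if "b < d" "b \<noteq> b0" for b
    using u b0 that by (auto simp: bij_betw_def inj_on_def)
  define \<phi> where "\<phi> b f = fs.representation B f (u b)" for b f
  note rf = representation_functionals[OF B(3) spanB u subset_refl, folded \<phi>_def]
  have ker: "f = 0" if "f \<in> supp_space d" "\<And>b. b < d \<Longrightarrow> \<phi> b f = 0" for f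
    using rf(4)[OF that] by simp
  have Esupp: "E i j f \<in> supp_space d" for i j f by (simp add: E_def mat_op_in_supp_space)
  have usupp: "u b \<in> supp_space d" if "b < d" for b using uL[OF that] \<open>L \<subseteq> supp_space d\<close> by blast
  have kerE: "\<phi> b (E i j f) = 0" if "i < n" "j < n" "f \<in> supp_space d" "\<And>c. c < d \<Longrightarrow> \<phi> c f = 0" "b < d" for i j f b
    using ker[OF that(3,4)] gl_action_zero[OF gl that(1,2)] that(4,5) by simp
  define R where "R i j b c = \<phi> b (E i j (u c))" for i j b c
  have R: "gl_entries n d R"
  proof -
    have "gl_entries n d (\<lambda>i j b c. \<phi> b (E i j (u c)))"
      by (rule subquotient_gl_entries[where \<phi> = \<phi>, OF gl subspace_supp_space[of d]]) (fact kerE | (rule Esupp usupp rf(1-3); assumption))+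
    then show ?thesis by (simp add: R_def[abs_def])
  qed
  have app: "\<phi> b (E i j f) = (\<Sum>c<d. R i j b c * \<phi> c f)" if "i < n" "j < n" "f \<in> supp_space d" "b < d" for i j f b
    unfolding R_def
    by (rule subquotient_apply[where \<phi> = \<phi>, OF gl subspace_supp_space[of d]]) (fact kerE that | (rule Esupp usupp rf(1-3); assumption))+
  obtain c where c: "casimir_op n E v = (\<lambda>x. c * v x)" using casimir_op_hw[OF gl hw] by blast
  have cas: "(\<Sum>i<n. \<Sum>j<n. \<Sum>e<d. R i j b e * R j i e b) = c" if b: "b < d" for b
  proof -
    have "casimir_op n E (u b) = (\<lambda>x. c * u b x)"
      by (rule casimir_op_scalar[OF gl c wt(1)[OF b]])
    then have "\<phi> b (casimir_op n E (u b)) = c"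
      using rf(2)[OF usupp[OF b]] rf(3)[OF b b] by simp
    moreover have phi_sum: "\<phi> b (\<Sum>i\<in>A. F i) = (\<Sum>i\<in>A. \<phi> b (F i))"
      if "\<And>i. i \<in> A \<Longrightarrow> F i \<in> supp_space d" "finite A" for F and A :: "nat set"
      using that(2,1)
    proof (induction A rule: finite_induct)
      case empty
      have "\<phi> b (0 + 0) = \<phi> b 0 + \<phi> b 0"
        by (rule rf(1)) (rule fs.subspace_0[OF subspace_supp_space])+
      then have "\<phi> b 0 = 0" by simp
      then show ?case by (simp only: sum.empty)
    next
      case (insert i A)
      have "\<phi> b (F i + sum F A) = \<phi> b (F i) + \<phi> b (sum F A)"
        using insert.prems by (intro rf(1) fs.subspace_sum[OF subspace_supp_space]) auto
      then show ?case using insert by (simp only: sum.insert insert_iff simp_thms)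
    qed
    have "\<phi> b (casimir_op n E (u b)) = (\<Sum>i<n. \<Sum>j<n. \<phi> b (E i j (E j i (u b))))"
      unfolding casimir_op_def
      by (subst phi_sum, (intro fs.subspace_sum[OF subspace_supp_space] Esupp finite_lessThan)+)
        (intro sum.cong refl phi_sum Esupp finite_lessThan)
    moreover have "\<phi> b (E i j (E j i (u b))) = (\<Sum>e<d. R i j b e * R j i e b)" if "i < n" "j < n" for i j
      using app[OF that Esupp b] by (simp add: R_def)
    ultimately show ?thesis by simp
  qed
  have "weight_module n d R wt b0"
  proof
    show "gl_entries n d R" by (rule R)
    show "R i i b c = (if b = c then of_int (wt b i) else 0)" if "i < n" "b < d" "c < d" for i b c
      using lowered_weight[OF gl hw wt(1)[OF that(3)] that(1)] rf(2)[OF usupp[OF that(3)]] rf(3)[OF that(2,3)]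
      by (simp add: R_def)
    show "wt b i = 0" if "b < d" "n \<le> i" for b i
      by (rule lowered_zero[OF wt(1)[OF that(1)] _ that(2)]) (simp add: lam_def)
    show "(\<Sum>i<n. wt b i) = (\<Sum>i<n. wt b0 i)" if "b < d" for b
      using lowered_total[OF wt(1)[OF that]] by (simp add: wt(2))
    show "b0 < d" by (rule b0)
    show "(\<Sum>i<n. y i * wt b i) < (\<Sum>i<n. y i * wt b0 i)"
      if "b < d" "b \<noteq> b0" "\<And>i j. i < j \<Longrightarrow> j < n \<Longrightarrow> y j < y i" for b and y :: "nat \<Rightarrow> int"
      using lowered_less[OF wt(1)[OF that(1)] that(3)] unv[OF that(1,2)] by (auto simp: wt(2))
    show "\<exists>c. \<forall>b<d. (\<Sum>i<n. \<Sum>j<n. \<Sum>e<d. R i j b e * R j i e b) = c"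
      using cas by blast
  qed
  then show ?thesis using that[of R wt b0] by (simp add: wt(2) lam_def)
qed

section \<open>Symmetry of the weight multiplicities\<close>

text \<open>Linear maps between spaces of functions.\<close>

definition linop :: "(('x \<Rightarrow> complex) \<Rightarrow> 'y \<Rightarrow> complex) \<Rightarrow> bool" where
  "linop X \<longleftrightarrow> (\<forall>f g. X (f + g) = X f + X g) \<and> (\<forall>c f. X (\<lambda>x. c * f x) = (\<lambda>x. c * X f x))"

lemma linopD:
  assumes "linop X"
  shows linop_add: "X (f + g) = X f + X g" and linop_scale: "X (\<lambda>x. c * f x) = (\<lambda>x. c * X f x)"
  using assms unfolding linop_def by simp_all

lemma linop_zero: "linop X \<Longrightarrow> X 0 = 0"
  using linop_add[of X 0 0] by simp

lemma linop_sum_scale: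
  assumes "linop X"
  shows "X (\<Sum>k\<in>A. (\<lambda>x. a k * f k x)) = (\<Sum>k\<in>A. (\<lambda>x. a k * X (f k) x))"
proof (induction A rule: infinite_finite_induct)
  case (insert k A)
  have "X ((\<lambda>x. a k * f k x) + (\<Sum>k\<in>A. (\<lambda>x. a k * f k x))) =
      (\<lambda>x. a k * X (f k) x) + (\<Sum>k\<in>A. (\<lambda>x. a k * X (f k) x))"
    unfolding linop_add[OF assms] insert.IH linop_scale[OF assms] ..
  then show ?case by (simp only: sum.insert[OF insert.hyps])
qed (simp_all add: linop_zero[OF assms, unfolded zero_fun_def] zero_fun_def)

lemma linop_funpow:
  fixes X :: "('x \<Rightarrow> complex) \<Rightarrow> 'x \<Rightarrow> complex"
  shows "linop X \<Longrightarrow> linop (X ^^ k)"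
proof (induction k)
  case (Suc k)
  then show ?case unfolding linop_def by (simp add: o_def)
next
  case 0
  show ?case unfolding linop_def funpow_0 by simp
qed

text \<open>The exponential series up to degree \<open>M - 1\<close>. It is the exponential of \<open>X\<close> if the powers of \<open>X\<close>
from the \<open>M\<close>-th on vanish.\<close>

definition exp_op :: "nat \<Rightarrow> (('x \<Rightarrow> complex) \<Rightarrow> 'x \<Rightarrow> complex) \<Rightarrow> ('x \<Rightarrow> complex) \<Rightarrow> 'x \<Rightarrow> complex" where
  "exp_op M X f = (\<Sum>k<M. (\<lambda>x. 1 / fact k * (X ^^ k) f x))"

lemma linop_exp_op: "linop X \<Longrightarrow> linop (exp_op M X)"
proof -
  assume "linop X"
  note l = linop_funpow[OF this]
  show ?thesis
    unfolding linop_def exp_op_def linop_add[OF l] linop_scale[OF l]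
    by (auto simp: fun_eq_iff sum_fun_apply distrib_left sum.distrib sum_distrib_left mult_ac)
qed

lemma exp_op_more:
  assumes "\<And>k f. M \<le> k \<Longrightarrow> (X ^^ k) f = 0" "M \<le> N"
  shows "exp_op N X f = exp_op M X f"
proof
  fix x
  have "(X ^^ k) f x = 0" if "M \<le> k" for k using assms(1)[OF that] by simp
  then show "exp_op N X f x = exp_op M X f x"
    unfolding exp_op_def sum_fun_apply using assms(2)
    by (intro sum.mono_neutral_right) auto
qed

text \<open>Conjugation by the exponential of \<open>X\<close> when the third iterated commutator of \<open>X\<close> with \<open>Y\<close> is 0:
\<open>Y1\<close> and \<open>Y2\<close> are the first two, so this is \<open>exp X Y = (Y + Y1 + Y2 / 2) exp X\<close>.\<close>

lemma exp_op_commute: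
  assumes X: "linop X" and Y: "linop Y" "linop Y1" "linop Y2"
    and XY: "\<And>f. X (Y f) = Y (X f) + Y1 f" "\<And>f. X (Y1 f) = Y1 (X f) + Y2 f" "\<And>f. X (Y2 f) = Y2 (X f)"
    and nil: "\<And>k f. M \<le> k \<Longrightarrow> (X ^^ k) f = 0"
  shows "exp_op M X (Y f) x = Y (exp_op M X f) x + Y1 (exp_op M X f) x + Y2 (exp_op M X f) x / 2"
proof -
  have X_pow: "(X ^^ (k + 2)) (Y f) = Y ((X ^^ (k + 2)) f) + (\<lambda>x. of_nat (k + 2) * Y1 ((X ^^ (k + 1)) f) x)
      + (\<lambda>x. of_nat ((k + 2) * (k + 1)) / 2 * Y2 ((X ^^ k) f) x)" for k
  proof (induction k)
    case 0
    have "X (X (Y f)) = Y (X (X f)) + Y1 (X f) + (Y1 (X f) + Y2 f)"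
      unfolding XY linop_add[OF X] ..
    then show ?case by (auto simp: numeral_2_eq_2 fun_eq_iff)
  next
    case (Suc k)
    have "(X ^^ (Suc k + 2)) (Y f) = X ((X ^^ (k + 2)) (Y f))" by simp
    also have "\<dots> = Y (X ((X ^^ (k + 2)) f)) + Y1 ((X ^^ (k + 2)) f) +
        (\<lambda>x. of_nat (k + 2) * (Y1 (X ((X ^^ (k + 1)) f)) + Y2 ((X ^^ (k + 1)) f)) x)
      + (\<lambda>x. of_nat ((k + 2) * (k + 1)) / 2 * Y2 (X ((X ^^ k) f)) x)"
      unfolding Suc.IH linop_add[OF X] linop_scale[OF X] XY ..
    finally show ?case by (auto simp: fun_eq_iff field_simps)
  qed
  have L: "Z (exp_op N X f) x = (\<Sum>k<N. Z ((X ^^ k) f) x / fact k)" if "linop Z" for Z N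
    unfolding exp_op_def linop_sum_scale[OF that] by (simp add: sum_fun_apply)
  have sum1: "(\<Sum>k<N + 1. a k) = a 0 + (\<Sum>k<N. a (k + 1))" for N and a :: "nat \<Rightarrow> complex"
    using sum.lessThan_Suc_shift[of a N] by (simp del: sum.lessThan_Suc)
  have sum2: "(\<Sum>k<N + 2. a k) = a 0 + a 1 + (\<Sum>k<N. a (k + 2))" for N and a :: "nat \<Rightarrow> complex"
    using sum.lessThan_Suc_shift[of a "Suc N"] sum.lessThan_Suc_shift[of "\<lambda>k. a (Suc k)" N]
    by (simp del: sum.lessThan_Suc)
  have "exp_op M X (Y f) x = exp_op (M + 2) X (Y f) x"
    using exp_op_more[OF nil, of M "M + 2"] by simp
  also have "\<dots> = Y f x + X (Y f) x + (\<Sum>k<M. (X ^^ (k + 2)) (Y f) x / fact (k + 2))"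
    unfolding exp_op_def sum_fun_apply sum2 by simp
  also have "(\<Sum>k<M. (X ^^ (k + 2)) (Y f) x / fact (k + 2)) =
      (\<Sum>k<M. Y ((X ^^ (k + 2)) f) x / fact (k + 2) + Y1 ((X ^^ (k + 1)) f) x / fact (k + 1)
        + Y2 ((X ^^ k) f) x / fact k / 2)"
  proof (intro sum.cong refl)
    fix k
    have fact2: "fact (k + 2) = (of_nat (k + 2) :: complex) * fact (k + 1)"
      and fact1: "fact (k + 1) = (of_nat (k + 1) :: complex) * fact k"
      using fact_Suc[of "k + 1"] fact_Suc[of k] by simp_all
    have nz: "of_nat (k + 2) \<noteq> (0::complex)" "of_nat (k + 1) \<noteq> (0::complex)"
      by (simp_all only: of_nat_eq_0_iff)
    have "of_nat (k + 2) / fact (k + 2) = (1 / fact (k + 1) :: complex)"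
      unfolding fact2 using nz by (simp del: of_nat_add of_nat_Suc)
    moreover have "of_nat ((k + 2) * (k + 1)) / 2 / fact (k + 2) = (1 / fact k / 2 :: complex)"
      unfolding fact2 fact1 of_nat_mult using nz by (simp del: of_nat_add of_nat_Suc)
    ultimately
    show "(X ^^ (k + 2)) (Y f) x / fact (k + 2) = Y ((X ^^ (k + 2)) f) x / fact (k + 2)
        + Y1 ((X ^^ (k + 1)) f) x / fact (k + 1) + Y2 ((X ^^ k) f) x / fact k / 2"
      unfolding X_pow plus_fun_apply add_divide_distrib
      by (metis (no_types, lifting) times_divide_eq_left mult_1)
  qed
  also have "Y f x + X (Y f) x + \<dots> = (\<Sum>k<M+2. Y ((X ^^ k) f) x / fact k)
      + (\<Sum>k<M+1. Y1 ((X ^^ k) f) x / fact k) + (\<Sum>k<M. Y2 ((X ^^ k) f) x / fact k) / 2"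
    unfolding sum2 sum1 by (simp add: XY sum.distrib sum_divide_distrib)
  also have "\<dots> = Y (exp_op M X f) x + Y1 (exp_op M X f) x + Y2 (exp_op M X f) x / 2"
    unfolding L[OF Y(1), symmetric] L[OF Y(2), symmetric] L[OF Y(3), symmetric]
    using exp_op_more[OF nil, of M "M + 2"] exp_op_more[OF nil, of M "M + 1"] by simp
  finally show ?thesis .
qed

text \<open>The last nonvanishing power of \<open>X\<close> maps \<open>exp X f\<close> and \<open>f\<close> to the same vector.\<close>

lemma exp_op_inj:
  assumes X: "linop X" and nil: "\<And>k f. M \<le> k \<Longrightarrow> (X ^^ k) f = 0" and z: "exp_op M X f = 0"
  shows "f = 0"
proof (rule ccontr)
  assume f: "f \<noteq> 0"
  define k where "k = (GREATEST k. (X ^^ k) f \<noteq> 0)"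
  have bound: "\<forall>k. (X ^^ k) f \<noteq> 0 \<longrightarrow> k \<le> M" using nil by (meson nat_le_linear)
  have "(X ^^ 0) f \<noteq> 0" using f by simp
  then have k: "(X ^^ k) f \<noteq> 0" unfolding k_def by (rule GreatestI_nat[OF _ bound[rule_format]])
  have k_max: "(X ^^ l) f = 0" if "k < l" for l
    using Greatest_le_nat[of "\<lambda>k. (X ^^ k) f \<noteq> 0" l, OF _ bound[rule_format]] that unfolding k_def by (meson not_le)
  have "k < M" using k nil by (meson not_le)
  have "(X ^^ k) (exp_op M X f) x = (X ^^ k) f x" for x
  proof -
    have "(X ^^ k) (exp_op M X f) x = (\<Sum>l<M. 1 / fact l * (X ^^ k) ((X ^^ l) f) x)"
      unfolding exp_op_def linop_sum_scale[OF linop_funpow[OF X]] by (simp add: sum_fun_apply)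
    also have "\<dots> = (\<Sum>l<M. if l = 0 then (X ^^ k) f x else 0)"
    proof (intro sum.cong refl)
      fix l
      have "(X ^^ k) ((X ^^ l) f) = (X ^^ (k + l)) f" by (simp add: funpow_add)
      then show "1 / fact l * (X ^^ k) ((X ^^ l) f) x = (if l = 0 then (X ^^ k) f x else 0)"
        using k_max[of "k + l"] by simp
    qed
    also have "\<dots> = (X ^^ k) f x" using \<open>k < M\<close> by simp
    finally show ?thesis .
  qed
  then have "(X ^^ k) f = (X ^^ k) (exp_op M X f)" by auto
  also have "\<dots> = 0" unfolding z by (rule linop_zero[OF linop_funpow[OF X]])
  finally show False using k by simp
qed

text \<open>The unit vectors.\<close>

definition unit_fun :: "'x \<Rightarrow> 'x \<Rightarrow> complex" where
  "unit_fun b = (\<lambda>x. if x = b then 1 else 0)"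

lemma sum_unit_fun:
  "finite A \<Longrightarrow> (\<Sum>b\<in>A. (\<lambda>x. r b * unit_fun b x)) = (\<lambda>x. if x \<in> A then r x else 0)"
proof
  fix x assume A: "finite A"
  have "(\<Sum>b\<in>A. r b * unit_fun b x) = (\<Sum>b\<in>A. if b = x then r x else 0)"
    by (intro sum.cong) (auto simp: unit_fun_def)
  then show "(\<Sum>b\<in>A. (\<lambda>x. r b * unit_fun b x)) x = (if x \<in> A then r x else 0)"
    using A by (simp add: sum_fun_apply)
qed

lemma card_le_of_inj_linop:
  assumes S: "linop S" and inj: "\<And>f. S f = 0 \<Longrightarrow> f = 0" and A: "finite A" and C: "finite C"
    and sub: "\<And>b x. b \<in> A \<Longrightarrow> x \<notin> C \<Longrightarrow> S (unit_fun b) x = 0"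
  shows "card A \<le> card C"
proof -
  define T where "T = (\<lambda>b. S (unit_fun b)) ` A"
  have lin: "r b = 0" if "(\<Sum>b\<in>A. (\<lambda>x. r b * S (unit_fun b) x)) = 0" "b \<in> A" for r b
  proof -
    have "S (\<Sum>b\<in>A. (\<lambda>x. r b * unit_fun b x)) = 0"
      unfolding linop_sum_scale[OF S] by (rule that(1))
    then have "(\<Sum>b\<in>A. (\<lambda>x. r b * unit_fun b x)) = 0" by (rule inj)
    then have "(\<lambda>x. if x \<in> A then r x else 0) = 0" unfolding sum_unit_fun[OF A] .
    from fun_cong[OF this, of b] show ?thesis using that(2) by simp
  qed
  have injS: "inj_on (\<lambda>b. S (unit_fun b)) A"
  proof (rule inj_onI)
    fix b c assume bc: "b \<in> A" "c \<in> A" and eq: "S (unit_fun b) = S (unit_fun c)"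
    have "S (unit_fun b + (\<lambda>x. -1 * unit_fun c x)) = 0"
      unfolding linop_add[OF S] linop_scale[OF S] eq by auto
    then have "unit_fun b + (\<lambda>x. -1 * unit_fun c x) = 0" by (rule inj)
    from fun_cong[OF this, of b] show "b = c" by (auto simp: unit_fun_def split: if_splits)
  qed
  have "fs.independent T"
  proof
    assume "fs.dependent T"
    then obtain r w where r: "(\<Sum>v\<in>T. (\<lambda>x. r v * v x)) = 0" "w \<in> T" "r w \<noteq> 0"
      using fs.dependent_finite[of T] A by (auto simp: T_def)
    obtain b where b: "b \<in> A" "w = S (unit_fun b)" using r(2) by (auto simp: T_def)
    have "(\<Sum>b\<in>A. (\<lambda>x. r (S (unit_fun b)) * S (unit_fun b) x)) = 0"
      using r(1) unfolding T_def sum.reindex[OF injS] o_def .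
    then have "r w = 0" unfolding b(2) using b(1) by (rule lin)
    then show False using r(3) by simp
  qed
  moreover have "T \<subseteq> fs.span (unit_fun ` C)"
  proof
    fix f assume "f \<in> T"
    then have "f x = 0" if "x \<notin> C" for x using sub that by (auto simp: T_def)
    then have "f = (\<Sum>c\<in>C. (\<lambda>x. f c * unit_fun c x))"
      unfolding sum_unit_fun[OF C] by auto
    moreover have "(\<Sum>c\<in>C. (\<lambda>x. f c * unit_fun c x)) \<in> fs.span (unit_fun ` C)"
      by (intro fs.span_sum fs.span_scale fs.span_base) auto
    ultimately show "f \<in> fs.span (unit_fun ` C)" by simp
  qed
  ultimately have "card T \<le> card (unit_fun ` C)"
    using fs.independent_span_bound C by blast
  then show ?thesis
    using card_image[OF injS] card_image_le[OF C, of unit_fun] by (simp add: T_def)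
qed

context weight_module
begin

abbreviation "E \<equiv> \<lambda>i j. mat_op d (R i j)"

definition mult :: "(nat \<Rightarrow> int) \<Rightarrow> nat" where
  "mult \<kappa> = card {b. b < d \<and> wt b = \<kappa>}"

lemma gl: "gl_action n E"
  by (rule gl_action_mat_op[OF rep])

lemma linop_E: "linop (E i j)"
  unfolding linop_def by (simp add: mat_op_add mat_op_scale)

lemma E_diag: "i < n \<Longrightarrow> E i i f = (\<lambda>b. if b < d then of_int (wt b i) * f b else 0)"
proof
  fix b assume "i < n"
  have "(\<Sum>c<d. R i i b c * f c) = (\<Sum>c<d. if c = b then of_int (wt b i) * f b else 0)" if "b < d"
    using diag[OF \<open>i < n\<close> that] by (intro sum.cong) auto
  then show "E i i f b = (if b < d then of_int (wt b i) * f b else 0)"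
    by (simp add: mat_op_def)
qed

lemma entry_nonzero:
  assumes ij: "i < n" "j < n" and bc: "b < d" "c < d" and nz: "R i j b c \<noteq> 0" and a: "a < n"
  shows "wt b a = wt c a + (if a = i then 1 else 0) - (if a = j then 1 else 0)"
proof -
  have "(\<Sum>e<d. R a a b e * R i j e c) - (\<Sum>e<d. R i j b e * R a a e c) =
      (if a = i then R a j b c else 0) - (if j = a then R i a b c else 0)"
    using rep a ij bc unfolding gl_entries_def by blast
  also have "(\<Sum>e<d. R a a b e * R i j e c) = (\<Sum>e<d. if e = b then of_int (wt b a) * R i j b c else 0)"
    using diag[OF a] bc by (intro sum.cong) auto
  also have "(\<Sum>e<d. R i j b e * R a a e c) = (\<Sum>e<d. if e = c then of_int (wt c a) * R i j b c else 0)"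
    using diag[OF a] bc by (intro sum.cong) auto
  finally have "(of_int (wt b a) - of_int (wt c a)) * R i j b c =
      ((if a = i then 1 else 0) - (if a = j then 1 else 0)) * R i j b c"
    using bc by (auto simp: algebra_simps)
  then have "of_int (wt b a) - of_int (wt c a) = ((if a = i then 1 else 0) - (if a = j then 1 else 0) :: complex)"
    using nz by simp
  then have "of_int (wt b a - wt c a) = (of_int ((if a = i then 1 else 0) - (if a = j then 1 else 0)) :: complex)"
    by simp
  then show ?thesis by (simp only: of_int_eq_iff)
qed

lemma E_nilpotent:
  assumes ij: "i < n" "j < n" "i \<noteq> j"
  obtains M where "\<And>k f. M \<le> k \<Longrightarrow> ((E i j) ^^ k) f = 0"
proof -
  \<comment> \<open>Each application raises the \<open>i\<close>-th entry of the weight by 1, and these entries differ by less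
    than \<open>M\<close>.\<close>
  define M where "M = nat (\<Sum>b<d. \<bar>wt b i\<bar>) + nat (\<Sum>b<d. \<bar>wt b i\<bar>) + 1"
  have le: "\<bar>wt b i\<bar> \<le> (\<Sum>b<d. \<bar>wt b i\<bar>)" if "b < d" for b
    by (rule member_le_sum) (use that in auto)
  have shift: "\<exists>c<d. b < d \<and> wt b i = wt c i + int (Suc k)" if "((E i j) ^^ Suc k) f b \<noteq> 0" for k f b
    using that
  proof (induction k arbitrary: b)
    case 0
    then have "b < d" "\<exists>c<d. R i j b c * f c \<noteq> 0"
      by (auto simp: mat_op_def split: if_splits intro: sum.neutral elim!: sum.not_neutral_contains_not_neutral)
    then show ?case using entry_nonzero[OF ij(1,2) \<open>b < d\<close> _ _ ij(1)] ij(3) by auto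
  next
    case (Suc k)
    let ?g = "((E i j) ^^ Suc k) f"
    have "E i j ?g b \<noteq> 0" using Suc.prems by simp
    then have "b < d" "\<exists>c<d. R i j b c * ?g c \<noteq> 0"
      by (auto simp only: mat_op_def split: if_splits intro: sum.neutral elim!: sum.not_neutral_contains_not_neutral)
    then obtain c where c: "c < d" "R i j b c \<noteq> 0" "?g c \<noteq> 0" by auto
    from Suc.IH[OF c(3)] obtain c' where "c' < d" "wt c i = wt c' i + int (Suc k)" by auto
    then show ?case using entry_nonzero[OF ij(1,2) \<open>b < d\<close> c(1,2) ij(1)] ij(3) \<open>b < d\<close> by auto
  qed
  have "((E i j) ^^ k) f = 0" if "M \<le> k" for k f
  proof
    fix b
    have "k = Suc (k - 1)" using that unfolding M_def by linarith
    then obtain k' where k': "k = Suc k'" ..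
    show "((E i j) ^^ k) f b = 0 b"
    proof (rule ccontr)
      assume "((E i j) ^^ k) f b \<noteq> 0 b"
      then have "((E i j) ^^ Suc k') f b \<noteq> 0" unfolding k' by simp
      from shift[OF this] obtain c where "c < d" "b < d" "wt b i = wt c i + int (Suc k')" by blast
      then show False using le[of b] le[of c] that unfolding M_def k' by linarith
    qed
  qed
  then show thesis by (rule that)
qed

end

lemma linop_op_add: "linop X \<Longrightarrow> linop Y \<Longrightarrow> linop (\<lambda>f. X f + Y f)"
  unfolding linop_def by (auto simp: fun_eq_iff distrib_left)

lemma linop_op_diff: "linop X \<Longrightarrow> linop Y \<Longrightarrow> linop (\<lambda>f. X f - Y f)"
  unfolding linop_def by (auto simp: fun_eq_iff right_diff_distrib)

lemma linop_op_uminus: "linop X \<Longrightarrow> linop (\<lambda>f. - X f)"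
  unfolding linop_def by (auto simp: fun_eq_iff)

lemma linop_diff: "linop X \<Longrightarrow> X (f - g) = X f - X g"
  using linop_add[of X "f - g" g] by (simp add: eq_diff_eq)

lemma linop_uminus: "linop X \<Longrightarrow> X (- f) = - X f"
  using linop_diff[of X 0 f] linop_zero[of X] by simp

lemma linop_op_zero: "linop (\<lambda>f. 0)"
  unfolding linop_def by (auto simp: fun_eq_iff)

lemma exp_op_commute0:
  assumes X: "linop X" and Y: "linop Y" and XY: "\<And>f. X (Y f) = Y (X f)"
    and nil: "\<And>k f. M \<le> k \<Longrightarrow> (X ^^ k) f = 0"
  shows "exp_op M X (Y f) = Y (exp_op M X f)"
proof
  fix x
  show "exp_op M X (Y f) x = Y (exp_op M X f) x"
    using exp_op_commute[OF X Y linop_op_zero linop_op_zero _ _ _ nil] XY linop_zero[OF X] by simp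
qed

lemma exp_op_commute1:
  assumes X: "linop X" and Y: "linop Y" "linop Y1"
    and XY: "\<And>f. X (Y f) = Y (X f) + Y1 f" "\<And>f. X (Y1 f) = Y1 (X f)"
    and nil: "\<And>k f. M \<le> k \<Longrightarrow> (X ^^ k) f = 0"
  shows "exp_op M X (Y f) = Y (exp_op M X f) + Y1 (exp_op M X f)"
proof
  fix x
  show "exp_op M X (Y f) x = (Y (exp_op M X f) + Y1 (exp_op M X f)) x"
    using exp_op_commute[OF X Y linop_op_zero _ _ _ nil, where f = f and x = x] XY linop_zero[OF X] by simp
qed

lemma exp_op_outside:
  assumes "\<And>f. X f x = 0" "M \<noteq> 0"
  shows "exp_op M X f x = f x"
proof -
  have "(X ^^ k) f x = (if k = 0 then f x else 0)" for k
    using assms(1) by (cases k) auto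
  then have "exp_op M X f x = (\<Sum>k<M. if k = 0 then f x else 0)"
    unfolding exp_op_def sum_fun_apply by (intro sum.cong) auto
  then show ?thesis using assms(2) by simp
qed

context weight_module
begin

text \<open>The operator \<open>exp X exp N exp X\<close>, where \<open>X = E i j\<close> and \<open>N = - E j i\<close>, anticommutes with
\<open>H = E i i - E j j\<close> and commutes with \<open>E i i + E j j\<close> and all other \<open>E a a\<close>. So it maps the
space of weight \<open>\<kappa>\<close> injectively into the one whose weight has the entries \<open>i\<close> and \<open>j\<close> of \<open>\<kappa>\<close>
interchanged.\<close>

lemma mult_transpose_le:
  assumes ij: "i < n" "j < n" "i \<noteq> j"
  shows "mult \<kappa> \<le> mult (\<kappa> \<circ> transpose i j)"
proof -
  define X where "X = E i j"
  define N where "N f = - E j i f" for f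
  define H where "H f = E i i f - E j j f" for f
  define K where "K f = E i i f + E j j f" for f
  note comm = gl_action_comm[OF gl]
  have linX: "linop X" and linN: "linop N" and linH: "linop H" and linK: "linop K"
    unfolding X_def N_def[abs_def] H_def[abs_def] K_def[abs_def]
    by (intro linop_op_add linop_op_diff linop_op_uminus linop_E)+
  obtain M1 where M1: "\<And>k f. M1 \<le> k \<Longrightarrow> (X ^^ k) f = 0"
    using E_nilpotent[OF ij] unfolding X_def by blast
  obtain M2 where M2: "\<And>k f. M2 \<le> k \<Longrightarrow> ((E j i) ^^ k) f = 0"
    using E_nilpotent[OF ij(2,1)] ij(3) by blast
  define M where "M = Suc (M1 + M2)"
  have nilX: "(X ^^ k) f = 0" if "M \<le> k" for k f using M1 that by (simp add: M_def)
  have powN: "(N ^^ k) f = (if even k then ((E j i) ^^ k) f else - ((E j i) ^^ k) f)" for k f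
    by (induction k) (simp_all add: N_def linop_uminus[OF linop_E])
  have nilN: "(N ^^ k) f = 0" if "M \<le> k" for k f
    unfolding powN using M2[of k f] that by (simp add: M_def)
  note lin = linop_diff[OF linop_E] linop_add[OF linop_E] linop_uminus[OF linop_E]
  have XE: "E i j (E i i f) = E i i (E i j f) - E i j f" "E i j (E j j f) = E j j (E i j f) + E i j f"
    "E j i (E i i f) = E i i (E j i f) + E j i f" "E j i (E j j f) = E j j (E j i f) - E j i f"
    "E j i (E i j f) = E i j (E j i f) + E j j f - E i i f" for f
    using comm[OF ij(1,2,1,1), of f] comm[OF ij(1,2,2,2), of f] comm[OF ij(2,1,1,1), of f]
      comm[OF ij(2,1,2,2), of f] comm[OF ij(2,1,1,2), of f] ij(3) by simp_all
  define X2 where "X2 f = - X f - X f" for f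
  define N2 where "N2 f = N f + N f" for f
  have lin2: "linop X2" "linop N2"
    unfolding X2_def[abs_def] N2_def[abs_def]
    by (intro linop_op_add linop_op_diff linop_op_uminus linX linN)+
  have a_H: "exp_op M X (H f) = H (exp_op M X f) + X2 (exp_op M X f)" for f
  proof (rule exp_op_commute1[OF linX linH lin2(1) _ _ nilX])
    show "X (H f) = H (X f) + X2 f" for f
      unfolding X_def H_def X2_def lin XE by (simp add: algebra_simps)
    show "X (X2 f) = X2 (X f)" for f
      unfolding X2_def linop_diff[OF linX] linop_uminus[OF linX] ..
  qed
  have a_X: "exp_op M X (X f) = X (exp_op M X f)" for f
    by (rule exp_op_commute0[OF linX linX refl nilX])
  have b_H: "exp_op M N (H f) = H (exp_op M N f) + N2 (exp_op M N f)" for f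
  proof (rule exp_op_commute1[OF linN linH lin2(2) _ _ nilN])
    show "N (H f) = H (N f) + N2 f" for f
      unfolding N_def H_def N2_def lin XE by (simp add: algebra_simps)
    show "N (N2 f) = N2 (N f)" for f
      unfolding N2_def linop_add[OF linN] ..
  qed
  have b_X: "exp_op M N (X f) = X (exp_op M N f) + H (exp_op M N f) + N (exp_op M N f)" for f
  proof
    fix x
    have "N (X f) = X (N f) + H f" for f
      unfolding N_def H_def X_def lin XE by (simp add: algebra_simps)
    moreover have "N (H f) = H (N f) + N2 f" for f
      unfolding N_def H_def N2_def lin XE by (simp add: algebra_simps)
    moreover have "N (N2 f) = N2 (N f)" for f
      unfolding N2_def linop_add[OF linN] ..
    ultimately show "exp_op M N (X f) x = (X (exp_op M N f) + H (exp_op M N f) + N (exp_op M N f)) x"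
      using exp_op_commute[OF linN linX linH lin2(2) _ _ _ nilN, where f = f and x = x]
      by (simp add: N2_def)
  qed
  define S where "S f = exp_op M X (exp_op M N (exp_op M X f))" for f
  note lina = linop_exp_op[OF linX, of M] and linb = linop_exp_op[OF linN, of M]
  have linS: "linop S"
    using lina linb unfolding linop_def S_def by simp
  have S_H: "S (H f) = - H (S f)" for f
  proof -
    define g where "g = exp_op M X f"
    define h where "h = exp_op M N g"
    have "S (H f) = exp_op M X (exp_op M N (H g + X2 g))"
      unfolding S_def a_H g_def ..
    also have "exp_op M N (H g + X2 g) = - H h - X h - X h"
      unfolding linop_add[OF linb] X2_def linop_diff[OF linb] linop_uminus[OF linb] b_H b_X h_def[symmetric] N2_def
      by (simp add: algebra_simps)
    also have "exp_op M X (- H h - X h - X h) = - H (exp_op M X h)"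
      unfolding linop_diff[OF lina] linop_uminus[OF lina] a_H a_X X2_def by (simp add: algebra_simps)
    finally show ?thesis by (simp add: S_def g_def h_def)
  qed
  have S_comm: "S (Y f) = Y (S f)"
    if "linop Y" "\<And>f. X (Y f) = Y (X f)" "\<And>f. N (Y f) = Y (N f)" for Y f
  proof -
    have a_Y: "exp_op M X (Y g) = Y (exp_op M X g)" for g
      by (rule exp_op_commute0[OF linX that(1,2) nilX])
    have b_Y: "exp_op M N (Y g) = Y (exp_op M N g)" for g
      by (rule exp_op_commute0[OF linN that(1,3) nilN])
    show ?thesis unfolding S_def a_Y b_Y by (rule refl)
  qed
  have S_K: "S (K f) = K (S f)" for f
  proof (rule S_comm[OF linK])
    show "X (K f) = K (X f)" "N (K f) = K (N f)" for f
      unfolding X_def N_def K_def lin XE by simp_all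
  qed
  have S_E: "S (E a a f) = E a a (S f)" if a: "a < n" "a \<noteq> i" "a \<noteq> j" for a f
  proof (rule S_comm[OF linop_E])
    show "X (E a a f) = E a a (X f)" "N (E a a f) = E a a (N f)" for f
      unfolding X_def N_def lin using comm[OF ij(1,2) a(1,1), of f] comm[OF ij(2,1) a(1,1), of f] a
      by simp_all
  qed
  have inj: "f = 0" if "S f = 0" for f
  proof -
    have "exp_op M N (exp_op M X f) = 0"
      by (rule exp_op_inj[OF linX nilX that[unfolded S_def]])
    from exp_op_inj[OF linN nilN this] have "exp_op M X f = 0" by this
    from exp_op_inj[OF linX nilX this] show ?thesis by this
  qed
  have S_out: "S f x = f x" if "d \<le> x" for f x
  proof -
    have "X f x = 0" "N f x = 0" for f using that by (simp_all add: X_def N_def mat_op_def)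
    then show ?thesis
      using exp_op_outside[of X x M] exp_op_outside[of N x M] by (simp add: S_def M_def del: funpow.simps)
  qed
  show ?thesis
    unfolding mult_def
  proof (rule card_le_of_inj_linop[OF linS inj])
    fix b x assume b: "b \<in> {b. b < d \<and> wt b = \<kappa>}" and x: "x \<notin> {b. b < d \<and> wt b = \<kappa> \<circ> transpose i j}"
    define f where "f = (unit_fun b :: nat \<Rightarrow> complex)"
    have Ef: "E a a f = (\<lambda>x. of_int (\<kappa> a) * f x)" if "a < n" for a
      unfolding E_diag[OF that] using b by (auto simp: f_def unit_fun_def)
    have Hf: "H f = (\<lambda>x. of_int (\<kappa> i - \<kappa> j) * f x)" and Kf: "K f = (\<lambda>x. of_int (\<kappa> i + \<kappa> j) * f x)"
      unfolding H_def K_def using Ef[OF ij(1)] Ef[OF ij(2)] by (auto simp: algebra_simps)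
    have HS: "H (S f) = (\<lambda>x. - of_int (\<kappa> i - \<kappa> j) * S f x)"
    proof -
      have "H (S f) x = - S (H f) x" for x using S_H[of f] by simp
      then show ?thesis unfolding Hf linop_scale[OF linS] by (intro ext) (simp add: algebra_simps)
    qed
    have KS: "K (S f) = (\<lambda>x. of_int (\<kappa> i + \<kappa> j) * S f x)"
      using S_K[of f] unfolding Kf linop_scale[OF linS] by simp
    have ES: "E a a (S f) x = of_int ((\<kappa> \<circ> transpose i j) a) * S f x" if "a < n" for a
    proof -
      consider "a = i" | "a = j" | "a \<noteq> i" "a \<noteq> j" by blast
      then show ?thesis
      proof cases
        case 1
        have "2 * E i i (S f) x = H (S f) x + K (S f) x" by (simp add: H_def K_def)
        then show ?thesis using 1 unfolding HS KS by (simp add: algebra_simps)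
      next
        case 2
        have "2 * E j j (S f) x = K (S f) x - H (S f) x" by (simp add: H_def K_def)
        then show ?thesis using 2 unfolding HS KS by (simp add: algebra_simps)
      next
        case 3
        then have "E a a (S f) = S (E a a f)" using S_E[OF that] by simp
        then show ?thesis using 3 unfolding Ef[OF that] linop_scale[OF linS]
          by (simp add: transpose_def)
      qed
    qed
    show "S (unit_fun b) x = 0"
    proof (rule ccontr)
      assume nz: "S (unit_fun b) x \<noteq> 0"
      have "x < d"
      proof (rule ccontr)
        assume "\<not> x < d"
        then have "S (unit_fun b) x = 0" using S_out[of x "unit_fun b"] b by (auto simp: unit_fun_def)
        with nz show False by simp
      qed
      have "wt x a = (\<kappa> \<circ> transpose i j) a" for a
      proof (cases "a < n")
        case True
        then show ?thesis using ES[OF True] nz \<open>x < d\<close> unfolding E_diag[OF True] f_def by simp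
      next
        case False
        then have "transpose i j a = a" using ij by (intro transpose_apply_other) auto
        then show ?thesis using False wt_zero[of x a] wt_zero[of b a] \<open>x < d\<close> b by auto
      qed
      then have "wt x = \<kappa> \<circ> transpose i j" by blast
      with x \<open>x < d\<close> show False by simp
    qed
  qed auto
qed

theorem mult_permute:
  assumes "\<sigma> permutes {0..<n}"
  shows "mult (\<kappa> \<circ> \<sigma>) = mult \<kappa>"
  using assms finite_atLeastLessThan[of 0 n]
proof (induction arbitrary: \<kappa> rule: permutes_induct)
  case id
  then show ?case by simp
next
  case (swap a b p)
  have "mult (\<kappa> \<circ> transpose a b) = mult \<kappa>"
  proof (cases "a = b")
    case False
    have "\<kappa> \<circ> transpose a b \<circ> transpose a b = \<kappa>" by (simp add: comp_assoc)
    then show ?thesis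
      using mult_transpose_le[of a b \<kappa>] mult_transpose_le[of a b "\<kappa> \<circ> transpose a b"] swap.hyps False
      by simp
  qed simp
  then show ?case using swap.IH[of "\<kappa> \<circ> transpose a b"] by (simp only: comp_assoc)
qed

end

section \<open>The group algebra of the weight lattice\<close>

text \<open>The group algebra of the weight lattice: finitely supported functions on the weights. Weights are
functions that vanish beyond \<open>n\<close>.\<close>

type_synonym weight_alg = "(nat \<Rightarrow> int) \<Rightarrow>\<^sub>0 complex"

abbreviation wmono :: "(nat \<Rightarrow> int) \<Rightarrow> complex \<Rightarrow> weight_alg" where
  "wmono \<equiv> Poly_Mapping.single"

abbreviation wcoeff :: "weight_alg \<Rightarrow> (nat \<Rightarrow> int) \<Rightarrow> complex" where
  "wcoeff \<equiv> Poly_Mapping.lookup"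

abbreviation perms :: "nat \<Rightarrow> (nat \<Rightarrow> nat) set" where
  "perms n \<equiv> {w. w permutes {0..<n}}"

text \<open>The variable \<open>x\<^sub>i\<close>.\<close>

definition wvar :: "nat \<Rightarrow> weight_alg" where
  "wvar i = wmono (\<lambda>k. if k = i then 1 else 0) 1"

text \<open>The derivation \<open>x\<^sub>i \<partial>/\<partial>x\<^sub>i\<close>.\<close>

definition wder :: "nat \<Rightarrow> weight_alg \<Rightarrow> weight_alg" where
  "wder i f = Poly_Mapping.mapp (\<lambda>\<kappa> c. of_int (\<kappa> i) * c) f"

lemma lookup_wder: "wcoeff (wder i f) \<kappa> = of_int (\<kappa> i) * wcoeff f \<kappa>"
  by (simp add: wder_def lookup_mapp when_def in_keys_iff)

lemma wder_add: "wder i (f + g) = wder i f + wder i g"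
  by (rule poly_mapping_eqI) (simp add: lookup_wder lookup_add distrib_left)

lemma wder_diff: "wder i (f - g) = wder i f - wder i g"
  by (rule poly_mapping_eqI) (simp add: lookup_wder lookup_minus right_diff_distrib)

lemma wder_sum: "wder i (\<Sum>a\<in>A. f a) = (\<Sum>a\<in>A. wder i (f a))"
  by (rule poly_mapping_eqI) (simp add: lookup_wder lookup_sum sum_distrib_left)

lemma wder_single: "wder i (wmono \<kappa> c) = wmono \<kappa> (of_int (\<kappa> i) * c)"
  by (rule poly_mapping_eqI) (simp add: lookup_wder lookup_single when_def)

lemma poly_mapping_sum_single: "f = (\<Sum>\<kappa>\<in>Poly_Mapping.keys f. wmono \<kappa> (wcoeff f \<kappa>))"
proof (rule poly_mapping_eqI)
  fix \<kappa>
  have "(\<Sum>\<kappa>'\<in>Poly_Mapping.keys f. wcoeff (wmono \<kappa>' (wcoeff f \<kappa>')) \<kappa>) =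
      (\<Sum>\<kappa>'\<in>Poly_Mapping.keys f. if \<kappa>' = \<kappa> then wcoeff f \<kappa> else 0)"
    by (intro sum.cong refl) (auto simp: lookup_single when_def)
  then show "wcoeff f \<kappa> = wcoeff (\<Sum>\<kappa>\<in>Poly_Mapping.keys f. wmono \<kappa> (wcoeff f \<kappa>)) \<kappa>"
    by (simp add: lookup_sum in_keys_iff)
qed

lemma wder_mult: "wder i (f * g) = wder i f * g + f * wder i g"
proof -
  have single: "wder i (wmono \<kappa> a * wmono \<kappa>' b) =
      wder i (wmono \<kappa> a) * wmono \<kappa>' b +
      wmono \<kappa> a * wder i (wmono \<kappa>' b)" for \<kappa> \<kappa>' a b
    by (simp add: mult_single wder_single single_add[symmetric] algebra_simps)
  have *: "wder i (sum F S * sum G U) = wder i (sum F S) * sum G U + sum F S * wder i (sum G U)"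
    if "\<And>s u. wder i (F s * G u) = wder i (F s) * G u + F s * wder i (G u)"
    for F G :: "(nat \<Rightarrow> int) \<Rightarrow> weight_alg" and S U
    unfolding sum_product wder_sum that by (simp add: sum.distrib)
  show ?thesis
    using *[of "\<lambda>\<kappa>. wmono \<kappa> (wcoeff f \<kappa>)" "\<lambda>\<kappa>. wmono \<kappa> (wcoeff g \<kappa>)"
        "Poly_Mapping.keys f" "Poly_Mapping.keys g"] single
    unfolding poly_mapping_sum_single[symmetric] by blast
qed

lemma wder_prod:
  assumes "finite P"
  shows "wder i (\<Prod>p\<in>P. f p) = (\<Sum>p\<in>P. wder i (f p) * (\<Prod>q\<in>P - {p}. f q))"
  using assms
proof (induction P rule: finite_induct)
  case empty
  have "wder i (1 * 1) = wder i 1 * 1 + 1 * wder i 1" by (rule wder_mult)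
  then show ?case by simp
next
  case (insert a P)
  have "(\<Prod>q\<in>insert a P - {p}. f q) = f a * (\<Prod>q\<in>P - {p}. f q)" if "p \<in> P" for p
  proof -
    have "insert a P - {p} = insert a (P - {p})" using insert.hyps that by auto
    then show ?thesis using insert.hyps by simp
  qed
  then have "(\<Sum>p\<in>P. wder i (f p) * (\<Prod>q\<in>insert a P - {p}. f q)) =
      f a * (\<Sum>p\<in>P. wder i (f p) * (\<Prod>q\<in>P - {p}. f q))"
    by (simp add: sum_distrib_left mult_ac)
  moreover have "insert a P - {a} = P" using insert.hyps by auto
  ultimately show ?case
    using insert by (simp add: wder_mult)
qed

lemma wder_wvar: "wder k (wvar i) = (if k = i then wvar i else 0)"
  by (simp add: wvar_def wder_single)

lemma wvar_power: "wvar i ^ m = wmono (\<lambda>k. if k = i then int m else 0) 1"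
proof (induction m)
  case 0
  have "(\<lambda>k. if k = i then int 0 else 0) = 0" by auto
  then show ?case by (simp only: power_0 single_one)
next
  case (Suc m)
  have "(\<lambda>k. if k = i then 1 else 0) + (\<lambda>k. if k = i then int m else 0) = (\<lambda>k. if k = i then int (Suc m) else 0)"
    by auto
  then show ?case by (simp only: power_Suc Suc.IH) (simp only: wvar_def mult_single mult_1)
qed

lemma prod_single_one:
  "(\<Prod>i\<in>A. wmono (\<kappa> i) (1::complex)) = wmono (\<lambda>k. \<Sum>i\<in>A. \<kappa> i k :: int) 1"
proof (induction A rule: infinite_finite_induct)
  case (insert a A)
  have "\<kappa> a + (\<lambda>k. \<Sum>i\<in>A. \<kappa> i k) = (\<lambda>k. \<Sum>i\<in>insert a A. \<kappa> i k)"
    using insert.hyps by auto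
  then show ?case using insert by (simp add: mult_single)
next
  case (infinite A)
  have "(\<lambda>k. \<Sum>i\<in>A. \<kappa> i k) = 0" using infinite by auto
  then show ?case using infinite by (simp only: prod.infinite single_one simp_thms)
next
  case empty
  have "(\<lambda>k. \<Sum>i\<in>{}. \<kappa> i k) = 0" by auto
  then show ?case by (simp only: prod.empty single_one)
qed

lemma of_int_mult_single: "of_int s * wmono \<kappa> (c::complex) = (wmono \<kappa> (of_int s * c) :: weight_alg)"
proof -
  have "(of_int s :: weight_alg) = wmono 0 (of_int s)" by simp
  then show ?thesis by (simp only: mult_single add_0)
qed

text \<open>The staircase weight \<open>\<rho> = (n - 1, \<dots>, 1, 0)\<close>.\<close>

definition stair :: "nat \<Rightarrow> nat \<Rightarrow> int" where
  "stair n k = (if k < n then int (n - 1 - k) else 0)"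

text \<open>The pairs \<open>(i, j)\<close> with \<open>i < j < n\<close>, that is, the positive roots.\<close>

definition pairs :: "nat \<Rightarrow> (nat \<times> nat) set" where
  "pairs n = (SIGMA j:{..<n}. {j<..<n})"

lemma pairs_iff [simp]: "(i, j) \<in> pairs n \<longleftrightarrow> i < j \<and> j < n"
  by (auto simp: pairs_def)

lemma finite_pairs [simp]: "finite (pairs n)"
  by (simp add: pairs_def)

lemma prod_pairs: "(\<Prod>(j, k)\<in>pairs n. f j k) = (\<Prod>j<n. \<Prod>k\<in>{j<..<n}. f j k)"
  unfolding pairs_def by (subst prod.Sigma) auto

lemma sum_split_pairs:
  fixes f :: "nat \<Rightarrow> nat \<Rightarrow> 'a::comm_monoid_add"
  shows "(\<Sum>i<n. \<Sum>j<n. f i j) = (\<Sum>i<n. f i i) + (\<Sum>(i, j)\<in>pairs n. f i j + f j i)"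
proof (induction n)
  case (Suc n)
  have eq: "pairs (Suc n) = pairs n \<union> (\<lambda>i. (i, n)) ` {..<n}"
    by (auto simp: pairs_def image_iff)
  have "(\<Sum>(i, j)\<in>pairs (Suc n). f i j + f j i) =
      (\<Sum>(i, j)\<in>pairs n. f i j + f j i) + (\<Sum>i<n. f i n + f n i)"
    unfolding eq by (subst sum.union_disjoint) (auto simp: pairs_def sum.reindex inj_on_def)
  then show ?case using Suc.IH by (simp add: sum.distrib add_ac)
qed (simp add: pairs_def)

text \<open>The Weyl denominator.\<close>

definition vdm :: "nat \<Rightarrow> weight_alg" where
  "vdm n = (\<Prod>(i, j)\<in>pairs n. wvar i - wvar j)"

lemma stair_comp: "w permutes {0..<n} \<Longrightarrow> (stair n \<circ> w) k = (if k < n then int (n - 1 - w k) else 0)"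
  using permutes_in_image[of w "{0..<n}" k] by (auto simp: stair_def)

lemma vdm_alt: "vdm n = (\<Sum>w\<in>perms n. wmono (stair n \<circ> w) (of_int (sign w)))"
proof -
  have "vdm n = det (mat n n (\<lambda>(i, j). wvar i ^ (n - 1 - j)))"
    unfolding vdm_def prod_pairs det_vandermonde ..
  also have "\<dots> = (\<Sum>w\<in>perms n. of_int (sign w) * (\<Prod>i = 0..<n. wvar i ^ (n - 1 - w i)))"
    unfolding det_def'[OF mat_carrier]
  proof (rule sum.cong[OF refl])
    fix w assume "w \<in> perms n"
    then have "w i < n" if "i < n" for i using that permutes_in_image[of w "{0..<n}" i] by auto
    then show "of_int (sign w) * (\<Prod>i = 0..<n. mat n n (\<lambda>(i, j). wvar i ^ (n - 1 - j)) $$ (i, w i)) =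
        of_int (sign w) * (\<Prod>i = 0..<n. wvar i ^ (n - 1 - w i))"
      by (intro arg_cong2[of _ _ _ _ "(*)"] prod.cong refl) simp
  qed
  also have "\<dots> = (\<Sum>w\<in>perms n. wmono (stair n \<circ> w) (of_int (sign w)))"
  proof (rule sum.cong[OF refl])
    fix w assume "w \<in> perms n"
    then have "(\<lambda>k. \<Sum>i = 0..<n. if k = i then int (n - 1 - w i) else 0) = stair n \<circ> w"
      using stair_comp[of w n] by auto
    then show "of_int (sign w) * (\<Prod>i = 0..<n. wvar i ^ (n - 1 - w i)) =
        wmono (stair n \<circ> w) (of_int (sign w))"
      unfolding wvar_power prod_single_one by (simp add: of_int_mult_single)
  qed
  finally show ?thesis .
qed

text \<open>The Laplacian; it multiplies the coefficient at \<open>\<kappa>\<close> by the squared length of \<open>\<kappa>\<close>.\<close>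

definition wlap :: "nat \<Rightarrow> weight_alg \<Rightarrow> weight_alg" where
  "wlap n f = (\<Sum>k<n. wder k (wder k f))"

lemma lookup_wlap: "wcoeff (wlap n f) \<kappa> = of_int (\<Sum>k<n. \<kappa> k ^ 2) * wcoeff f \<kappa>"
  by (simp add: wlap_def lookup_sum lookup_wder sum_distrib_right power2_eq_square mult.assoc)

lemma wlap_vdm: "wlap n (vdm n) = of_int (\<Sum>k<n. stair n k ^ 2) * vdm n"
proof (rule poly_mapping_eqI)
  fix \<kappa>
  have *: "(\<Sum>k<n. \<kappa> k ^ 2) = (\<Sum>k<n. stair n k ^ 2)" if "wcoeff (vdm n) \<kappa> \<noteq> 0"
  proof -
    from that have "(\<Sum>w\<in>perms n.
        wcoeff (wmono (stair n \<circ> w) (of_int (sign w) :: complex)) \<kappa>) \<noteq> 0"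
      unfolding vdm_alt lookup_sum .
    then obtain w where "w \<in> perms n"
      "wcoeff (wmono (stair n \<circ> w) (of_int (sign w) :: complex)) \<kappa> \<noteq> 0"
      by (rule sum.not_neutral_contains_not_neutral)
    then have w: "w permutes {0..<n}" "\<kappa> = stair n \<circ> w"
      by (auto simp: lookup_single when_def split: if_splits)
    then have "(\<Sum>k<n. \<kappa> k ^ 2) = (\<Sum>k\<in>{0..<n}. ((\<lambda>k. stair n k ^ 2) \<circ> w) k)" by (simp add: atLeast0LessThan)
    also have "\<dots> = (\<Sum>k\<in>{0..<n}. stair n k ^ 2)"
      using sum.permute[OF w(1), of "\<lambda>k. stair n k ^ 2"] by simp
    finally show ?thesis by (simp add: atLeast0LessThan)
  qed
  have "(of_int s :: weight_alg) * vdm n = Poly_Mapping.map ((*) (of_int s)) (vdm n)" for s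
    unfolding mult_map_scale_conv_mult by simp
  then have lk: "wcoeff (of_int s * vdm n) \<kappa> = of_int s * wcoeff (vdm n) \<kappa>" for s
    by (simp add: Poly_Mapping.map.rep_eq when_def)
  show "wcoeff (wlap n (vdm n)) \<kappa> = wcoeff (of_int (\<Sum>k<n. stair n k ^ 2) * vdm n) \<kappa>"
    unfolding lookup_wlap lk
    by (cases "wcoeff (vdm n) \<kappa> = 0") (simp_all only: mult_zero_right * not_False_eq_True)
qed

text \<open>The linear extension of a function on weights to the group algebra.\<close>

definition weval :: "((nat \<Rightarrow> int) \<Rightarrow> complex) \<Rightarrow> weight_alg \<Rightarrow> complex" where
  "weval h f = (\<Sum>\<kappa>\<in>Poly_Mapping.keys f. wcoeff f \<kappa> * h \<kappa>)"

lemma weval_superset: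
  "finite S \<Longrightarrow> Poly_Mapping.keys f \<subseteq> S \<Longrightarrow> weval h f = (\<Sum>\<kappa>\<in>S. wcoeff f \<kappa> * h \<kappa>)"
  unfolding weval_def by (rule sum.mono_neutral_left) (auto simp: in_keys_iff)

lemma weval_add: "weval h (f + g) = weval h f + weval h g"
proof -
  let ?S = "Poly_Mapping.keys f \<union> Poly_Mapping.keys g"
  have "Poly_Mapping.keys (f + g) \<subseteq> ?S" by (rule keys_add)
  then show ?thesis
    using weval_superset[of ?S f h] weval_superset[of ?S g h] weval_superset[of ?S "f + g" h]
    by (simp add: lookup_add distrib_right sum.distrib)
qed

lemma weval_single: "weval h (wmono \<kappa> c) = c * h \<kappa>"
  using weval_superset[of "{\<kappa>}" "wmono \<kappa> c" h] by simp

lemma weval_sum: "weval h (\<Sum>a\<in>A. f a) = (\<Sum>a\<in>A. weval h (f a))"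
proof (induction A rule: infinite_finite_induct)
  case (insert a A)
  then show ?case by (simp add: weval_add)
qed (simp_all add: weval_def)

lemma sum_swap_less:
  fixes y a :: "nat \<Rightarrow> int"
  assumes ij: "i < j" "j < n" and y: "y j < y i" and a: "a (\<sigma> i) < a (\<sigma> j)"
  shows "(\<Sum>k<n. y k * a (\<sigma> k)) < (\<Sum>k<n. y k * a ((\<sigma> \<circ> transpose i j) k))"
proof -
  have split: "(\<Sum>k<n. F k) = F i + F j + (\<Sum>k\<in>{..<n} - {i, j}. F k)" for F :: "nat \<Rightarrow> int"
  proof -
    have "{..<n} = insert i (insert j ({..<n} - {i, j}))" using ij by auto
    then have "sum F {..<n} = sum F (insert i (insert j ({..<n} - {i, j})))" by simp
    then show ?thesis using ij by simp
  qed
  have "(\<Sum>k\<in>{..<n} - {i, j}. y k * a ((\<sigma> \<circ> transpose i j) k)) = (\<Sum>k\<in>{..<n} - {i, j}. y k * a (\<sigma> k))"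
    by (intro sum.cong) (auto simp: transpose_def)
  moreover have "0 < (y i - y j) * (a (\<sigma> j) - a (\<sigma> i))" using y a by simp
  ultimately show ?thesis unfolding split[of "\<lambda>k. y k * a (\<sigma> k)"] split[of "\<lambda>k. y k * a ((\<sigma> \<circ> transpose i j) k)"]
    by (simp add: algebra_simps)
qed

lemma ex_sorting_permutation:
  fixes y a :: "nat \<Rightarrow> int"
  assumes y: "\<And>i j. i < j \<Longrightarrow> j < n \<Longrightarrow> y j < y i"
  obtains \<sigma> where "\<sigma> permutes {0..<n}" "\<And>i j. i < j \<Longrightarrow> j < n \<Longrightarrow> a (\<sigma> j) \<le> a (\<sigma> i)"
    "\<And>\<tau>. \<tau> permutes {0..<n} \<Longrightarrow> (\<Sum>k<n. y k * a (\<tau> k)) \<le> (\<Sum>k<n. y k * a (\<sigma> k))"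
proof -
  define g where "g \<sigma> = (\<Sum>k<n. y k * a (\<sigma> k))" for \<sigma>
  have fin: "finite (perms n)" by (rule finite_permutations) simp
  have "g ` (perms n) \<noteq> {}" using permutes_id by blast
  then have "Max (g ` (perms n)) \<in> g ` (perms n)"
    using fin by (intro Max_in) auto
  then obtain \<sigma> where \<sigma>1: "\<sigma> permutes {0..<n}" "Max (g ` (perms n)) = g \<sigma>"
    by auto
  have "g \<tau> \<le> g \<sigma>" if "\<tau> permutes {0..<n}" for \<tau>
    unfolding \<sigma>1(2)[symmetric] using fin that by (intro Max_ge) auto
  note \<sigma> = \<sigma>1(1) this
  have "a (\<sigma> j) \<le> a (\<sigma> i)" if ij: "i < j" "j < n" for i j
  proof (rule ccontr)
    assume "\<not> a (\<sigma> j) \<le> a (\<sigma> i)"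
    then have "g \<sigma> < g (\<sigma> \<circ> transpose i j)"
      unfolding g_def using sum_swap_less[OF ij y[OF ij]] by auto
    moreover have "\<sigma> \<circ> transpose i j permutes {0..<n}"
      using ij by (intro permutes_compose[OF permutes_swap_id \<sigma>(1)]) auto
    ultimately show False using \<sigma>(2) by fastforce
  qed
  then show thesis using that[OF \<sigma>(1)] \<sigma>(2) unfolding g_def by blast
qed

lemma permutes_mono_id:
  fixes w :: "nat \<Rightarrow> nat"
  assumes w: "w permutes {0..<n}" and mono: "\<And>i j. i < j \<Longrightarrow> j < n \<Longrightarrow> w i \<le> w j"
  shows "w = id"
proof (rule permutes_natset_ge[OF w])
  have "i \<le> w i" if "i < n" for i
    using that
  proof (induction i)
    case (Suc i)
    have "w i \<noteq> w (Suc i)" using permutes_inj[OF w] by (metis injD n_not_Suc_n)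
    then show ?case using mono[of i "Suc i"] Suc by simp
  qed simp
  then show "\<forall>i\<in>{0..<n}. i \<le> w i" by simp
qed

lemma rearrangement_stair:
  fixes y :: "nat \<Rightarrow> int"
  assumes y: "\<And>i j. i < j \<Longrightarrow> j < n \<Longrightarrow> y j < y i" and w: "w permutes {0..<n}"
  shows "w = id \<or> (\<Sum>k<n. y k * stair n (w k)) < (\<Sum>k<n. y k * stair n k)"
proof -
  obtain \<sigma> where \<sigma>: "\<sigma> permutes {0..<n}" "\<And>i j. i < j \<Longrightarrow> j < n \<Longrightarrow> stair n (\<sigma> j) \<le> stair n (\<sigma> i)"
    "\<And>\<tau>. \<tau> permutes {0..<n} \<Longrightarrow> (\<Sum>k<n. y k * stair n (\<tau> k)) \<le> (\<Sum>k<n. y k * stair n (\<sigma> k))"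
    by (rule ex_sorting_permutation[where a = "stair n" and y = y and n = n]) (use y in auto)
  have lt: "\<tau> i < n" if "\<tau> permutes {0..<n}" "i < n" for \<tau> i
    using permutes_in_image[OF that(1), of i] that(2) by simp
  have "\<sigma> = id"
  proof (rule permutes_mono_id[OF \<sigma>(1)])
    fix i j assume "i < j" "j < n"
    then show "\<sigma> i \<le> \<sigma> j" using \<sigma>(2)[of i j] lt[OF \<sigma>(1), of i] lt[OF \<sigma>(1), of j]
      by (simp add: stair_def)
  qed
  show ?thesis
  proof (cases "w = id")
    case False
    then obtain i j where ij: "i < j" "j < n" "\<not> w i \<le> w j"
      using permutes_mono_id[OF w] by blast
    have "stair n (w i) < stair n (w j)"
      using ij lt[OF w, of i] by (simp add: stair_def)
    then have "(\<Sum>k<n. y k * stair n (w k)) < (\<Sum>k<n. y k * stair n ((w \<circ> transpose i j) k))"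
      by (intro sum_swap_less ij y)
    also have "w \<circ> transpose i j permutes {0..<n}"
      using ij by (intro permutes_compose[OF permutes_swap_id w]) auto
    from \<sigma>(3)[OF this] have "(\<Sum>k<n. y k * stair n ((w \<circ> transpose i j) k)) \<le> (\<Sum>k<n. y k * stair n k)"
      unfolding \<open>\<sigma> = id\<close> by simp
    finally show ?thesis ..
  qed simp
qed

section \<open>The Weyl character formula\<close>

lemma single_sum: "wmono \<kappa> (\<Sum>a\<in>A. c a) = (\<Sum>a\<in>A. wmono \<kappa> (c a :: complex))"
  by (induction A rule: infinite_finite_induct) (auto simp: single_add)

lemma lookup_const_mult: "wcoeff (wmono 0 K * (f :: weight_alg)) \<kappa> = K * wcoeff f \<kappa>"
proof -
  have "wmono 0 K * f = Poly_Mapping.map ((*) K) f"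
    by (rule mult_map_scale_conv_mult[symmetric])
  then show ?thesis by (simp add: Poly_Mapping.map.rep_eq when_def)
qed

context weight_module
begin

text \<open>The character of the representation.\<close>

definition chi :: weight_alg where
  "chi = (\<Sum>b<d. wmono (wt b) 1)"

text \<open>The diagonal entries of \<open>E\<^sub>j\<^sub>i E\<^sub>i\<^sub>j\<close>.\<close>

definition tr_coeff :: "nat \<Rightarrow> nat \<Rightarrow> nat \<Rightarrow> complex" where
  "tr_coeff i j b = (\<Sum>e<d. R j i b e * R i j e b)"

text \<open>The element whose coefficient at a weight is the trace of \<open>E\<^sub>j\<^sub>i E\<^sub>i\<^sub>j\<close> on the weight space.\<close>

definition tr_chi :: "nat \<Rightarrow> nat \<Rightarrow> weight_alg" where
  "tr_chi i j = (\<Sum>b<d. wmono (wt b) (tr_coeff i j b))"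

lemma wder_chi: "wder i chi = (\<Sum>b<d. wmono (wt b) (of_int (wt b i)))"
  by (simp add: chi_def wder_sum wder_single)

lemma tr_coeff_swap:
  assumes "i < n" "j < n" "b < d"
  shows "(\<Sum>e<d. R i j b e * R j i e b) = tr_coeff i j b + of_int (wt b i) - of_int (wt b j)"
proof -
  have "(\<Sum>e<d. R i j b e * R j i e b) - (\<Sum>e<d. R j i b e * R i j e b) =
      (if j = j then R i i b b else 0) - (if i = i then R j j b b else 0)"
    using assms by (intro rep[unfolded gl_entries_def, rule_format])
  then show ?thesis using diag assms by (simp add: tr_coeff_def algebra_simps)
qed

text \<open>Cyclicity of the trace: \<open>E\<^sub>i\<^sub>j\<close> shifts weights by the exponent of \<open>x\<^sub>i / x\<^sub>j\<close>, so that factor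
turns the traces of \<open>E\<^sub>j\<^sub>i E\<^sub>i\<^sub>j\<close> into those of \<open>E\<^sub>i\<^sub>j E\<^sub>j\<^sub>i\<close>.\<close>

lemma wvar_tr_chi:
  assumes ij: "i < n" "j < n"
  shows "wvar i * tr_chi i j = wvar j * (tr_chi i j + wder i chi - wder j chi)"
proof -
  define \<epsilon> where "\<epsilon> i = (\<lambda>k. if k = i then 1 else 0 :: int)" for i :: nat
  have key: "wmono (\<epsilon> i + wt b) (R j i b e * R i j e b) =
      wmono (\<epsilon> j + wt e) (R i j e b * R j i b e)" if "b < d" "e < d" for b e
  proof (cases "R i j e b = 0")
    case False
    have "(\<epsilon> i + wt b) a = (\<epsilon> j + wt e) a" for a
    proof (cases "a < n")
      case True
      then show ?thesis using entry_nonzero[OF ij that(2,1) False True] by (auto simp: \<epsilon>_def)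
    next
      case F: False
      then show ?thesis using wt_zero[OF that(1), of a] wt_zero[OF that(2), of a] ij by (auto simp: \<epsilon>_def)
    qed
    then have "\<epsilon> i + wt b = \<epsilon> j + wt e" by blast
    then show ?thesis by (simp add: mult.commute)
  qed simp
  have "wvar i * tr_chi i j = (\<Sum>b<d. \<Sum>e<d. wmono (\<epsilon> i + wt b) (R j i b e * R i j e b))"
    unfolding wvar_def tr_chi_def tr_coeff_def \<epsilon>_def[symmetric] sum_distrib_left mult_single mult_1 single_sum ..
  also have "\<dots> = (\<Sum>b<d. \<Sum>e<d. wmono (\<epsilon> j + wt e) (R i j e b * R j i b e))"
    by (intro sum.cong refl key) auto
  also have "\<dots> = (\<Sum>e<d. \<Sum>b<d. wmono (\<epsilon> j + wt e) (R i j e b * R j i b e))"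
    by (rule sum.swap)
  also have "\<dots> = (\<Sum>e<d. wmono (\<epsilon> j) 1 * wmono (wt e) (tr_coeff i j e + of_int (wt e i) - of_int (wt e j)))"
  proof (rule sum.cong[OF refl])
    fix e assume "e \<in> {..<d}"
    then have "(\<Sum>b<d. R i j e b * R j i b e) = tr_coeff i j e + of_int (wt e i) - of_int (wt e j)"
      using tr_coeff_swap[OF ij] by simp
    then show "(\<Sum>b<d. wmono (\<epsilon> j + wt e) (R i j e b * R j i b e)) =
        wmono (\<epsilon> j) 1 * wmono (wt e) (tr_coeff i j e + of_int (wt e i) - of_int (wt e j))"
      unfolding single_sum[symmetric] mult_single mult_1 by simp
  qed
  also have "\<dots> = wvar j * (tr_chi i j + wder i chi - wder j chi)"
    unfolding wder_chi tr_chi_def wvar_def \<epsilon>_def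
    by (simp add: single_add single_diff sum.distrib sum_subtractf sum_distrib_left distrib_left right_diff_distrib)
  finally show ?thesis .
qed

lemma casimir_chi:
  obtains c where "wlap n chi + (\<Sum>(i, j)\<in>pairs n. tr_chi i j + tr_chi i j + wder i chi - wder j chi) =
    wmono 0 c * chi"
proof -
  obtain c where c: "\<And>b. b < d \<Longrightarrow> (\<Sum>i<n. \<Sum>j<n. \<Sum>e<d. R i j b e * R j i e b) = c"
    using casimir by blast
  have coeff: "(\<Sum>i<n. of_int (wt b i ^ 2)) + (\<Sum>(i, j)\<in>pairs n. tr_coeff i j b + tr_coeff i j b + of_int (wt b i) - of_int (wt b j)) = c"
    if b: "b < d" for b
  proof -
    define f where "f i j = (\<Sum>e<d. R i j b e * R j i e b)" for i j
    have "f i i = of_int (wt b i ^ 2)" if "i < n" for i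
    proof -
      have "f i i = (\<Sum>e<d. if e = b then of_int (wt b i ^ 2) else 0)"
        unfolding f_def using diag[OF that] b by (intro sum.cong) (auto simp: power2_eq_square)
      then show ?thesis using b by simp
    qed
    moreover have "f i j + f j i = tr_coeff i j b + tr_coeff i j b + of_int (wt b i) - of_int (wt b j)"
      if "i < j" "j < n" for i j
      using tr_coeff_swap[of i j b] that b by (simp add: f_def tr_coeff_def)
    then have "(\<Sum>(i, j)\<in>pairs n. f i j + f j i) =
        (\<Sum>(i, j)\<in>pairs n. tr_coeff i j b + tr_coeff i j b + of_int (wt b i) - of_int (wt b j))"
      by (intro sum.cong) (auto simp del: of_int_power)
    ultimately show ?thesis
      using c[OF b] sum_split_pairs[of f n] by (simp add: f_def)
  qed
  have lap: "wlap n chi = (\<Sum>b<d. wmono (wt b) (\<Sum>i<n. of_int (wt b i ^ 2)))"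
    unfolding wlap_def wder_chi wder_sum wder_single single_sum
    by (subst sum.swap) (simp add: power2_eq_square)
  have prs: "(\<Sum>(i, j)\<in>pairs n. tr_chi i j + tr_chi i j + wder i chi - wder j chi) =
      (\<Sum>b<d. wmono (wt b) (\<Sum>(i, j)\<in>pairs n. tr_coeff i j b + tr_coeff i j b + of_int (wt b i) - of_int (wt b j)))"
  proof -
    have "(\<Sum>(i, j)\<in>pairs n. tr_chi i j + tr_chi i j + wder i chi - wder j chi) =
      (\<Sum>p\<in>pairs n. \<Sum>b<d. wmono (wt b) (case p of (i, j) \<Rightarrow> tr_coeff i j b + tr_coeff i j b + of_int (wt b i) - of_int (wt b j)))"
      unfolding tr_chi_def wder_chi
      unfolding sum.distrib[symmetric] sum_subtractf[symmetric] single_add[symmetric] single_diff[symmetric]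
      by (intro sum.cong refl) (simp only: case_prod_beta)
    then show ?thesis unfolding single_sum by (subst (asm) sum.swap)
  qed
  have "wlap n chi + (\<Sum>(i, j)\<in>pairs n. tr_chi i j + tr_chi i j + wder i chi - wder j chi) =
      (\<Sum>b<d. wmono (wt b) c)"
    unfolding lap prs sum.distrib[symmetric] single_add[symmetric]
    by (intro sum.cong refl) (use coeff in \<open>simp del: of_int_power\<close>)
  also have "\<dots> = wmono 0 c * chi"
    by (simp add: chi_def sum_distrib_left mult_single)
  finally show thesis by (rule that)
qed

lemma wlap_vdm_chi:
  obtains K where "wlap n (vdm n * chi) = wmono 0 K * (vdm n * chi)"
proof -
  obtain c where c: "wlap n chi + (\<Sum>(i, j)\<in>pairs n. tr_chi i j + tr_chi i j + wder i chi - wder j chi) =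
    wmono 0 c * chi"
    by (rule casimir_chi)
  define N where "N = (\<Sum>i<n. wt b0 i)"
  define S where "S = (\<Sum>(i, j)\<in>pairs n. wder i chi + wder j chi)"
  have sum_der: "(\<Sum>i<n. wder i chi) = wmono 0 (of_int N) * chi"
  proof -
    have "(\<Sum>i<n. wder i chi) = (\<Sum>b<d. wmono (wt b) (of_int (\<Sum>i<n. wt b i)))"
      unfolding wder_chi of_int_sum single_sum by (rule sum.swap)
    also have "\<dots> = (\<Sum>b<d. wmono (wt b) (of_int N))"
      by (intro sum.cong refl) (simp add: wt_total N_def)
    also have "\<dots> = wmono 0 (of_int N) * chi"
      unfolding chi_def sum_distrib_left mult_single add_0_left mult_1_right ..
    finally show ?thesis .
  qed
  have S: "S = of_nat n * (wmono 0 (of_int N) * chi) - wmono 0 (of_int N) * chi"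
    using sum_split_pairs[of "\<lambda>i j. wder i chi" n] unfolding S_def[symmetric]
    by (simp add: sum_distrib_left[symmetric] sum_der algebra_simps)
  \<comment> \<open>\<open>Q'\<close> is \<open>vdm n\<close> without the factor \<open>p\<close>, so no division is needed.\<close>
  define Q' where "Q' p = (\<Prod>q\<in>pairs n - {p}. wvar (fst q) - wvar (snd q))" for p
  have Q: "vdm n = (\<Prod>q\<in>pairs n. wvar (fst q) - wvar (snd q))"
    by (simp add: vdm_def case_prod_beta)
  have Q_split: "vdm n = (wvar (fst p) - wvar (snd p)) * Q' p" if "p \<in> pairs n" for p
    unfolding Q Q'_def using that by (intro prod.remove) auto
  have cross: "(\<Sum>k<n. wder k (vdm n) * wder k chi) =
      (\<Sum>p\<in>pairs n. Q' p * (wvar (fst p) * wder (fst p) chi - wvar (snd p) * wder (snd p) chi))"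
  proof -
    have "(\<Sum>k<n. wder k (vdm n) * wder k chi) =
        (\<Sum>k<n. \<Sum>p\<in>pairs n. Q' p * (wder k (wvar (fst p) - wvar (snd p)) * wder k chi))"
      unfolding Q wder_prod[OF finite_pairs] sum_distrib_right Q'_def
      by (intro sum.cong refl) (simp add: mult_ac)
    also have "\<dots> = (\<Sum>p\<in>pairs n. Q' p * (\<Sum>k<n. wder k (wvar (fst p) - wvar (snd p)) * wder k chi))"
      unfolding sum_distrib_left by (rule sum.swap)
    also have "\<dots> = (\<Sum>p\<in>pairs n. Q' p * (wvar (fst p) * wder (fst p) chi - wvar (snd p) * wder (snd p) chi))"
    proof (intro sum.cong refl arg_cong2[of _ _ _ _ "(*)"])
      fix p assume "p \<in> pairs n"
      then have p: "fst p < n" "snd p < n" by (auto simp: pairs_def)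
      have "(\<Sum>k<n. wder k (wvar (fst p) - wvar (snd p)) * wder k chi) =
          (\<Sum>k<n. (if k = fst p then wvar (fst p) * wder (fst p) chi else 0) -
             (if k = snd p then wvar (snd p) * wder (snd p) chi else 0))"
        by (intro sum.cong refl) (auto simp: wder_diff wder_wvar left_diff_distrib)
      then show "(\<Sum>k<n. wder k (wvar (fst p) - wvar (snd p)) * wder k chi) =
          wvar (fst p) * wder (fst p) chi - wvar (snd p) * wder (snd p) chi"
        using p by (simp add: sum_subtractf)
    qed
    finally show ?thesis .
  qed
  have pair: "Q' p * (wvar (fst p) * wder (fst p) chi - wvar (snd p) * wder (snd p) chi) +
      Q' p * (wvar (fst p) * wder (fst p) chi - wvar (snd p) * wder (snd p) chi) =
      vdm n * (case p of (i, j) \<Rightarrow> wder i chi + wder j chi) +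
      vdm n * (case p of (i, j) \<Rightarrow> tr_chi i j + tr_chi i j + wder i chi - wder j chi)"
    if "p \<in> pairs n" for p
  proof -
    obtain i j where p: "p = (i, j)" "i < j" "j < n" using \<open>p \<in> pairs n\<close> by (cases p) auto
    define x y a b t q where "x = wvar i" and "y = wvar j" and "a = wder i chi" and "b = wder j chi"
      and "t = tr_chi i j" and "q = Q' p"
    have t: "x * t = y * (t + a - b)"
      using wvar_tr_chi[of i j] p by (simp add: x_def y_def a_def b_def t_def)
    have "(x - y) * q * (a + b) + (x - y) * q * (t + t + a - b) =
        q * ((x * a - y * a) + (x * t - y * t) + ((x * a - y * a) + (x * t - y * t)))"
      by (simp add: algebra_simps)
    also have "\<dots> = q * (x * a - y * b) + q * (x * a - y * b)"
      unfolding t by (simp add: algebra_simps)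
    finally show ?thesis
      using Q_split[OF \<open>p \<in> pairs n\<close>] unfolding p by (simp add: x_def y_def a_def b_def t_def q_def p)
  qed
  let ?X = "\<Sum>k<n. wder k (vdm n) * wder k chi"
  have "?X + ?X = vdm n * S + vdm n * (wmono 0 c * chi - wlap n chi)"
  proof -
    have "?X + ?X = vdm n * S + vdm n * (\<Sum>(i, j)\<in>pairs n. tr_chi i j + tr_chi i j + wder i chi - wder j chi)"
      unfolding cross S_def sum_distrib_left sum.distrib[symmetric] by (intro sum.cong refl pair)
    moreover have "(\<Sum>(i, j)\<in>pairs n. tr_chi i j + tr_chi i j + wder i chi - wder j chi) =
        wmono 0 c * chi - wlap n chi"
      unfolding c[symmetric] by simp
    ultimately show ?thesis by simp
  qed
  moreover have "wlap n (vdm n * chi) = wlap n (vdm n) * chi + (?X + ?X) + vdm n * wlap n chi"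
    unfolding wlap_def wder_mult wder_add
    by (simp add: sum.distrib sum_distrib_left sum_distrib_right algebra_simps)
  ultimately have "wlap n (vdm n * chi) = of_int (\<Sum>k<n. stair n k ^ 2) * (vdm n * chi) +
      (of_nat n * (wmono 0 (of_int N) * (vdm n * chi)) - wmono 0 (of_int N) * (vdm n * chi))
      + wmono 0 c * (vdm n * chi)"
    unfolding wlap_vdm S by (simp add: algebra_simps del: of_int_sum)
  also have "\<dots> = (of_int (\<Sum>k<n. stair n k ^ 2) + of_nat n * wmono 0 (of_int N)
      - wmono 0 (of_int N) + wmono 0 c) * (vdm n * chi)"
    by (simp add: algebra_simps del: of_int_sum)
  also have "of_int (\<Sum>k<n. stair n k ^ 2) + of_nat n * wmono 0 (of_int N)
      - wmono 0 (of_int N) + wmono 0 c =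
      (wmono 0 (of_int (\<Sum>k<n. stair n k ^ 2) + of_nat n * of_int N - of_int N + c) :: weight_alg)"
  proof -
    have 1: "(of_int s :: weight_alg) = wmono 0 (of_int s)" for s by simp
    have 2: "(of_nat s :: weight_alg) = wmono 0 (of_nat s)" for s by simp
    show ?thesis unfolding 1 2 mult_single single_add single_diff by simp
  qed
  finally show thesis by (rule that)
qed

lemma vdm_chi: "vdm n * chi = (\<Sum>w\<in>perms n. \<Sum>b<d.
    wmono ((stair n \<circ> w) + wt b) (of_int (sign w)))"
  unfolding vdm_alt chi_def sum_product mult_single mult_1_right ..

text \<open>The coefficients of the product of Weyl denominator and character.\<close>

definition acoeff :: "(nat \<Rightarrow> int) \<Rightarrow> complex" where
  "acoeff \<nu> = wcoeff (vdm n * chi) \<nu>"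

lemma acoeff_alt: "acoeff \<nu> = (\<Sum>w\<in>perms n. of_int (sign w) * of_nat (mult (\<nu> - (stair n \<circ> w))))"
  unfolding acoeff_def vdm_chi lookup_sum
proof (rule sum.cong[OF refl])
  fix w
  have "(\<Sum>b<d. wcoeff (wmono ((stair n \<circ> w) + wt b) (of_int (sign w))) \<nu>) =
      (\<Sum>b<d. if wt b = \<nu> - (stair n \<circ> w) then of_int (sign w) else (0::complex))"
    by (intro sum.cong refl) (auto simp: lookup_single when_def)
  also have "\<dots> = of_int (sign w) * of_nat (card {b\<in>{..<d}. wt b = \<nu> - (stair n \<circ> w)})"
    by (simp add: sum.If_cases Int_def)
  finally show "(\<Sum>b<d. wcoeff (wmono ((stair n \<circ> w) + wt b) (of_int (sign w))) \<nu>) =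
      (of_int (sign w) :: complex) * of_nat (mult (\<nu> - (stair n \<circ> w)))"
    by (simp add: mult_def)
qed

lemma acoeff_nonzero:
  assumes "acoeff \<nu> \<noteq> 0"
  obtains w b where "w permutes {0..<n}" "b < d" "\<nu> = (stair n \<circ> w) + wt b"
proof -
  from assms obtain w where w: "w \<in> perms n"
    "of_int (sign w) * of_nat (mult (\<nu> - (stair n \<circ> w))) \<noteq> (0::complex)"
    unfolding acoeff_alt by (rule sum.not_neutral_contains_not_neutral)
  then have "{b. b < d \<and> wt b = \<nu> - (stair n \<circ> w)} \<noteq> {}" by (auto simp: mult_def)
  then obtain b where "b < d" "wt b = \<nu> - (stair n \<circ> w)" by auto
  then show thesis using that[of w b] w by simp
qed

lemma acoeff_permute:
  assumes s: "\<sigma> permutes {0..<n}"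
  shows "acoeff (\<nu> \<circ> \<sigma>) = of_int (sign \<sigma>) * acoeff \<nu>"
proof -
  have "acoeff (\<nu> \<circ> \<sigma>) = (\<Sum>w\<in>perms n. of_int (sign (w \<circ> \<sigma>)) * of_nat (mult ((\<nu> \<circ> \<sigma>) - (stair n \<circ> (w \<circ> \<sigma>)))))"
    unfolding acoeff_alt by (rule sum_permutations_compose_right[OF s])
  also have "\<dots> = (\<Sum>w\<in>perms n. of_int (sign \<sigma>) * (of_int (sign w) * of_nat (mult (\<nu> - (stair n \<circ> w)))))"
  proof (rule sum.cong[OF refl])
    fix w assume w: "w \<in> perms n"
    have "(\<nu> \<circ> \<sigma>) - (stair n \<circ> (w \<circ> \<sigma>)) = (\<nu> - (stair n \<circ> w)) \<circ> \<sigma>" by (auto simp: fun_eq_iff)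
    moreover have "sign (w \<circ> \<sigma>) = sign w * sign \<sigma>"
      using w s by (intro sign_compose permutation_permutes[THEN iffD2]) auto
    ultimately show "of_int (sign (w \<circ> \<sigma>)) * of_nat (mult ((\<nu> \<circ> \<sigma>) - (stair n \<circ> (w \<circ> \<sigma>)))) =
        of_int (sign \<sigma>) * (of_int (sign w) * (of_nat (mult (\<nu> - (stair n \<circ> w))) :: complex))"
      using mult_permute[OF s] by simp
  qed
  also have "\<dots> = of_int (sign \<sigma>) * acoeff \<nu>" unfolding acoeff_alt sum_distrib_left ..
  finally show ?thesis .
qed

text \<open>The shifted highest weight \<open>\<lambda> + \<rho>\<close>.\<close>

definition hwt :: "nat \<Rightarrow> int" where
  "hwt = stair n + wt b0"

lemma dominated:
  fixes y :: "nat \<Rightarrow> int"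
  assumes y: "\<And>i j. i < j \<Longrightarrow> j < n \<Longrightarrow> y j < y i" and w: "w permutes {0..<n}" and b: "b < d"
  shows "(w = id \<and> b = b0) \<or> (\<Sum>k<n. y k * ((stair n \<circ> w) + wt b) k) < (\<Sum>k<n. y k * hwt k)"
  using rearrangement_stair[where y = y, OF y w] wt_less[where y = y, OF b _ y]
  by (cases "w = id"; cases "b = b0") (auto simp: hwt_def distrib_left sum.distrib)

lemma stair_decreasing: "i < j \<Longrightarrow> j < n \<Longrightarrow> stair n j < stair n i"
  by (simp add: stair_def)

lemma acoeff_hwt: "acoeff hwt = 1"
proof -
  have "mult (hwt - (stair n \<circ> w)) = (if w = id then 1 else 0)" if w: "w permutes {0..<n}" for w
  proof -
    have "{b. b < d \<and> wt b = hwt - (stair n \<circ> w)} = (if w = id then {b0} else {})"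
    proof (intro Set.set_eqI iffI)
      fix b assume "b \<in> {b. b < d \<and> wt b = hwt - (stair n \<circ> w)}"
      then have b: "b < d" "(stair n \<circ> w) + wt b = hwt" by auto
      then show "b \<in> (if w = id then {b0} else {})"
        using dominated[where y = "stair n", OF stair_decreasing w b(1)] by auto
    next
      fix b assume "b \<in> (if w = id then {b0} else {})"
      then show "b \<in> {b. b < d \<and> wt b = hwt - (stair n \<circ> w)}"
        using b0 by (auto simp: hwt_def split: if_splits)
    qed
    then show ?thesis by (simp add: mult_def)
  qed
  then have "acoeff hwt = (\<Sum>w\<in>perms n. if w = id then 1 else 0)"
    unfolding acoeff_alt by (intro sum.cong refl) auto
  then show ?thesis using finite_permutations[of "{0..<n}"] permutes_id by simp
qed

text \<open>All weights that occur in the product have the same length, as it is an eigenvector of the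
Laplacian.\<close>

lemma acoeff_norm:
  assumes "acoeff \<nu> \<noteq> 0"
  shows "(\<Sum>k<n. \<nu> k ^ 2) = (\<Sum>k<n. hwt k ^ 2)"
proof -
  obtain K where K: "wlap n (vdm n * chi) = wmono 0 K * (vdm n * chi)"
    by (rule wlap_vdm_chi)
  have *: "of_int (\<Sum>k<n. \<nu> k ^ 2) = K" if "acoeff \<nu> \<noteq> 0" for \<nu>
    using arg_cong[OF K, of "\<lambda>f. wcoeff f \<nu>"] that
    unfolding lookup_wlap lookup_const_mult acoeff_def by (simp del: of_int_sum)
  have "of_int (\<Sum>k<n. \<nu> k ^ 2) = (of_int (\<Sum>k<n. hwt k ^ 2) :: complex)"
    using *[OF assms] *[of hwt] acoeff_hwt by simp
  then show ?thesis by (simp only: of_int_eq_iff)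
qed

end

text \<open>The highest weight is weakly decreasing, so \<open>hwt\<close> is strictly decreasing.\<close>

locale dominant_module = weight_module +
  assumes dominant: "\<And>i j. i < j \<Longrightarrow> j < n \<Longrightarrow> wt b0 j \<le> wt b0 i"
begin

lemma hwt_decreasing: "i < j \<Longrightarrow> j < n \<Longrightarrow> hwt j < hwt i"
  using dominant[of i j] stair_decreasing[of i j] by (simp add: hwt_def)

text \<open>For \<open>y = hwt + \<nu>\<close> the pairing of \<open>y\<close> with \<open>hwt - \<nu>\<close> is the difference of the squared lengths,
which is 0. By \<open>dominated\<close> this forces \<open>\<nu> = hwt\<close>.\<close>

lemma acoeff_decreasing:
  assumes nz: "acoeff \<nu> \<noteq> 0" and dec: "\<And>i j. i < j \<Longrightarrow> j < n \<Longrightarrow> \<nu> j < \<nu> i"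
  shows "\<nu> = hwt"
proof -
  obtain w b where wb: "w permutes {0..<n}" "b < d" "\<nu> = (stair n \<circ> w) + wt b"
    by (rule acoeff_nonzero[OF nz])
  have y: "(hwt + \<nu>) j < (hwt + \<nu>) i" if "i < j" "j < n" for i j
    using dec[OF that] hwt_decreasing[OF that] by simp
  have "(\<Sum>k<n. (hwt + \<nu>) k * hwt k) - (\<Sum>k<n. (hwt + \<nu>) k * \<nu> k) =
      (\<Sum>k<n. hwt k ^ 2) - (\<Sum>k<n. \<nu> k ^ 2)"
    unfolding sum_subtractf[symmetric] by (intro sum.cong refl) (simp add: algebra_simps power2_eq_square)
  then have "(\<Sum>k<n. (hwt + \<nu>) k * \<nu> k) = (\<Sum>k<n. (hwt + \<nu>) k * hwt k)"
    using acoeff_norm[OF nz] by simp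
  then have "w = id \<and> b = b0"
    using dominated[where y = "hwt + \<nu>", OF y wb(1,2)] unfolding wb(3)[symmetric] by auto
  then show ?thesis using wb(3) by (auto simp: hwt_def)
qed

lemma acoeff_orbit:
  assumes nz: "acoeff \<nu> \<noteq> 0"
  obtains \<tau> where "\<tau> permutes {0..<n}" "\<nu> = hwt \<circ> \<tau>"
proof -
  \<comment> \<open>An alternating function vanishes at weights with a repeated entry.\<close>
  have distinct: "\<nu> i \<noteq> \<nu> j" if "i < n" "j < n" "i \<noteq> j" for i j
  proof
    assume "\<nu> i = \<nu> j"
    then have "\<nu> \<circ> transpose i j = \<nu>" by (auto simp: transpose_def)
    moreover have "transpose i j permutes {0..<n}" using that by (intro permutes_swap_id) auto
    ultimately have "acoeff \<nu> = - acoeff \<nu>"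
      using acoeff_permute[of "transpose i j" \<nu>] that by (simp add: sign_swap_id)
    then show False using nz by simp
  qed
  obtain \<sigma> where \<sigma>: "\<sigma> permutes {0..<n}" "\<And>i j. i < j \<Longrightarrow> j < n \<Longrightarrow> \<nu> (\<sigma> j) \<le> \<nu> (\<sigma> i)"
    by (rule ex_sorting_permutation[where a = \<nu> and y = "stair n" and n = n]) (use stair_decreasing in auto)
  have "(\<nu> \<circ> \<sigma>) j < (\<nu> \<circ> \<sigma>) i" if ij: "i < j" "j < n" for i j
  proof -
    have "\<sigma> i < n" "\<sigma> j < n" using permutes_in_image[OF \<sigma>(1), of i] permutes_in_image[OF \<sigma>(1), of j] ij by auto
    moreover have "\<sigma> i \<noteq> \<sigma> j" using permutes_inj[OF \<sigma>(1)] ij by (metis injD less_irrefl)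
    ultimately show ?thesis using \<sigma>(2)[OF ij] distinct[of "\<sigma> i" "\<sigma> j"] by simp
  qed
  moreover have "acoeff (\<nu> \<circ> \<sigma>) \<noteq> 0"
    using nz acoeff_permute[OF \<sigma>(1)] by (simp add: sign_def)
  ultimately have "\<nu> \<circ> \<sigma> = hwt" by (intro acoeff_decreasing)
  then have "\<nu> = hwt \<circ> inv_into UNIV \<sigma>"
    using permutes_inv_o(1)[OF \<sigma>(1)] by (metis comp_assoc comp_id)
  then show thesis using that[of "inv_into UNIV \<sigma>"] permutes_inv[OF \<sigma>(1)] by blast
qed

theorem weyl_character:
  "vdm n * chi = (\<Sum>\<sigma>\<in>perms n. wmono (hwt \<circ> \<sigma>) (of_int (sign \<sigma>)))"
proof (rule poly_mapping_eqI)
  fix \<nu>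
  have inj: "\<sigma> = \<tau>" if st: "\<sigma> permutes {0..<n}" "\<tau> permutes {0..<n}" and eq: "hwt \<circ> \<sigma> = hwt \<circ> \<tau>" for \<sigma> \<tau>
  proof
    fix k
    show "\<sigma> k = \<tau> k"
    proof (cases "k < n")
      case True
      then have "\<sigma> k < n" "\<tau> k < n" using permutes_in_image[OF st(1), of k] permutes_in_image[OF st(2), of k] by auto
      then show ?thesis using hwt_decreasing[of "\<sigma> k" "\<tau> k"] hwt_decreasing[of "\<tau> k" "\<sigma> k"] fun_cong[OF eq, of k]
        by (cases "\<sigma> k" "\<tau> k" rule: linorder_cases) auto
    next
      case False
      then show ?thesis using permutes_not_in[OF st(1), of k] permutes_not_in[OF st(2), of k] by simp
    qed
  qed
  have rhs: "wcoeff (\<Sum>\<sigma>\<in>perms n. wmono (hwt \<circ> \<sigma>) (of_int (sign \<sigma>))) \<nu> =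
      (\<Sum>\<sigma>\<in>perms n. if hwt \<circ> \<sigma> = \<nu> then of_int (sign \<sigma>) else (0::complex))"
    unfolding lookup_sum by (intro sum.cong refl) (auto simp: lookup_single when_def)
  show "wcoeff (vdm n * chi) \<nu> =
      wcoeff (\<Sum>\<sigma>\<in>perms n. wmono (hwt \<circ> \<sigma>) (of_int (sign \<sigma>))) \<nu>"
  proof (cases "\<exists>\<tau>. \<tau> permutes {0..<n} \<and> \<nu> = hwt \<circ> \<tau>")
    case True
    then obtain \<tau> where \<tau>: "\<tau> permutes {0..<n}" "\<nu> = hwt \<circ> \<tau>" by blast
    have "(\<Sum>\<sigma>\<in>perms n. if hwt \<circ> \<sigma> = \<nu> then of_int (sign \<sigma>) else (0::complex)) =
        (\<Sum>\<sigma>\<in>perms n. if \<sigma> = \<tau> then of_int (sign \<tau>) else 0)"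
      using inj \<tau> by (intro sum.cong refl) auto
    also have "\<dots> = of_int (sign \<tau>)"
      using finite_permutations[of "{0..<n}"] \<tau>(1) by simp
    also have "\<dots> = acoeff \<nu>"
      unfolding \<tau>(2) acoeff_permute[OF \<tau>(1)] acoeff_hwt by simp
    finally show ?thesis unfolding rhs acoeff_def ..
  next
    case False
    then have "acoeff \<nu> = 0" using acoeff_orbit by metis
    moreover have "(\<Sum>\<sigma>\<in>perms n. if hwt \<circ> \<sigma> = \<nu> then of_int (sign \<sigma>) else (0::complex)) = 0"
      using False by (intro sum.neutral) auto
    ultimately show ?thesis unfolding rhs acoeff_def by simp
  qed
qed

end

section \<open>The Weyl dimension formula\<close>

lemma vandermonde_powr:
  fixes l :: "nat \<Rightarrow> int" and q :: real
  assumes q: "q > 0"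
  shows "(\<Sum>\<sigma>\<in>perms n. of_int (sign \<sigma>) * q powr of_int (\<Sum>k<n. stair n k * (l \<circ> \<sigma>) k)) =
    (\<Prod>(i, j)\<in>pairs n. q powr of_int (l i) - q powr of_int (l j))"
proof -
  define x where "x j = q powr of_int (l j)" for j
  define V where "V = mat n n (\<lambda>(i, j). x i ^ (n - 1 - j))"
  have V: "V \<in> carrier_mat n n" by (simp add: V_def)
  have "(\<Prod>(i, j)\<in>pairs n. x i - x j) = det (transpose_mat V)"
    unfolding det_transpose[OF V] unfolding V_def prod_pairs det_vandermonde ..
  also have "\<dots> = (\<Sum>\<sigma>\<in>perms n. of_int (sign \<sigma>) * (\<Prod>i = 0..<n. transpose_mat V $$ (i, \<sigma> i)))"
    by (rule det_def') (simp add: V_def)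
  also have "\<dots> = (\<Sum>\<sigma>\<in>perms n. of_int (sign \<sigma>) * q powr of_int (\<Sum>k<n. stair n k * (l \<circ> \<sigma>) k))"
  proof (rule sum.cong[OF refl])
    fix \<sigma> assume "\<sigma> \<in> perms n"
    then have lt: "\<sigma> i < n" if "i < n" for i using permutes_in_image[of \<sigma> "{0..<n}" i] that by simp
    have "(\<Prod>i = 0..<n. transpose_mat V $$ (i, \<sigma> i)) = (\<Prod>i<n. q powr of_int (stair n i * (l \<circ> \<sigma>) i))"
      unfolding atLeast0LessThan
    proof (rule prod.cong[OF refl])
      fix i assume "i \<in> {..<n}"
      then have i: "i < n" by simp
      have "q powr of_int (stair n i * (l \<circ> \<sigma>) i) = x (\<sigma> i) powr real (n - 1 - i)"
        using q i by (simp add: x_def powr_powr stair_def mult.commute)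
      also have "\<dots> = x (\<sigma> i) ^ (n - 1 - i)"
        using q by (intro powr_realpow) (simp add: x_def)
      finally show "transpose_mat V $$ (i, \<sigma> i) = q powr of_int (stair n i * (l \<circ> \<sigma>) i)"
        using i lt[OF i] by (simp add: V_def)
    qed
    also have "\<dots> = q powr of_int (\<Sum>k<n. stair n k * (l \<circ> \<sigma>) k)"
      unfolding of_int_sum using q by (subst powr_sum) auto
    finally show "of_int (sign \<sigma>) * (\<Prod>i = 0..<n. transpose_mat V $$ (i, \<sigma> i)) =
        of_int (sign \<sigma>) * q powr of_int (\<Sum>k<n. stair n k * (l \<circ> \<sigma>) k)" by simp
  qed
  finally show ?thesis by (simp add: x_def)
qed

lemma tendsto_powr_diff_quotient:
  "((\<lambda>q. (q powr a - q powr b) / (q - 1)) \<longlongrightarrow> a - b) (at (1::real))"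
proof -
  have "((\<lambda>q. q powr a - q powr b) has_real_derivative (a * 1 powr (a - 1) - b * 1 powr (b - 1))) (at 1)"
    by (intro DERIV_diff has_real_derivative_powr) auto
  then have "((\<lambda>q. q powr a - q powr b) has_real_derivative (a - b)) (at 1)" by simp
  then show ?thesis unfolding has_field_derivative_iff by simp
qed

context dominant_module
begin

lemma weyl_character_eval:
  fixes q :: real
  assumes q: "q > 0"
  shows "(\<Prod>(i, j)\<in>pairs n. q powr of_int (stair n i) - q powr of_int (stair n j)) *
      (\<Sum>b<d. q powr of_int (\<Sum>k<n. stair n k * wt b k)) =
    (\<Prod>(i, j)\<in>pairs n. q powr of_int (hwt i) - q powr of_int (hwt j))"
proof -
  define e where "e \<kappa> = q powr of_int (\<Sum>k<n. stair n k * \<kappa> k)" for \<kappa> :: "nat \<Rightarrow> int"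
  have e_add: "e (\<kappa> + \<kappa>') = e \<kappa> * e \<kappa>'" for \<kappa> \<kappa>'
    using q by (simp add: e_def distrib_left sum.distrib powr_add)
  let ?h = "\<lambda>\<kappa>. complex_of_real (e \<kappa>)"
  have "weval ?h (vdm n * chi) = (\<Sum>w\<in>perms n. \<Sum>b<d. of_int (sign w) * ?h ((stair n \<circ> w) + wt b))"
    unfolding vdm_chi weval_sum weval_single ..
  also have "\<dots> = of_real ((\<Sum>w\<in>perms n. of_int (sign w) * e (stair n \<circ> w)) * (\<Sum>b<d. e (wt b)))"
    unfolding sum_product e_add by (simp add: mult.assoc)
  finally have "of_real ((\<Sum>w\<in>perms n. of_int (sign w) * e (stair n \<circ> w)) * (\<Sum>b<d. e (wt b))) =
      weval ?h (\<Sum>\<sigma>\<in>perms n. wmono (hwt \<circ> \<sigma>) (of_int (sign \<sigma>)))"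
    by (simp only: weyl_character)
  also have "\<dots> = of_real (\<Sum>\<sigma>\<in>perms n. of_int (sign \<sigma>) * e (hwt \<circ> \<sigma>))"
    unfolding weval_sum weval_single by simp
  finally have "(\<Sum>w\<in>perms n. of_int (sign w) * e (stair n \<circ> w)) * (\<Sum>b<d. e (wt b)) =
      (\<Sum>\<sigma>\<in>perms n. of_int (sign \<sigma>) * e (hwt \<circ> \<sigma>))"
    by (simp only: of_real_eq_iff)
  then show ?thesis
    unfolding e_def vandermonde_powr[OF q] .
qed

theorem weyl_dimension:
  "real d * (\<Prod>(i, j)\<in>pairs n. of_int (stair n i) - of_int (stair n j)) =
    (\<Prod>(i, j)\<in>pairs n. of_int (hwt i) - of_int (hwt j))"
proof -
  \<comment> \<open>Both sides are divided by the same power of \<open>q - 1\<close> before \<open>q\<close> tends to 1.\<close>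
  define r where "r l q = (\<Prod>(i, j)\<in>pairs n. (q powr of_int (l i) - q powr of_int (l j)) / (q - 1))"
    for l :: "nat \<Rightarrow> int" and q :: real
  have r_lim: "(r l \<longlongrightarrow> (\<Prod>(i, j)\<in>pairs n. of_int (l i) - of_int (l j))) (at 1)" for l
    unfolding r_def case_prod_beta by (intro tendsto_prod tendsto_powr_diff_quotient)
  have r_div: "r l q = (\<Prod>(i, j)\<in>pairs n. q powr of_int (l i) - q powr of_int (l j)) / (\<Prod>(i, j)\<in>pairs n. q - 1)" for l q
    unfolding r_def case_prod_beta by (rule prod_dividef)
  have ev: "r (stair n) q * (\<Sum>b<d. q powr of_int (\<Sum>k<n. stair n k * wt b k)) = r hwt q" if "q > 0" for q
    unfolding r_div weyl_character_eval[OF that, symmetric] by simp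
  have "((\<lambda>q::real. \<Sum>b<d. q powr of_int (\<Sum>k<n. stair n k * wt b k)) \<longlongrightarrow> (\<Sum>b<d. 1 powr of_int (\<Sum>k<n. stair n k * wt b k))) (at 1)"
    by (intro tendsto_intros) auto
  then have "((\<lambda>q. r (stair n) q * (\<Sum>b<d. q powr of_int (\<Sum>k<n. stair n k * wt b k))) \<longlongrightarrow>
      (\<Prod>(i, j)\<in>pairs n. of_int (stair n i) - of_int (stair n j)) * real d) (at 1)"
    using tendsto_mult[OF r_lim[of "stair n"]] by simp
  moreover have "\<forall>\<^sub>F q in at (1::real). r (stair n) q * (\<Sum>b<d. q powr of_int (\<Sum>k<n. stair n k * wt b k)) = r hwt q"
  proof -
    have "\<forall>\<^sub>F q in at (1::real). q > 0"
      by (rule order_tendstoD(1)[OF tendsto_ident_at]) simp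
    then show ?thesis by eventually_elim (rule ev)
  qed
  ultimately have "(r hwt \<longlongrightarrow> (\<Prod>(i, j)\<in>pairs n. of_int (stair n i) - of_int (stair n j)) * real d) (at 1)"
    by (rule Lim_transform_eventually)
  from tendsto_unique[OF _ this r_lim[of hwt]] show ?thesis by (simp add: mult.commute)
qed

end

theorem dimension_formula:
  assumes simple: "simple_gl_module n d \<rho>" and hwt: "has_highest_weight n d \<rho> p" and p: "is_partition p"
  shows "int d * (\<Prod>(i, j)\<in>pairs n. int j - int i) =
    (\<Prod>(i, j)\<in>pairs n. int (part p i) - int (part p j) + (int j - int i))"
proof -
  obtain R wt b0 where wm: "weight_module n d R wt b0" and wt: "\<And>i. i < n \<Longrightarrow> wt b0 i = int (part p i)"
    using simple_weight_module[OF simple hwt] by blast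
  interpret dominant_module n d R wt b0
  proof (intro dominant_module.intro wm dominant_module_axioms.intro)
    fix i j assume "i < j" "j < n"
    then show "wt b0 j \<le> wt b0 i"
      using wt partition_nth_mono[OF p, of i j] by (simp add: part_def)
  qed
  have st: "stair n i - stair n j = int j - int i" if "i < j" "j < n" for i j
    using that by (simp add: stair_def of_nat_diff)
  have hw: "hwt i - hwt j = int (part p i) - int (part p j) + (int j - int i)" if "i < j" "j < n" for i j
    using st[OF that] wt[of i] wt[of j] that by (simp add: hwt_def)
  have "real_of_int (int d * (\<Prod>(i, j)\<in>pairs n. stair n i - stair n j)) =
      real_of_int (\<Prod>(i, j)\<in>pairs n. hwt i - hwt j)"
    using weyl_dimension by (simp add: case_prod_beta)
  then have "int d * (\<Prod>(i, j)\<in>pairs n. stair n i - stair n j) = (\<Prod>(i, j)\<in>pairs n. hwt i - hwt j)"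
    by (simp only: of_int_eq_iff)
  moreover have "(\<Prod>(i, j)\<in>pairs n. stair n i - stair n j) = (\<Prod>(i, j)\<in>pairs n. int j - int i)"
    by (intro prod.cong) (auto simp: st)
  moreover have "(\<Prod>(i, j)\<in>pairs n. hwt i - hwt j) =
      (\<Prod>(i, j)\<in>pairs n. int (part p i) - int (part p j) + (int j - int i))"
    by (intro prod.cong) (auto simp: hw)
  ultimately show ?thesis by simp
qed

lemma prod_pairs_diff_pos: "(\<Prod>(i, j)\<in>pairs n. int j - int i) > 0"
  by (rule prod_pos) auto

text \<open>Existence and the dimension formula together identify the dimension that \<open>dim_F\<close> picks.\<close>

theorem dim_F_formula:
  assumes p: "is_partition p" and n: "length p \<le> n"
  shows "int (dim_F n p) * (\<Prod>(i, j)\<in>pairs n. int j - int i) =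
    (\<Prod>(i, j)\<in>pairs n. int (part p i) - int (part p j) + (int j - int i))"
proof -
  have "part p j \<le> part p i" if "i \<le> j" for i j
    using partition_nth_mono[OF p that] that by (simp add: part_def)
  then obtain d \<rho> where d: "simple_gl_module n d \<rho>" "has_highest_weight n d \<rho> p"
    using simple_gl_module_exists[of n p] by blast
  have "d' = d" if "simple_gl_module n d' \<rho>'" "has_highest_weight n d' \<rho>' p" for d' \<rho>'
  proof -
    have "int d' * (\<Prod>(i, j)\<in>pairs n. int j - int i) = int d * (\<Prod>(i, j)\<in>pairs n. int j - int i)"
      unfolding dimension_formula[OF that p] dimension_formula[OF d p] ..
    moreover have "(\<Prod>(i, j)\<in>pairs n. int j - int i) \<noteq> 0"
      using prod_pairs_diff_pos[of n] by linarith
    ultimately have "int d' = int d" by (simp only: mult_right_cancel not_False_eq_True)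
    then show ?thesis by simp
  qed
  then have "(THE d. \<exists>\<rho>. simple_gl_module n d \<rho> \<and> has_highest_weight n d \<rho> p) = d"
    using d by (intro the_equality) blast+
  then have "dim_F n p = d" using n by (simp add: dim_F_def)
  then show ?thesis using dimension_formula[OF d p] by simp
qed

section \<open>The hook-content formula\<close>

text \<open>The hook length of a box \<open>x\<close> in a set \<open>Y\<close> of boxes.\<close>

definition hook :: "(nat \<times> nat) set \<Rightarrow> nat \<times> nat \<Rightarrow> nat" where
  "hook Y x = card {j. snd x < j \<and> (fst x, j) \<in> Y} + card {i. fst x < i \<and> (i, snd x) \<in> Y} + 1"

text \<open>The diagram with \<open>n\<close> rows of the lengths \<open>l 0, \<dots>, l (n - 1)\<close>.\<close>

definition shape :: "(nat \<Rightarrow> nat) \<Rightarrow> nat \<Rightarrow> (nat \<times> nat) set" where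
  "shape l n = (SIGMA i:{..<n}. {..<l i})"

lemma shape_iff [simp]: "(i, j) \<in> shape l n \<longleftrightarrow> i < n \<and> j < l i"
  by (auto simp: shape_def)

lemma prod_shape: "(\<Prod>x\<in>shape l n. f x) = (\<Prod>i<n. \<Prod>j<l i. f (i, j))"
  unfolding shape_def by (subst prod.Sigma) auto

lemma pairs_Suc: "pairs (Suc n) = pairs n \<union> (\<lambda>i. (i, n)) ` {..<n}"
  by (auto simp: pairs_def image_iff)

lemma prod_pairs_Suc: "(\<Prod>(i, j)\<in>pairs (Suc n). f i j) = (\<Prod>(i, j)\<in>pairs n. f i j) * (\<Prod>i<n. f i n)"
  unfolding pairs_Suc
  by (subst prod.union_disjoint) (auto simp: pairs_def prod.reindex inj_on_def)

text \<open>The induction deletes an empty last row or, if there is none, the first column, whose hook lengths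
are the numbers \<open>l i + (n - 1 - i)\<close>.\<close>

lemma hook_prod_shape:
  assumes "\<And>i j. i \<le> j \<Longrightarrow> j < n \<Longrightarrow> l j \<le> l i"
  shows "int (\<Prod>x\<in>shape l n. hook (shape l n) x) *
      (\<Prod>(i, j)\<in>pairs n. int (l i) - int (l j) + (int j - int i)) =
    (\<Prod>i<n. fact (l i + (n - 1 - i)))"
  using assms
proof (induction "n + sum l {..<n}" arbitrary: n l rule: less_induct)
  case less
  show ?case
  proof (cases n)
    case 0
    then show ?thesis by (simp add: shape_def pairs_def)
  next
    case (Suc k)
    show ?thesis
    proof (cases "l k = 0")
      case True
      have sh: "shape l n = shape l k"
        using True Suc by (auto simp: less_Suc_eq)
      have IH: "int (\<Prod>x\<in>shape l k. hook (shape l k) x) *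
          (\<Prod>(i, j)\<in>pairs k. int (l i) - int (l j) + (int j - int i)) =
          (\<Prod>i<k. fact (l i + (k - 1 - i)))"
        by (rule less.hyps) (use less.prems Suc in auto)
      have "(\<Prod>i<n. fact (l i + (n - 1 - i)) :: int) = (\<Prod>i<k. fact (l i + (k - i)))"
        unfolding Suc by (simp add: True)
      also have "\<dots> = (\<Prod>i<k. fact (l i + (k - 1 - i)) * (int (l i) - int (l k) + (int k - int i)))"
      proof (rule prod.cong[OF refl])
        fix i assume "i \<in> {..<k}"
        then have "l i + (k - i) = Suc (l i + (k - 1 - i))" "int (l i + (k - i)) = int (l i) + (int k - int i)" by auto
        then show "fact (l i + (k - i)) = fact (l i + (k - 1 - i)) * (int (l i) - int (l k) + (int k - int i))"
          using fact_Suc[of "l i + (k - 1 - i)", where 'a = int] True by simp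
      qed
      also have "\<dots> = int (\<Prod>x\<in>shape l k. hook (shape l k) x) *
          ((\<Prod>(i, j)\<in>pairs k. int (l i) - int (l j) + (int j - int i)) *
           (\<Prod>i<k. int (l i) - int (l k) + (int k - int i)))"
        unfolding prod.distrib IH[symmetric] by (simp only: mult.assoc)
      finally show ?thesis unfolding sh unfolding Suc prod_pairs_Suc by (rule sym)
    next
      case False
      define l' where "l' i = l i - 1" for i
      have pos: "0 < l i" if "i < n" for i using less.prems[of i k] that False Suc by simp
      have lt: "sum l' {..<n} < sum l {..<n}"
        using pos Suc by (intro sum_strict_mono) (auto simp: l'_def)
      have IH: "int (\<Prod>x\<in>shape l' n. hook (shape l' n) x) *
          (\<Prod>(i, j)\<in>pairs n. int (l' i) - int (l' j) + (int j - int i)) =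
          (\<Prod>i<n. fact (l' i + (n - 1 - i)))"
        using lt less.prems by (intro less.hyps) (auto simp: l'_def diff_le_mono)
      have hook0: "hook (shape l n) (i, 0) = l i + (n - 1 - i)" if i: "i < n" for i
      proof -
        have "{j. 0 < j \<and> (i, j) \<in> shape l n} = {0<..<l i}" using i by auto
        moreover have "{i'. i < i' \<and> (i', 0) \<in> shape l n} = {i<..<n}" using pos by auto
        ultimately show ?thesis using pos[OF i] i by (simp add: hook_def)
      qed
      have hookS: "hook (shape l n) (i, Suc j) = hook (shape l' n) (i, j)" for i j
      proof -
        have "{j'. Suc j < j' \<and> (i, j') \<in> shape l n} = Suc ` {j'. j < j' \<and> (i, j') \<in> shape l' n}"
          by (auto simp: l'_def image_iff less_diff_conv Suc_less_eq2)
        moreover have "{i'. i < i' \<and> (i', Suc j) \<in> shape l n} = {i'. i < i' \<and> (i', j) \<in> shape l' n}"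
          by (auto simp: l'_def less_diff_conv)
        ultimately show ?thesis by (simp add: hook_def card_image)
      qed
      have row: "(\<Prod>j<l i. hook (shape l n) (i, j)) = (l i + (n - 1 - i)) * (\<Prod>j<l' i. hook (shape l' n) (i, j))"
        if i: "i < n" for i
      proof -
        have "l i = Suc (l' i)" using pos[OF i] by (simp add: l'_def)
        then show ?thesis
          using hook0[OF i] by (simp add: prod.lessThan_Suc_shift hookS del: prod.lessThan_Suc)
      qed
      have H: "(\<Prod>x\<in>shape l n. hook (shape l n) x) =
          (\<Prod>i<n. l i + (n - 1 - i)) * (\<Prod>x\<in>shape l' n. hook (shape l' n) x)"
        unfolding prod_shape prod.distrib[symmetric] by (intro prod.cong refl row) auto
      have V: "(\<Prod>(i, j)\<in>pairs n. int (l i) - int (l j) + (int j - int i)) =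
          (\<Prod>(i, j)\<in>pairs n. int (l' i) - int (l' j) + (int j - int i))"
      proof (rule prod.cong[OF refl])
        fix x assume x: "x \<in> pairs n"
        obtain i j where ij: "x = (i, j)" "i < n" "j < n" using x by (cases x) auto
        show "(case x of (i, j) \<Rightarrow> int (l i) - int (l j) + (int j - int i)) =
            (case x of (i, j) \<Rightarrow> int (l' i) - int (l' j) + (int j - int i))"
          using pos[OF ij(2)] pos[OF ij(3)] by (simp add: ij l'_def of_nat_diff)
      qed
      have F: "fact (l i + (n - 1 - i)) = int (l i + (n - 1 - i)) * fact (l' i + (n - 1 - i))" if "i < n" for i
      proof -
        have "l i + (n - 1 - i) = Suc (l' i + (n - 1 - i))" using pos[OF that] by (simp add: l'_def)
        then show ?thesis by (simp only: fact_Suc)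
      qed
      have "(\<Prod>i<n. fact (l i + (n - 1 - i))) = (\<Prod>i<n. int (l i + (n - 1 - i)) * fact (l' i + (n - 1 - i)))"
        by (intro prod.cong refl F) auto
      also have "\<dots> = int (\<Prod>i<n. l i + (n - 1 - i)) * (\<Prod>i<n. fact (l' i + (n - 1 - i)))"
        unfolding prod.distrib of_nat_prod ..
      finally show ?thesis unfolding H V of_nat_mult IH[symmetric] by (simp only: mult.assoc)
    qed
  qed
qed

lemma content_prod_shape:
  "(\<Prod>x\<in>shape l n. int n + int (snd x) - int (fst x)) * (\<Prod>i<n. fact (n - 1 - i)) =
    (\<Prod>i<n. fact (l i + (n - 1 - i)))"
proof -
  have "(\<Prod>j<t. int n + int j - int i) * fact (n - 1 - i) = fact (t + (n - 1 - i))" if "i < n" for i t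
  proof (induction t)
    case (Suc t)
    have "Suc t + (n - 1 - i) = Suc (t + (n - 1 - i))" by simp
    then have "fact (Suc t + (n - 1 - i)) = int (Suc (t + (n - 1 - i))) * fact (t + (n - 1 - i))"
      by (simp only: fact_Suc)
    also have "int (Suc (t + (n - 1 - i))) = int n + int t - int i" using that by simp
    finally show ?case unfolding Suc.IH[symmetric] prod.lessThan_Suc by (simp only: mult_ac)
  qed simp
  then show ?thesis
    unfolding prod_shape prod.distrib[symmetric] by (intro prod.cong) auto
qed

lemma prod_pairs_diff: "(\<Prod>(i, j)\<in>pairs n. int j - int i) = (\<Prod>i<n. fact (n - 1 - i))"
  unfolding prod_pairs
proof (rule prod.cong[OF refl])
  fix i assume "i \<in> {..<n}"
  have "(\<Prod>j\<in>{i<..<n}. int j - int i) = (\<Prod>t\<in>{1..n - 1 - i}. int t)"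
    by (rule prod.reindex_bij_witness[of _ "\<lambda>t. t + i" "\<lambda>j. j - i"]) (use \<open>i \<in> {..<n}\<close> in auto)
  then show "(\<Prod>j\<in>{i<..<n}. int j - int i) = fact (n - 1 - i)"
    by (simp add: fact_prod)
qed

text \<open>Appending empty rows does not change the diagram.\<close>

lemma young_diagram_shape: "length p \<le> n \<Longrightarrow> young_diagram p = shape (part p) n"
  by (auto simp: young_diagram_def part_def split: if_splits)

lemma finite_young_diagram: "finite (young_diagram p)"
  by (auto simp: young_diagram_shape[OF order_refl] shape_def)

text \<open>The content of a box, column minus row.\<close>

definition content :: "nat \<times> nat \<Rightarrow> int" where
  "content x = int (snd x) - int (fst x)"

theorem hook_content_formula:
  assumes p: "is_partition p"
  shows "int (dim_F n p) * int (\<Prod>x\<in>young_diagram p. hook (young_diagram p) x) =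
    (\<Prod>x\<in>young_diagram p. int n + content x)"
proof (cases "length p \<le> n")
  case True
  let ?Y = "young_diagram p"
  let ?D = "\<Prod>(i, j)\<in>pairs n. int j - int i"
  have Y: "?Y = shape (part p) n" by (rule young_diagram_shape[OF True])
  have mono: "part p j \<le> part p i" if "i \<le> j" for i j
    using partition_nth_mono[OF p that] that by (auto simp: part_def)
  have "(int (dim_F n p) * int (\<Prod>x\<in>?Y. hook ?Y x)) * ?D =
      int (\<Prod>x\<in>?Y. hook ?Y x) * (int (dim_F n p) * ?D)"
    by (simp only: mult_ac)
  also have "\<dots> = (\<Prod>i<n. fact (part p i + (n - 1 - i)))"
    unfolding dim_F_formula[OF p True] unfolding Y by (rule hook_prod_shape) (rule mono)
  also have "\<dots> = (\<Prod>x\<in>?Y. int n + content x) * ?D"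
    unfolding content_prod_shape[symmetric] prod_pairs_diff Y content_def by (simp only: add_diff_eq)
  finally show ?thesis
    using prod_pairs_diff_pos[of n] by (metis less_irrefl mult_right_cancel)
next
  case False
  then have "p ! n \<noteq> 0" using p by (auto simp: is_partition_def in_set_conv_nth)
  then have "(n, 0) \<in> young_diagram p" using False by (simp add: young_diagram_def)
  moreover have "int n + content (n, 0) = 0" by (simp add: content_def)
  ultimately have "(\<Prod>x\<in>young_diagram p. int n + content x) = 0"
    using finite_young_diagram by (intro prod_zero) auto
  then show ?thesis using False by (simp add: dim_F_def)
qed

lemma hook_pos: "hook Y x > 0"
  by (simp add: hook_def)

lemma hook_converse: "hook (Y\<inverse>) x = hook Y (prod.swap x)"
  by (simp add: hook_def)

lemma prod_converse: "(\<Prod>x\<in>Y\<inverse>. f x) = (\<Prod>x\<in>Y. f (prod.swap x))"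
  by (rule prod.reindex_bij_witness[of _ prod.swap prod.swap]) auto

lemma dim_F_eq_iff:
  assumes p: "is_partition p"
  shows "dim_F n p = dim_F (n + m) (conjugate_partition p) \<longleftrightarrow>
    (\<Prod>x\<in>young_diagram p. int n + content x) = (\<Prod>x\<in>young_diagram p. int n + (int m - content x))"
proof -
  let ?Y = "young_diagram p"
  define H where "H = (\<Prod>x\<in>?Y. hook ?Y x)"
  have H: "H > 0" unfolding H_def by (intro prod_pos hook_pos)
  have 1: "int (dim_F n p) * int H = (\<Prod>x\<in>?Y. int n + content x)"
    unfolding H_def by (rule hook_content_formula[OF p])
  have "int (dim_F (n + m) (conjugate_partition p)) * int H = (\<Prod>x\<in>?Y. int (n + m) + content (prod.swap x))"
    using hook_content_formula[OF is_partition_conjugate_partition[OF p], of "n + m"]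
    unfolding young_diagram_conjugate_partition[OF p] prod_converse hook_converse H_def
    by simp
  also have "\<dots> = (\<Prod>x\<in>?Y. int n + (int m - content x))"
    by (intro prod.cong) (auto simp: content_def)
  finally show ?thesis unfolding 1[symmetric] using H by (metis mult_right_cancel of_nat_eq_iff less_irrefl of_nat_0)
qed

section \<open>Contents and Frobenius coordinates\<close>

lemma order_prod_linear:
  fixes f :: "'b \<Rightarrow> 'a::field"
  assumes "finite A"
  shows "order a (\<Prod>x\<in>A. [:- f x, 1:]) = card {x \<in> A. f x = a}"
  using assms
proof (induction A rule: finite_induct)
  case (insert y A)
  have ord: "order a [:- f y, 1:] = (if f y = a then 1 else 0)"
    using order_power_n_n[of a 1] by (auto intro!: order_0I)
  have "{x \<in> insert y A. f x = a} = (if f y = a then insert y {x \<in> A. f x = a} else {x \<in> A. f x = a})"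
    by auto
  moreover have "(\<Prod>x\<in>insert y A. [:- f x, 1:]) \<noteq> 0"
    using insert.hyps(1) by (subst prod_zero_iff) auto
  then have "[:- f y, 1:] * (\<Prod>x\<in>A. [:- f x, 1:]) \<noteq> 0"
    unfolding prod.insert[OF insert.hyps] .
  then have "order a (\<Prod>x\<in>insert y A. [:- f x, 1:]) =
      order a [:- f y, 1:] + order a (\<Prod>x\<in>A. [:- f x, 1:])"
    unfolding prod.insert[OF insert.hyps] by (rule order_mult)
  ultimately show ?case using insert by (simp only: ord) simp
qed (simp add: order_1_eq_0)

lemma prod_by_fibres:
  assumes "finite A" "finite C" "f ` A \<subseteq> C"
  shows "(\<Prod>x\<in>A. h (f x)) = (\<Prod>c\<in>C. h c ^ card {x \<in> A. f x = c} :: 'a::comm_monoid_mult)"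
proof -
  have "(\<Prod>x\<in>A. h (f x)) = (\<Prod>c\<in>C. \<Prod>x\<in>{x \<in> A. f x = c}. h (f x))"
    by (rule prod.group[symmetric]) (use assms in auto)
  then show ?thesis by simp
qed

text \<open>The two products are the values at \<open>n\<close> of polynomials in \<open>n\<close>. If they agree for all \<open>n\<close>, the
polynomials have the same roots with the same multiplicities.\<close>

lemma prods_eq_iff:
  fixes f g :: "'b \<Rightarrow> int"
  assumes A: "finite A"
  shows "(\<forall>n::nat. (\<Prod>x\<in>A. int n + f x) = (\<Prod>x\<in>A. int n + g x)) \<longleftrightarrow>
    (\<forall>c. card {x \<in> A. f x = c} = card {x \<in> A. g x = c})"
proof (intro iffI allI)
  fix c assume eq: "\<forall>n::nat. (\<Prod>x\<in>A. int n + f x) = (\<Prod>x\<in>A. int n + g x)"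
  define P where "P h = (\<Prod>x\<in>A. [:- (- real_of_int (h x)), 1:])" for h :: "'b \<Rightarrow> int"
  have poly_P: "poly (P h) (real n) = of_int (\<Prod>x\<in>A. int n + h x)" for h n
    by (simp add: P_def poly_prod add.commute)
  have "P f = P g"
  proof (rule ccontr)
    assume "P f \<noteq> P g"
    then have "finite {x. poly (P f - P g) x = 0}" by (intro poly_roots_finite) simp
    moreover have "range real \<subseteq> {x. poly (P f - P g) x = 0}"
      using eq by (auto simp: poly_P simp del: of_int_prod)
    ultimately have "finite (range real)" by (rule finite_subset[rotated])
    then show False using finite_imageD[of real UNIV] by (simp add: inj_on_def)
  qed
  then have "order (- of_int c) (P f) = order (- of_int c) (P g)" by simp
  then show "card {x \<in> A. f x = c} = card {x \<in> A. g x = c}"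
    unfolding P_def order_prod_linear[OF A] by simp
next
  fix n :: nat assume eq: "\<forall>c. card {x \<in> A. f x = c} = card {x \<in> A. g x = c}"
  show "(\<Prod>x\<in>A. int n + f x) = (\<Prod>x\<in>A. int n + g x)"
    using prod_by_fibres[of A "f ` A \<union> g ` A" f "\<lambda>c. int n + c"]
      prod_by_fibres[of A "f ` A \<union> g ` A" g "\<lambda>c. int n + c"] A eq by simp
qed

lemma down_closed_card:
  fixes S :: "nat set"
  assumes "finite S" "\<And>i j. j \<in> S \<Longrightarrow> i \<le> j \<Longrightarrow> i \<in> S"
  shows "S = {..<card S}"
proof (cases "S = {}")
  case False
  define M where "M = Max S"
  have "M \<in> S" "\<And>i. i \<in> S \<Longrightarrow> i \<le> M"
    unfolding M_def using Max_in[OF assms(1) False] Max_ge[OF assms(1)] by auto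
  then have S: "S = {..<Suc M}" using assms(2)[of M] by (auto simp: less_Suc_eq_le)
  show ?thesis unfolding S by simp
qed simp

text \<open>Finite sets of boxes closed under moving up and to the left. Unlike lists of parts, they are
stable under transposition by definition.\<close>

definition diagram :: "(nat \<times> nat) set \<Rightarrow> bool" where
  "diagram Y \<longleftrightarrow> finite Y \<and> (\<forall>i j i' j'. (i, j) \<in> Y \<longrightarrow> i' \<le> i \<longrightarrow> j' \<le> j \<longrightarrow> (i', j') \<in> Y)"

text \<open>The number of boxes in row \<open>i\<close> to the right of the diagonal, provided that \<open>(i, i)\<close> lies in
\<open>Y\<close>: a Frobenius coordinate. For the converse of \<open>Y\<close> it is the number of boxes below the diagonal.\<close>

definition arm :: "(nat \<times> nat) set \<Rightarrow> nat \<Rightarrow> nat" where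
  "arm Y i = card {j. i < j \<and> (i, j) \<in> Y}"

lemma diagram_converse: "diagram Y \<Longrightarrow> diagram (Y\<inverse>)"
  unfolding diagram_def by auto

lemma diagram_young_diagram:
  assumes "is_partition p"
  shows "diagram (young_diagram p)"
  unfolding diagram_def using finite_young_diagram
  using partition_nth_mono[OF assms] by (fastforce simp: young_diagram_def)

lemma diagram_down: "diagram Y \<Longrightarrow> (i, j) \<in> Y \<Longrightarrow> i' \<le> i \<Longrightarrow> j' \<le> j \<Longrightarrow> (i', j') \<in> Y"
  unfolding diagram_def by blast

lemma diagonal_iff:
  assumes Y: "diagram Y"
  shows "i < card {i. (i, i) \<in> Y} \<longleftrightarrow> (i, i) \<in> Y"
proof -
  have "finite ((\<lambda>i. (i, i)) -` Y)" using Y by (intro finite_vimageI) (auto simp: diagram_def inj_on_def)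
  then have "{i. (i, i) \<in> Y} = {..<card {i. (i, i) \<in> Y}}"
    using diagram_down[OF Y] by (intro down_closed_card) (auto simp: vimage_def)
  then show ?thesis by blast
qed

lemma arm_iff:
  assumes Y: "diagram Y" and i: "(i, i) \<in> Y"
  shows "(i, i + c) \<in> Y \<longleftrightarrow> c \<le> arm Y i"
proof (cases c)
  case 0
  then show ?thesis using i by simp
next
  case (Suc t)
  define S where "S = {t. (i, i + Suc t) \<in> Y}"
  have fin: "finite ((\<lambda>t. (i, i + Suc t)) -` Y)"
    using Y by (intro finite_vimageI) (auto simp: diagram_def inj_on_def)
  have S: "S = {..<card S}"
    using fin diagram_down[OF Y] unfolding S_def by (intro down_closed_card) (auto simp: vimage_def)
  have "bij_betw (\<lambda>t. i + Suc t) S {j. i < j \<and> (i, j) \<in> Y}"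
    by (rule bij_betw_byWitness[where f' = "\<lambda>j. j - Suc i"]) (auto simp: S_def)
  then have "card S = arm Y i" unfolding arm_def by (rule bij_betw_same_card)
  then have "t \<in> S \<longleftrightarrow> t < arm Y i" using S by auto
  then show ?thesis using Suc by (auto simp: S_def)
qed

lemma arm_decreasing:
  assumes Y: "diagram Y" and ij: "i < j" and j: "(j, j) \<in> Y"
  shows "arm Y j < arm Y i"
proof -
  have "(j, j + arm Y j) \<in> Y" using arm_iff[OF Y j] by blast
  then have "(i, i + (j - i + arm Y j)) \<in> Y" using diagram_down[OF Y] ij by simp
  moreover have "(i, i) \<in> Y" using diagram_down[OF Y j] ij by simp
  ultimately have "j - i + arm Y j \<le> arm Y i" using arm_iff[OF Y] by blast
  then show ?thesis using ij by simp
qed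

lemma card_content_nonneg:
  assumes Y: "diagram Y"
  shows "card {x \<in> Y. content x = int t} = card {i. i < card {i. (i, i) \<in> Y} \<and> t \<le> arm Y i}"
proof (rule bij_betw_same_card)
  have mem: "(i, i + t) \<in> Y \<longleftrightarrow> i < card {i. (i, i) \<in> Y} \<and> t \<le> arm Y i" for i
    unfolding diagonal_iff[OF Y] using arm_iff[OF Y, of i t] diagram_down[OF Y, of i "i + t" i i] by auto
  show "bij_betw fst {x \<in> Y. content x = int t} {i. i < card {i. (i, i) \<in> Y} \<and> t \<le> arm Y i}"
  proof (rule bij_betw_byWitness[where f' = "\<lambda>i. (i, i + t)"])
    show "fst ` {x \<in> Y. content x = int t} \<subseteq> {i. i < card {i. (i, i) \<in> Y} \<and> t \<le> arm Y i}"
    proof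
      fix i assume "i \<in> fst ` {x \<in> Y. content x = int t}"
      then obtain j where "(i, j) \<in> Y" "int j - int i = int t" by (auto simp: content_def)
      moreover from this have "j = i + t" by simp
      ultimately show "i \<in> {i. i < card {i. (i, i) \<in> Y} \<and> t \<le> arm Y i}" using mem by simp
    qed
    show "(\<lambda>i. (i, i + t)) ` {i. i < card {i. (i, i) \<in> Y} \<and> t \<le> arm Y i} \<subseteq> {x \<in> Y. content x = int t}"
    proof
      fix x assume "x \<in> (\<lambda>i. (i, i + t)) ` {i. i < card {i. (i, i) \<in> Y} \<and> t \<le> arm Y i}"
      then obtain i where "x = (i, i + t)" "i < card {i. (i, i) \<in> Y} \<and> t \<le> arm Y i" by blast
      then show "x \<in> {x \<in> Y. content x = int t}" unfolding mem[symmetric] by (simp add: content_def)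
    qed
    show "\<forall>x\<in>{x \<in> Y. content x = int t}. (fst x, fst x + t) = x" by (auto simp: content_def)
  qed simp
qed

lemma card_content_nonpos:
  assumes Y: "diagram Y"
  shows "card {x \<in> Y. content x = - int t} = card {i. i < card {i. (i, i) \<in> Y} \<and> t \<le> arm (Y\<inverse>) i}"
proof -
  have "card {x \<in> Y. content x = - int t} = card {x \<in> Y\<inverse>. content x = int t}"
    by (rule bij_betw_same_card[of prod.swap], rule bij_betw_byWitness[where f' = prod.swap])
      (auto simp: content_def)
  then show ?thesis using card_content_nonneg[OF diagram_converse[OF Y], of t] by simp
qed

text \<open>For contents \<open>t + m\<close> and \<open>- t\<close> with \<open>t \<ge> 0\<close> the symmetry compares the numbers of \<open>i\<close> with
\<open>arm Y i \<ge> t + m\<close> and with \<open>arm (Y\<inverse>) i \<ge> t\<close>. Both sets of \<open>i\<close> are initial segments, so equal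
cardinality for every \<open>t\<close> means equality of the two sets.\<close>

lemma content_symmetric_iff:
  assumes Y: "diagram Y"
  shows "(\<forall>c. card {x \<in> Y. content x = c} = card {x \<in> Y. int m - content x = c}) \<longleftrightarrow>
    (\<forall>i < card {i. (i, i) \<in> Y}. arm Y i = arm (Y\<inverse>) i + m)"
proof -
  define r where "r = card {i. (i, i) \<in> Y}"
  define N where "N c = card {x \<in> Y. content x = c}" for c
  have "{x \<in> Y. int m - content x = c} = {x \<in> Y. content x = int m - c}" for c by auto
  then have lhs: "(\<forall>c. card {x \<in> Y. content x = c} = card {x \<in> Y. int m - content x = c}) \<longleftrightarrow>
      (\<forall>c. N c = N (int m - c))" by (simp add: N_def)
  have pos: "N (int t) = card {i. i < r \<and> t \<le> arm Y i}"
    and neg: "N (- int t) = card {i. i < r \<and> t \<le> arm (Y\<inverse>) i}" for t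
    unfolding N_def r_def by (rule card_content_nonneg[OF Y] card_content_nonpos[OF Y])+
  have diag: "(i, i) \<in> Y" if "i < r" for i using diagonal_iff[OF Y] that by (simp add: r_def)
  have dec: "{i. i < r \<and> t \<le> arm Z i} = {..<card {i. i < r \<and> t \<le> arm Z i}}" if Z: "Z = Y \<or> Z = Y\<inverse>" for t Z
  proof (rule down_closed_card)
    fix i j assume j: "j \<in> {i. i < r \<and> t \<le> arm Z i}" and "i \<le> j"
    have "diagram Z" "(j, j) \<in> Z" using Z Y diagram_converse[OF Y] diag j by auto
    then have "arm Z j \<le> arm Z i" using arm_decreasing[of Z i j] \<open>i \<le> j\<close> by (cases "i = j") auto
    then show "i \<in> {i. i < r \<and> t \<le> arm Z i}" using j \<open>i \<le> j\<close> by simp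
  qed simp
  show ?thesis
    unfolding lhs r_def[symmetric]
  proof (intro iffI allI impI)
    fix i assume sym: "\<forall>c. N c = N (int m - c)" and i: "i < r"
    have "card {i. i < r \<and> t + m \<le> arm Y i} = card {i. i < r \<and> t \<le> arm (Y\<inverse>) i}" for t
      using sym[rule_format, of "int (t + m)"] pos[of "t + m"] neg[of t] by simp
    then have "{i. i < r \<and> t + m \<le> arm Y i} = {i. i < r \<and> t \<le> arm (Y\<inverse>) i}" for t
      using dec[of Y "t + m"] dec[of "Y\<inverse>" t] by simp
    then have key: "t + m \<le> arm Y i \<longleftrightarrow> t \<le> arm (Y\<inverse>) i" for t using i by blast
    show "arm Y i = arm (Y\<inverse>) i + m"
      using key[of "arm (Y\<inverse>) i"] key[of "arm Y i - m"] by simp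
  next
    fix c assume eq: "\<forall>i<r. arm Y i = arm (Y\<inverse>) i + m"
    have upper: "N (int (t + m)) = N (- int t)" for t
      unfolding pos neg using eq by (intro arg_cong[of _ _ card]) auto
    have mid: "N (int t) = r" if "t \<le> m" for t
    proof -
      have "{i. i < r \<and> t \<le> arm Y i} = {..<r}" using eq that by auto
      then show ?thesis unfolding pos by simp
    qed
    consider "c < 0" | "0 \<le> c" "c \<le> int m" | "int m < c" by linarith
    then show "N c = N (int m - c)"
    proof cases
      case 1
      then show ?thesis using upper[of "nat (- c)"] by simp
    next
      case 2
      then show ?thesis using mid[of "nat c"] mid[of "nat (int m - c)"] by simp
    next
      case 3
      then show ?thesis using upper[of "nat (c - int m)"] by simp
    qed
  qed
qed

lemma frobenius_iff:
  assumes p: "is_partition p"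
  defines "Y \<equiv> young_diagram p"
  shows "(\<exists>\<alpha>. sorted_wrt (>) \<alpha> \<and> frobenius p = (map (\<lambda>a. a + m) \<alpha>, \<alpha>)) \<longleftrightarrow>
    (\<forall>i < card {i. (i, i) \<in> Y}. arm Y i = arm (Y\<inverse>) i + m)"
proof -
  define r where "r = card {i. (i, i) \<in> Y}"
  have Y: "diagram Y" unfolding Y_def by (rule diagram_young_diagram[OF p])
  have frob: "frobenius p = (map (arm Y) [0..<r], map (arm (Y\<inverse>)) [0..<r])"
    by (simp add: frobenius_def diagonal_length_def r_def Y_def arm_def[abs_def])
  have sorted: "sorted_wrt (>) (map (arm (Y\<inverse>)) [0..<r])"
    unfolding sorted_wrt_iff_nth_less
  proof (intro allI impI)
    fix i j assume ij: "i < j" "j < length (map (arm (Y\<inverse>)) [0..<r])"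
    then have "(j, j) \<in> Y\<inverse>" using diagonal_iff[OF Y, of j] by (simp add: r_def)
    then have "arm (Y\<inverse>) j < arm (Y\<inverse>) i"
      using arm_decreasing[OF diagram_converse[OF Y]] ij(1) by blast
    then show "map (arm (Y\<inverse>)) [0..<r] ! j < map (arm (Y\<inverse>)) [0..<r] ! i" using ij by simp
  qed
  have "(\<exists>\<alpha>. sorted_wrt (>) \<alpha> \<and> frobenius p = (map (\<lambda>a. a + m) \<alpha>, \<alpha>)) \<longleftrightarrow>
      map (arm Y) [0..<r] = map (\<lambda>a. a + m) (map (arm (Y\<inverse>)) [0..<r])"
    unfolding frob using sorted by auto
  also have "\<dots> \<longleftrightarrow> (\<forall>i < r. arm Y i = arm (Y\<inverse>) i + m)"
    by auto
  finally show ?thesis by (simp add: r_def)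
qed

theorem theorem2p2:
  fixes m :: nat and p :: "nat list"
  assumes "is_partition p"
  shows "(\<forall>n. dim_F n p = dim_F (n + m) (conjugate_partition p)) \<longleftrightarrow>
         (\<exists>\<alpha>. sorted_wrt (>) \<alpha> \<and> frobenius p = (map (\<lambda>a. a + m) \<alpha>, \<alpha>))"
  unfolding dim_F_eq_iff[OF assms] prods_eq_iff[OF finite_young_diagram]
    content_symmetric_iff[OF diagram_young_diagram[OF assms]] frobenius_iff[OF assms] ..

end
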